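(* Let $N\ge 1$, $T>0$, $\rho\in(0,1)$ and $a>\frac N2$. Let $\varphi\in C(\mathbb{T}^N)\cap L_2^{a-2}(\mathbb{T}^N)$. Let $f(x,t)$ be a continuous function of $(x,t)\in\mathbb{T}^N\times(0,T]$ such that $f(\cdot,t)\in L_2^a(\mathbb{T}^N)$ for $0<t\le T$ and $\|t^{1-\rho}f(\cdot,t)\|^2_{L_2^a(\mathbb{T}^N)}\in C[0,T]$ as a function of $t$. Then there exists a solution $u$ of the initial-boundary value problem $$\partial_t^\rho u(x,t)-\Delta u(x,t)=f(x,t),\quad x\in\mathbb{T}^N,\ 0<t\le T,$$ $$\lim_{t\to0}\partial_t^{\rho-1}u(x,t)=\varphi(x),\quad x\in\mathbb{T}^N,$$ and it has the form $$u(x,t)=\sum_{n\in\mathbb{Z}^N}\bigg[\varphi_n t^{\rho-1}E_{\rho,\rho}(-|n|^2t^\rho)+\int_0^t f_n(t-\xi)\,\xi^{\rho-1}E_{\rho,\rho}(-|n|^2\xi^\rho)\,d\xi\bigg]e^{inx},$$ where the series converges absolutely and uniformly in $x\in\mathbb{T}^N$ for each $t\in(0,T]$, and where $\varphi_n$ and $f_n(t)$ are the Fourier coefficients of $\varphi$ and $f(\cdot,t)$. Moreover, the series obtained from it by applying the operators $\partial_t^\rho$ and $A=-\Delta$ term by term also converge absolutely and uniformly in $x\in\mathbb{T}^N$ for each $t\in(0,T]$.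
   Context: Torus and function classes: $\mathbb{T}^N=(-\pi,\pi]^N$ is the $N$-dimensional torus; $C(\mathbb{T}^N)$ and $C^2(\mathbb{T}^N)$ denote the continuous, respectively twice continuously differentiable, functions that are $2\pi$-periodic in each variable $x_j$. Spaces such as $C(\mathbb{T}^N\times(0,T])$ are understood with the same periodicity in $x$. $A v=-\Delta v$ for $v\in C^2(\mathbb{T}^N)$, with $\Delta$ the Laplace operator in $x$. For $n\in\mathbb{Z}^N$, $|n|^2=n_1^2+\dots+n_N^2$ and $nx=n_1x_1+\dots+n_Nx_N$. Fourier coefficients: $g_n=(2\pi)^{-N}\int_{\mathbb{T}^N}g(x)e^{-inx}\,dx$; $f_n(t)$ are the Fourier coefficients of $f(\cdot,t)$. Liouville classes: for a real number $b$, $L_2^b(\mathbb{T}^N)$ is the class of functions $g\in L_2(\mathbb{T}^N)$ for which $$\|g\|^2_{L_2^b(\mathbb{T}^N)}=\sum_{n\in\mathbb{Z}^N}(1+|n|^2)^b|g_n|^2<\infty$$ (so for $b\le0$ this condition is automatically satisfied by every $g\in L_2(\mathbb{T}^N)$, in particular by every $g\in C(\mathbb{T}^N)$). The condition $\|t^{1-\rho}f(\cdot,t)\|^2_{L_2^a(\mathbb{T}^N)}\in C[0,T]$ means that this function of $t\in(0,T]$ is continuous and extends continuously to $[0,T]$. Fractional operators: for $\sigma<0$ the fractional integral of order $\sigma$ is $$\partial_t^\sigma h(t)=\frac{1}{\Gamma(-\sigma)}\int_0^t\frac{h(\xi)}{(t-\xi)^{\sigma+1}}\,d\xi,\quad t>0,$$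 provided the right-hand side exists, where $\Gamma$ is Euler's gamma function. For $0<\rho<1$ the Riemann–Liouville derivative of order $\rho$ is $\partial_t^\rho h(t)=\frac{d}{dt}\partial_t^{\rho-1}h(t)$. For functions of $(x,t)$ these act in $t$ with $x$ fixed. Mittag-Leffler function: $E_{\rho,\mu}(t)=\sum_{k=0}^\infty\frac{t^k}{\Gamma(\rho k+\mu)}$. Solution: a function $u(x,t)$ is called a solution of the initial-boundary value problem if $\partial_t^\rho u(x,t),\ Au(x,t)\in C(\mathbb{T}^N\times(0,T])$, $\partial_t^{\rho-1}u(x,t)\in C(\mathbb{T}^N\times[0,T])$ (with the value at $t=0$ understood as the limit $t\to0$), and $u$ satisfies the equation and the initial condition of the problem. *)

theory Defs
  imports "HOL-Analysis.Analysis"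
begin

text \<open>Functions on the torus are represented by functions on the whole space that are
  \<open>2\<pi>\<close>-periodic in each variable; integrals are taken over the fundamental cell.
  The dimension is \<open>CARD('n)\<close>.\<close>

definition torus :: "(real ^ 'n) set" where
  "torus = {x. \<forall>j. - pi < x $ j \<and> x $ j \<le> pi}"

definition periodic :: "(real ^ 'n \<Rightarrow> complex) \<Rightarrow> bool" where
  "periodic g \<longleftrightarrow> (\<forall>x j. g (x + axis j (2 * pi)) = g x)"

definition C_torus :: "(real ^ 'n \<Rightarrow> complex) set" where
  "C_torus = {g. periodic g \<and> continuous_on UNIV g}"

definition C_torus_time :: "real set \<Rightarrow> (real ^ 'n \<Rightarrow> real \<Rightarrow> complex) set" where
  "C_torus_time I = {F. (\<forall>t\<in>I. periodic (\<lambda>x. F x t)) \<and>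
     continuous_on (UNIV \<times> I) (\<lambda>(x, t). F x t)}"

definition partial_differentiable :: "'n \<Rightarrow> (real ^ 'n \<Rightarrow> complex) \<Rightarrow> real ^ 'n \<Rightarrow> bool" where
  "partial_differentiable j g x \<longleftrightarrow> (\<lambda>s::real. g (x + axis j s)) differentiable (at 0)"

definition partial :: "'n \<Rightarrow> (real ^ 'n \<Rightarrow> complex) \<Rightarrow> real ^ 'n \<Rightarrow> complex" where
  "partial j g x = vector_derivative (\<lambda>s::real. g (x + axis j s)) (at 0)"

definition C1_torus :: "(real ^ 'n \<Rightarrow> complex) set" where
  "C1_torus = {g \<in> C_torus. \<forall>j. (\<forall>x. partial_differentiable j g x) \<and> partial j g \<in> C_torus}"

definition C2_torus :: "(real ^ 'n \<Rightarrow> complex) set" where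
  "C2_torus = {g \<in> C1_torus. \<forall>j. partial j g \<in> C1_torus}"

definition laplacian :: "(real ^ 'n \<Rightarrow> complex) \<Rightarrow> real ^ 'n \<Rightarrow> complex" where
  "laplacian g x = (\<Sum>j\<in>UNIV. partial j (partial j g) x)"

text \<open>The operator \<open>A\<close>, meaningful for functions in \<open>C2_torus\<close>.\<close>

definition A_op :: "(real ^ 'n \<Rightarrow> complex) \<Rightarrow> real ^ 'n \<Rightarrow> complex" where
  "A_op g x = - laplacian g x"

text \<open>Embedding the multi-indices into Euclidean space, \<open>nx\<close> becomes \<open>real_vec n \<bullet> x\<close> and
  \<open>|n|\<^sup>2\<close> becomes \<open>(norm (real_vec n))\<^sup>2\<close>.\<close>

definition real_vec :: "int ^ 'n \<Rightarrow> real ^ 'n" where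
  "real_vec n = (\<chi> j. real_of_int (n $ j))"

definition fourier_coeff :: "(real ^ 'n \<Rightarrow> complex) \<Rightarrow> int ^ 'n \<Rightarrow> complex" where
  "fourier_coeff g n =
     set_lebesgue_integral lborel torus (\<lambda>x. g x * cis (- (real_vec n \<bullet> x))) /
     (2 * pi) ^ CARD('n)"

definition L2_torus :: "(real ^ 'n \<Rightarrow> complex) set" where
  "L2_torus = {g. set_borel_measurable lborel torus g \<and>
     set_integrable lborel torus (\<lambda>x. (norm (g x))\<^sup>2)}"

definition liouville_summand :: "real \<Rightarrow> (real ^ 'n \<Rightarrow> complex) \<Rightarrow> int ^ 'n \<Rightarrow> real" where
  "liouville_summand b g n = (1 + (norm (real_vec n))\<^sup>2) powr b * (norm (fourier_coeff g n))\<^sup>2"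

definition L2b_torus :: "real \<Rightarrow> (real ^ 'n \<Rightarrow> complex) set" where
  "L2b_torus b = {g \<in> L2_torus. liouville_summand b g summable_on UNIV}"

definition L2b_norm_sq :: "real \<Rightarrow> (real ^ 'n \<Rightarrow> complex) \<Rightarrow> real" where
  "L2b_norm_sq b g = (\<Sum>\<^sub>\<infinity>n. liouville_summand b g n)"

definition frac_integral_exists :: "real \<Rightarrow> (real \<Rightarrow> complex) \<Rightarrow> real \<Rightarrow> bool" where
  "frac_integral_exists \<sigma> h t \<longleftrightarrow>
     set_integrable lborel {0<..<t} (\<lambda>\<xi>. h \<xi> /\<^sub>R (t - \<xi>) powr (\<sigma> + 1))"

text \<open>Meaningful for orders \<open>\<sigma> < 0\<close> only.\<close>

definition frac_integral :: "real \<Rightarrow> (real \<Rightarrow> complex) \<Rightarrow> real \<Rightarrow> complex" where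
  "frac_integral \<sigma> h t =
     set_lebesgue_integral lborel {0<..<t} (\<lambda>\<xi>. h \<xi> /\<^sub>R (t - \<xi>) powr (\<sigma> + 1)) /\<^sub>R Gamma (- \<sigma>)"

text \<open>The Riemann--Liouville derivative of order \<open>\<rho>\<close>, \<open>0 < \<rho> < 1\<close>, of a function on
  \<open>(0,T]\<close>: at \<open>t = T\<close> the outer derivative is one-sided.\<close>

definition rl_differentiable :: "real \<Rightarrow> real \<Rightarrow> (real \<Rightarrow> complex) \<Rightarrow> bool" where
  "rl_differentiable T \<rho> h \<longleftrightarrow> (\<forall>t\<in>{0<..T}. frac_integral_exists (\<rho> - 1) h t \<and>
     frac_integral (\<rho> - 1) h differentiable (at t within {0<..T}))"

definition rl_deriv :: "real \<Rightarrow> real \<Rightarrow> (real \<Rightarrow> complex) \<Rightarrow> real \<Rightarrow> complex" where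
  "rl_deriv T \<rho> h t = vector_derivative (frac_integral (\<rho> - 1) h) (at t within {0<..T})"

definition mittag_leffler :: "real \<Rightarrow> real \<Rightarrow> real \<Rightarrow> real" where
  "mittag_leffler \<rho> \<mu> z = (\<Sum>k. z ^ k / Gamma (\<rho> * real k + \<mu>))"

definition is_solution ::
  "real \<Rightarrow> real \<Rightarrow> (real ^ 'n \<Rightarrow> complex) \<Rightarrow> (real ^ 'n \<Rightarrow> real \<Rightarrow> complex) \<Rightarrow>
   (real ^ 'n \<Rightarrow> real \<Rightarrow> complex) \<Rightarrow> bool" where
  "is_solution T \<rho> \<phi> f u \<longleftrightarrow>
     (\<forall>x. rl_differentiable T \<rho> (u x)) \<and>
     (\<lambda>x. rl_deriv T \<rho> (u x)) \<in> C_torus_time {0<..T} \<and>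
     (\<forall>t\<in>{0<..T}. (\<lambda>x. u x t) \<in> C2_torus) \<and>
     (\<lambda>x t. A_op (\<lambda>y. u y t) x) \<in> C_torus_time {0<..T} \<and>
     (\<exists>v\<in>C_torus_time {0..T}. \<forall>x. \<forall>t\<in>{0<..T}. v x t = frac_integral (\<rho> - 1) (u x) t) \<and>
     (\<forall>x. \<forall>t\<in>{0<..T}. rl_deriv T \<rho> (u x) t - laplacian (\<lambda>y. u y t) x = f x t) \<and>
     (\<forall>x. (frac_integral (\<rho> - 1) (u x) \<longlongrightarrow> \<phi> x) (at_right 0))"

definition duhamel_integrand ::
  "real \<Rightarrow> (real ^ 'n \<Rightarrow> real \<Rightarrow> complex) \<Rightarrow> int ^ 'n \<Rightarrow> real \<Rightarrow> real \<Rightarrow> complex" where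
  "duhamel_integrand \<rho> f n t \<xi> = fourier_coeff (\<lambda>x. f x (t - \<xi>)) n *
     complex_of_real (\<xi> powr (\<rho> - 1) *
       mittag_leffler \<rho> \<rho> (- ((norm (real_vec n))\<^sup>2 * \<xi> powr \<rho>)))"

definition series_term ::
  "real \<Rightarrow> (real ^ 'n \<Rightarrow> complex) \<Rightarrow> (real ^ 'n \<Rightarrow> real \<Rightarrow> complex) \<Rightarrow> int ^ 'n \<Rightarrow>
   real ^ 'n \<Rightarrow> real \<Rightarrow> complex" where
  "series_term \<rho> \<phi> f n x t =
     (fourier_coeff \<phi> n * complex_of_real (t powr (\<rho> - 1) *
        mittag_leffler \<rho> \<rho> (- ((norm (real_vec n))\<^sup>2 * t powr \<rho>)))
      + set_lebesgue_integral lborel {0<..<t} (duhamel_integrand \<rho> f n t)) *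
     cis (real_vec n \<bullet> x)"

text \<open>Absolute convergence at every point, and uniform convergence of the unordered partial
  sums (the net over finite sets of multi-indices).\<close>

definition converges_abs_unif :: "(int ^ 'n \<Rightarrow> real ^ 'n \<Rightarrow> complex) \<Rightarrow> bool" where
  "converges_abs_unif w \<longleftrightarrow>
     (\<forall>x. (\<lambda>n. norm (w n x)) summable_on UNIV) \<and>
     uniform_limit UNIV (\<lambda>M x. \<Sum>n\<in>M. w n x) (\<lambda>x. \<Sum>\<^sub>\<infinity>n. w n x)
       (finite_subsets_at_top UNIV)"

end

theory Submission
  imports Defs
begin

text \<open>
  On the Fourier mode \<open>n\<close> the problem is a scalar fractional equation with rate \<open>l = \<bar>n\<bar>\<^sup>2\<close>. It is solved by
  \<open>\<phi>\<^sub>n e + f\<^sub>n * e\<close>, where \<open>e(t) = t\<^sup>\<rho>\<^sup>-\<^sup>1 E\<^sub>\<rho>\<^sub>,\<^sub>\<rho>(- l t\<^sup>\<rho>)\<close> and \<open>*\<close> is convolution on the half-line. Its fractional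
  integral of order \<open>1 - \<rho>\<close> is \<open>\<phi>\<^sub>n E + f\<^sub>n * E\<close> with \<open>E(t) = E\<^sub>\<rho>(- l t\<^sup>\<rho>)\<close>, and the derivative of that is
  \<open>f\<^sub>n - l (\<phi>\<^sub>n e + f\<^sub>n * e)\<close>. So each term of the series satisfies the equation, and the work is to sum the
  modes. There are three difficulties.

  The first is the decay of \<open>e\<close>. Positivity comes from an extremum principle: at a negative minimum a
  function has a negative Riemann-Liouville derivative
  (\<open>rl_derivative_negative_at_negative_minimum\<close>). Positivity makes \<open>E\<close> decreasing and bounds it by a
  multiple of \<open>1 / (l t\<^sup>\<rho>)\<close>. The identity \<open>t e = \<rho> (e * E)\<close> then gives \<open>e(t) \<le> C t\<^sup>-\<^sup>1\<^sup>-\<^sup>\<rho> / l\<^sup>2\<close> in two rounds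
  (\<open>ml_kernel_decay\<close>).

  The second is convergence. With the weight \<open>w = 1 + \<bar>n\<bar>\<^sup>2\<close>, the quadratic decay turns \<open>w \<bar>\<phi>\<^sub>n\<bar> e\<close> into
  \<open>\<bar>\<phi>\<^sub>n\<bar> / w\<close>, which is summable by the Cauchy-Schwarz inequality because \<open>\<phi>\<close> is in the class of order
  \<open>a - 2\<close> and the sum of \<open>w\<^sup>-\<^sup>a\<close> over the lattice converges. For the source, interpolation gives
  \<open>w e(s) \<le> C w\<^sup>\<epsilon> s\<^sup>\<epsilon>\<^sup>\<rho>\<^sup>-\<^sup>1\<close>, which is integrable at \<open>0\<close> and costs an arbitrarily small power of \<open>w\<close>. A bound of
  this kind for all finite sets of modes, uniform in \<open>t\<close>, gives uniform convergence
  (\<open>uniform_limit_sqrt_tail\<close>, \<open>mode_weighted_sum\<close>), and with it the smoothness in \<open>x\<close>, the interchange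
  of sums with the operators, and, since an absolutely convergent Fourier series represents its
  function (\<open>fourier_series_eq\<close>), the differential equation.

  The third is the initial condition, where \<open>\<phi>\<close> is merely continuous and its Fourier series may
  diverge. The extremum principle also yields a maximum principle for the time-fractional heat
  equation with a trigonometric polynomial as initial value (\<open>trig_relax_max_principle\<close>). Hence the
  solution operator is a contraction in the supremum norm, uniformly in time, and approximation of
  \<open>\<phi>\<close> by trigonometric polynomials gives continuity up to \<open>t = 0\<close> (\<open>relax_series_continuous\<close>).
\<close>

section \<open>The Mittag-Leffler function and fractional integrals of its kernels\<close>

text \<open>Euler's integral over \<open>[R, R + 1]\<close> alone gives this. Since \<open>R\<close> is arbitrary, \<open>\<Gamma>\<close> beats every
  exponential, so the Mittag-Leffler series is entire.\<close>

lemma Gamma_ge_powr: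
  fixes x R :: real
  assumes "x \<ge> 1" "R \<ge> 0"
  shows "R powr (x - 1) * exp (- (R + 1)) \<le> Gamma x"
proof -
  have c: "((\<lambda>t. R powr (x - 1) * exp (- (R + 1))) has_integral
      (R + 1 - R) *\<^sub>R (R powr (x - 1) * exp (- (R + 1)))) {R..R + 1}"
    using has_integral_const_real[of "R powr (x - 1) * exp (- (R + 1))" R "R + 1"] by simp
  have ig: "(\<lambda>t. t powr (x - 1) / exp t) integrable_on {0..}"
    using Gamma_integral_real[of x] assms by (auto simp: integrable_on_def)
  have "((\<lambda>t. t powr (x - 1) / exp t) integrable_on {R..R + 1})"
    by (intro integrable_on_subinterval[OF ig]) (use assms in auto)
  then have i: "((\<lambda>t. t powr (x - 1) / exp t) has_integral
      integral {R..R + 1} (\<lambda>t. t powr (x - 1) / exp t)) {R..R + 1}"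
    by (rule integrable_integral)
  have "R powr (x - 1) * exp (- (R + 1)) \<le> integral {R..R + 1} (\<lambda>t. t powr (x - 1) / exp t)"
  proof -
    have "(R + 1 - R) *\<^sub>R (R powr (x - 1) * exp (- (R + 1)))
        \<le> integral {R..R + 1} (\<lambda>t. t powr (x - 1) / exp t)"
    proof (rule has_integral_le[OF c i])
      fix t assume t: "t \<in> {R..R + 1}"
      have "R powr (x - 1) \<le> t powr (x - 1)"
        using t assms by (intro powr_mono2) auto
      moreover have "exp (- (R + 1)) \<le> exp (- t)" using t by auto
      ultimately show "R powr (x - 1) * exp (- (R + 1)) \<le> t powr (x - 1) / exp t"
        unfolding divide_inverse exp_minus[symmetric] by (intro mult_mono) auto
    qed
    then show ?thesis by simp
  qed
  also have "\<dots> \<le> Gamma x"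
    by (rule has_integral_subset_le[OF _ i Gamma_integral_real]) (use assms in auto)
  finally show ?thesis .
qed

lemma mittag_leffler_summable:
  fixes \<rho> \<mu> z :: real
  assumes "\<rho> > 0" "\<mu> > 0"
  shows "summable (\<lambda>k. z ^ k / Gamma (\<rho> * real k + \<mu>))"
proof -
  \<comment> \<open>This choice makes the terms decay like a geometric sequence of ratio below one half.\<close>
  define R where "R = (2 * \<bar>z\<bar> + 1) powr (1 / \<rho>)"
  have R: "R > 0" "R powr \<rho> = 2 * \<bar>z\<bar> + 1"
    using assms by (auto simp: R_def powr_powr)
  define C where "C = exp (R + 1) * R powr (1 - \<mu>)"
  have "eventually (\<lambda>k. norm (z ^ k / Gamma (\<rho> * real k + \<mu>)) \<le> C * (1 / 2) ^ k) sequentially"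
  proof -
    have "filterlim (\<lambda>k. \<rho> * real k + \<mu>) at_top sequentially"
      using assms by real_asymp
    then have "eventually (\<lambda>k. \<rho> * real k + \<mu> \<ge> 1) sequentially"
      by (auto simp: filterlim_at_top)
    then show ?thesis
    proof eventually_elim
      case (elim k)
      have "R powr (\<rho> * real k + \<mu> - 1) * exp (- (R + 1)) \<le> Gamma (\<rho> * real k + \<mu>)"
        using Gamma_ge_powr[OF elim, of R] R by simp
      moreover have "R powr (\<rho> * real k + \<mu> - 1) * exp (- (R + 1)) = (2 * \<bar>z\<bar> + 1) ^ k / C"
      proof -
        have "R powr (\<rho> * real k + \<mu> - 1) = (R powr \<rho>) powr real k / R powr (1 - \<mu>)"
          using R(1) by (simp add: powr_powr powr_diff powr_add)
        also have "\<dots> = (2 * \<bar>z\<bar> + 1) ^ k / R powr (1 - \<mu>)"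
          using R by (simp add: powr_realpow)
        finally show ?thesis by (simp only: C_def exp_minus) (simp add: field_simps)
      qed
      ultimately have G: "(2 * \<bar>z\<bar> + 1) ^ k / C \<le> Gamma (\<rho> * real k + \<mu>)" by simp
      have C: "C > 0" using R by (simp add: C_def)
      have "norm (z ^ k / Gamma (\<rho> * real k + \<mu>)) = \<bar>z\<bar> ^ k / Gamma (\<rho> * real k + \<mu>)"
        using elim Gamma_real_pos[of "\<rho> * real k + \<mu>"] by (simp add: power_abs)
      also have "\<dots> \<le> \<bar>z\<bar> ^ k / ((2 * \<bar>z\<bar> + 1) ^ k / C)"
        using C by (intro divide_left_mono G mult_pos_pos Gamma_real_pos) (use elim in auto)
      also have "\<dots> = C * (\<bar>z\<bar> / (2 * \<bar>z\<bar> + 1)) ^ k"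
        by (simp add: power_divide)
      also have "\<dots> \<le> C * (1 / 2) ^ k"
        using C by (intro mult_left_mono power_mono) (auto simp: field_simps)
      finally show ?case .
    qed
  qed
  then show ?thesis
    by (rule summable_comparison_test_ev) (auto intro!: summable_mult summable_geometric)
qed

text \<open>Convolution with \<open>power_kernel \<alpha>\<close> on the half-line is the fractional integral of order
  \<open>\<alpha>\<close>. Among the kernels \<open>t\<^sup>\<mu>\<^sup>-\<^sup>1 E\<^sub>\<rho>\<^sub>,\<^sub>\<mu>(- l t\<^sup>\<rho>)\<close>, the one with \<open>\<mu> = \<rho>\<close> is the impulse response \<open>e\<close> of the
  fractional relaxation equation with rate \<open>l\<close>, and the one with \<open>\<mu> = 1\<close> is its relaxation
  function \<open>E\<close>, the fractional integral of \<open>e\<close> of order \<open>1 - \<rho>\<close>.\<close>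

definition power_kernel :: "real \<Rightarrow> real \<Rightarrow> real" where
  "power_kernel \<alpha> s = s powr (\<alpha> - 1) / Gamma \<alpha>"

definition ml_kernel :: "real \<Rightarrow> real \<Rightarrow> real \<Rightarrow> real \<Rightarrow> real" where
  "ml_kernel \<rho> \<mu> l s = s powr (\<mu> - 1) * mittag_leffler \<rho> \<mu> (- (l * s powr \<rho>))"

definition half_conv ::
  "(real \<Rightarrow> real) \<Rightarrow> (real \<Rightarrow> 'a) \<Rightarrow> real \<Rightarrow> 'a::{banach, second_countable_topology}" where
  "half_conv k g t = set_lebesgue_integral lborel {0<..<t} (\<lambda>s. k (t - s) *\<^sub>R g s)"

lemma mittag_leffler_sums:
  assumes "\<rho> > 0" "\<mu> > 0"
  shows "(\<lambda>k. z ^ k / Gamma (\<rho> * real k + \<mu>)) sums mittag_leffler \<rho> \<mu> z"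
  unfolding mittag_leffler_def by (intro summable_sums mittag_leffler_summable assms)

lemma mittag_leffler_powser:
  assumes "\<rho> > 0" "\<mu> > 0"
  shows "mittag_leffler \<rho> \<mu> z = (\<Sum>k. (1 / Gamma (\<rho> * real k + \<mu>)) * z ^ k)"
  unfolding mittag_leffler_def by (simp add: mult.commute)

lemma mittag_leffler_0 [simp]: "mittag_leffler \<rho> \<mu> 0 = 1 / Gamma \<mu>"
  unfolding mittag_leffler_def by (subst suminf_finite[of "{0}"]) auto

lemma mittag_leffler_rec:
  assumes "\<rho> > 0" "\<mu> > 0"
  shows "mittag_leffler \<rho> \<mu> z = 1 / Gamma \<mu> + z * mittag_leffler \<rho> (\<mu> + \<rho>) z"
proof -
  have "mittag_leffler \<rho> \<mu> z = (\<Sum>k. z ^ Suc k / Gamma (\<rho> * real (Suc k) + \<mu>)) + 1 / Gamma \<mu>"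
    unfolding mittag_leffler_def
    by (subst suminf_split_head[OF mittag_leffler_summable[OF assms]]) simp
  also have "(\<Sum>k. z ^ Suc k / Gamma (\<rho> * real (Suc k) + \<mu>)) =
      (\<Sum>k. z * (z ^ k / Gamma (\<rho> * real k + (\<mu> + \<rho>))))"
    by (simp add: algebra_simps)
  also have "\<dots> = z * mittag_leffler \<rho> (\<mu> + \<rho>) z"
    unfolding mittag_leffler_def using assms
    by (intro suminf_mult mittag_leffler_summable) auto
  finally show ?thesis by simp
qed

text \<open>Comparing coefficients, the identity reduces to \<open>\<Gamma>(x + 1) = x \<Gamma>(x)\<close> at \<open>x = \<rho> k + \<mu>\<close>. It is the
  combination that appears when \<open>t\<^sup>\<mu> E\<^sub>\<rho>\<^sub>,\<^sub>\<mu>\<^sub>+\<^sub>1(- l t\<^sup>\<rho>)\<close> is differentiated.\<close>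

lemma mittag_leffler_has_derivative:
  assumes "\<rho> > 0" "\<mu> > 0"
  shows "\<exists>D. ((mittag_leffler \<rho> (\<mu> + 1)) has_real_derivative D) (at z) \<and>
     \<mu> * mittag_leffler \<rho> (\<mu> + 1) z + \<rho> * z * D = mittag_leffler \<rho> \<mu> z"
proof -
  define c where "c = (\<lambda>k. 1 / Gamma (\<rho> * real k + (\<mu> + 1)))"
  have s: "summable (\<lambda>k. c k * z ^ k)" for z
    using mittag_leffler_summable[of \<rho> "\<mu> + 1" z] assms by (simp add: c_def)
  have E: "mittag_leffler \<rho> (\<mu> + 1) = (\<lambda>z. \<Sum>k. c k * z ^ k)"
    using mittag_leffler_powser[of \<rho> "\<mu> + 1"] assms by (auto simp: c_def)
  have D: "(mittag_leffler \<rho> (\<mu> + 1) has_real_derivative (\<Sum>k. diffs c k * z ^ k)) (at z)"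
    unfolding E by (rule termdiffs_strong_converges_everywhere[OF s])
  have sd: "summable (\<lambda>k. diffs c k * z ^ k)"
    by (rule termdiff_converges_all[OF s])
  have "(\<lambda>k. z * (diffs c k * z ^ k)) sums (z * (\<Sum>k. diffs c k * z ^ k))"
    by (intro sums_mult summable_sums sd)
  then have "(\<lambda>k. real (Suc k) * c (Suc k) * z ^ Suc k) sums (z * (\<Sum>k. diffs c k * z ^ k))"
    by (simp add: diffs_def mult_ac)
  then have "(\<lambda>k. real k * c k * z ^ k) sums (z * (\<Sum>k. diffs c k * z ^ k))"
    using sums_Suc_iff[of "\<lambda>k. real k * c k * z ^ k"] by simp
  then have "(\<lambda>k. \<mu> * (c k * z ^ k) + \<rho> * (real k * c k * z ^ k)) sums
      (\<mu> * (\<Sum>k. c k * z ^ k) + \<rho> * (z * (\<Sum>k. diffs c k * z ^ k)))"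
    by (intro sums_add sums_mult summable_sums s)
  moreover have "\<mu> * (c k * z ^ k) + \<rho> * (real k * c k * z ^ k) = z ^ k / Gamma (\<rho> * real k + \<mu>)" for k
  proof -
    have p: "\<rho> * real k + \<mu> > 0" using assms by (intro add_nonneg_pos) auto
    have "Gamma (\<rho> * real k + (\<mu> + 1)) = (\<rho> * real k + \<mu>) * Gamma (\<rho> * real k + \<mu>)"
      using Gamma_plus1[of "\<rho> * real k + \<mu>"] p
      by (metis add.assoc less_irrefl nonpos_Ints_nonpos not_le)
    then have "c k = 1 / ((\<rho> * real k + \<mu>) * Gamma (\<rho> * real k + \<mu>))" by (simp add: c_def)
    moreover have "\<mu> * (c k * z ^ k) + \<rho> * (real k * c k * z ^ k) = (\<rho> * real k + \<mu>) * c k * z ^ k"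
      by (simp add: algebra_simps)
    ultimately show ?thesis using p by simp
  qed
  ultimately have "(\<lambda>k. z ^ k / Gamma (\<rho> * real k + \<mu>)) sums
      (\<mu> * (\<Sum>k. c k * z ^ k) + \<rho> * (z * (\<Sum>k. diffs c k * z ^ k)))" by simp
  from sums_unique2[OF this mittag_leffler_sums[OF assms]]
  show ?thesis using D by (intro exI[of _ "\<Sum>k. diffs c k * z ^ k"]) (simp add: E)
qed

lemma continuous_on_mittag_leffler [continuous_intros]:
  assumes "\<rho> > 0" "\<mu> > 0" "continuous_on A g"
  shows "continuous_on A (\<lambda>x. mittag_leffler \<rho> \<mu> (g x))"
proof -
  define c where "c = (\<lambda>k. 1 / Gamma (\<rho> * real k + \<mu>))"
  have s: "summable (\<lambda>k. c k * z ^ k)" for z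
    using mittag_leffler_summable[of \<rho> "\<mu>" z] assms by (simp add: c_def)
  have E: "mittag_leffler \<rho> \<mu> = (\<lambda>z. \<Sum>k. c k * z ^ k)"
    using mittag_leffler_powser[of \<rho> "\<mu>"] assms by (auto simp: c_def)
  have "isCont (mittag_leffler \<rho> \<mu>) z" for z
    unfolding E by (rule isCont_powser_converges_everywhere[OF s])
  then have "continuous_on UNIV (mittag_leffler \<rho> \<mu>)"
    by (simp add: continuous_on_eq_continuous_at)
  from continuous_on_compose2[OF this assms(3)] show ?thesis by simp
qed

lemma continuous_on_ml_kernel:
  assumes "\<rho> > 0" "\<mu> > 0" 
  shows "continuous_on {0<..} (ml_kernel \<rho> \<mu> l)"
  unfolding ml_kernel_def using assms by (intro continuous_intros) auto

lemma borel_measurable_ml_kernel [measurable]: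
  assumes "\<rho> > 0" "\<mu> > 0"
  shows "ml_kernel \<rho> \<mu> l \<in> borel_measurable borel"
proof -
  have "mittag_leffler \<rho> \<mu> \<in> borel_measurable borel"
    using continuous_on_mittag_leffler[OF assms continuous_on_id]
    by (intro borel_measurable_continuous_onI) auto
  then have [measurable]: "mittag_leffler \<rho> \<mu> \<in> borel_measurable borel" .
  show ?thesis unfolding ml_kernel_def by measurable
qed

lemma borel_measurable_power_kernel [measurable]: "power_kernel \<alpha> \<in> borel_measurable borel"
  unfolding power_kernel_def by measurable

text \<open>For \<open>\<mu> = \<rho>\<close> and \<open>\<mu> = 1\<close> these are the Volterra equations of \<open>e\<close> and \<open>E\<close>, because the last kernel is
  the fractional integral of order \<open>\<rho>\<close> of the first one.\<close>

lemma ml_kernel_rec: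
  assumes "\<rho> > 0" "\<mu> > 0" "s > 0"
  shows "ml_kernel \<rho> \<mu> l s = power_kernel \<mu> s - l * ml_kernel \<rho> (\<mu> + \<rho>) l s"
  using assms by (simp add: ml_kernel_def power_kernel_def mittag_leffler_rec[of \<rho> \<mu>] powr_add
      powr_diff field_simps)

lemma ml_kernel_has_derivative:
  assumes "\<rho> > 0" "\<mu> > 0" "s > 0"
  shows "(ml_kernel \<rho> (\<mu> + 1) l has_real_derivative ml_kernel \<rho> \<mu> l s) (at s)"
proof -
  define z where "z = - (l * s powr \<rho>)"
  obtain D where D: "((mittag_leffler \<rho> (\<mu> + 1)) has_real_derivative D) (at z)"
     "\<mu> * mittag_leffler \<rho> (\<mu> + 1) z + \<rho> * z * D = mittag_leffler \<rho> \<mu> z"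
    using mittag_leffler_has_derivative[OF assms(1,2)] by blast
  have z: "((\<lambda>s. - (l * s powr \<rho>)) has_real_derivative - (l * (\<rho> * s powr (\<rho> - 1)))) (at s)"
    using assms by (auto intro!: derivative_eq_intros simp: powr_diff)
  have "((\<lambda>s. mittag_leffler \<rho> (\<mu> + 1) (- (l * s powr \<rho>))) has_real_derivative
      D * - (l * (\<rho> * s powr (\<rho> - 1)))) (at s)"
    using DERIV_chain2[OF _ z] D(1) by (simp add: z_def)
  moreover have "((\<lambda>s. s powr \<mu>) has_real_derivative \<mu> * s powr (\<mu> - 1)) (at s)"
    using assms by (auto intro!: derivative_eq_intros simp: powr_diff)
  ultimately have "((\<lambda>s. s powr \<mu> * mittag_leffler \<rho> (\<mu> + 1) (- (l * s powr \<rho>))) has_real_derivative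
      (\<mu> * s powr (\<mu> - 1)) * mittag_leffler \<rho> (\<mu> + 1) z + (D * - (l * (\<rho> * s powr (\<rho> - 1)))) * s powr \<mu>) (at s)"
    unfolding z_def by (rule DERIV_mult[rotated])
  moreover have "(\<mu> * s powr (\<mu> - 1)) * mittag_leffler \<rho> (\<mu> + 1) z + (D * - (l * (\<rho> * s powr (\<rho> - 1)))) * s powr \<mu>
     = ml_kernel \<rho> \<mu> l s"
    unfolding ml_kernel_def z_def[symmetric] D(2)[symmetric]
    using assms by (simp add: z_def powr_diff field_simps)
  ultimately show ?thesis unfolding ml_kernel_def by simp
qed

text \<open>After the substitution \<open>s = t x\<close> this is Euler's Beta integral. It says that fractional
  integrals compose by adding orders.\<close>

lemma has_bochner_integral_power_kernel:
  fixes \<alpha> \<beta> t :: real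
  assumes "\<alpha> > 0" "\<beta> > 0" "t > 0"
  shows "has_bochner_integral lborel
     (\<lambda>s. indicator {0<..<t} s *\<^sub>R (power_kernel \<alpha> (t - s) * power_kernel \<beta> s)) (power_kernel (\<alpha> + \<beta>) t)"
proof -
  have i: "set_integrable lborel {0..1} (\<lambda>x. x powr (\<beta> - 1) * (1 - x) powr (\<alpha> - 1))"
    by (rule integrable_Beta) (use assms in auto)
  then have v: "set_lebesgue_integral lborel {0..1} (\<lambda>x. x powr (\<beta> - 1) * (1 - x) powr (\<alpha> - 1)) = Beta \<beta> \<alpha>"
    using has_integral_Beta_real[of \<beta> \<alpha>] assms
    by (metis integral_unique set_borel_integral_eq_integral(2))
  have "has_bochner_integral lborel
      (\<lambda>x. indicator {0..1} x *\<^sub>R (x powr (\<beta> - 1) * (1 - x) powr (\<alpha> - 1))) (Beta \<beta> \<alpha>)"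
    using i v by (simp add: has_bochner_integral_iff set_integrable_def set_lebesgue_integral_def)
  also have "?this \<longleftrightarrow> has_bochner_integral lborel
      (\<lambda>x. indicator {0<..<1} x *\<^sub>R (x powr (\<beta> - 1) * (1 - x) powr (\<alpha> - 1))) (Beta \<beta> \<alpha>)"
    by (rule has_bochner_integral_cong) (auto simp: indicator_def)
  finally have B: "has_bochner_integral lborel
      (\<lambda>x. (t powr (\<alpha> + \<beta> - 2) / (Gamma \<alpha> * Gamma \<beta>)) *
        (indicator {0<..<1} x *\<^sub>R (x powr (\<beta> - 1) * (1 - x) powr (\<alpha> - 1))))
      ((t powr (\<alpha> + \<beta> - 2) / (Gamma \<alpha> * Gamma \<beta>)) * Beta \<beta> \<alpha>)"
    by (intro has_bochner_integral_mult_right)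
  have v2: "(t powr (\<alpha> + \<beta> - 2) / (Gamma \<alpha> * Gamma \<beta>)) * Beta \<beta> \<alpha> = power_kernel (\<alpha> + \<beta>) t /\<^sub>R \<bar>t\<bar>"
    using assms Gamma_real_pos[of \<alpha>, THEN less_imp_neq] Gamma_real_pos[of \<beta>, THEN less_imp_neq]
    by (simp add: Beta_def power_kernel_def powr_diff powr_add field_simps power2_eq_square)
  have f2: "(t powr (\<alpha> + \<beta> - 2) / (Gamma \<alpha> * Gamma \<beta>)) *
        (indicator {0<..<1} x *\<^sub>R (x powr (\<beta> - 1) * (1 - x) powr (\<alpha> - 1))) =
      indicator {0<..<t} (0 + t * x) *\<^sub>R (power_kernel \<alpha> (t - (0 + t * x)) * power_kernel \<beta> (0 + t * x))" for x
  proof (cases "x \<in> {0<..<1}")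
    case True
    have "t - t * x = t * (1 - x)" by (simp add: algebra_simps)
    then have "(t - t * x) powr \<alpha> = t powr \<alpha> * (1 - x) powr \<alpha>"
      using assms True by (simp only: powr_mult)
    moreover have "t * x < t" "0 < t * x" using True assms by auto
    ultimately show ?thesis using assms True
      by (simp add: power_kernel_def powr_mult powr_diff powr_add field_simps power2_eq_square)
  next
    case False
    then have "t * x \<notin> {0<..<t}" using assms by (auto simp: mult_less_cancel_left1 zero_less_mult_iff)
    then show ?thesis using False by auto
  qed
  show ?thesis
    using B unfolding v2 f2 using assms
    by (subst lborel_has_bochner_integral_real_affine_iff[where c = t and t = 0]) auto
qed

lemma power_kernel_nonneg: "\<alpha> > 0 \<Longrightarrow> power_kernel \<alpha> s \<ge> 0"
  unfolding power_kernel_def using Gamma_real_pos[of \<alpha>] by simp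

lemma power_kernel_1: "s > 0 \<Longrightarrow> power_kernel 1 s = 1"
  by (simp add: power_kernel_def)

lemma ml_kernel_sums:
  assumes "\<rho> > 0" "\<mu> > 0" "s > 0"
  shows "(\<lambda>k. (- l) ^ k * power_kernel (\<rho> * real k + \<mu>) s) sums ml_kernel \<rho> \<mu> l s"
proof -
  have "(\<lambda>k. s powr (\<mu> - 1) * ((- (l * s powr \<rho>)) ^ k / Gamma (\<rho> * real k + \<mu>))) sums ml_kernel \<rho> \<mu> l s"
    unfolding ml_kernel_def by (intro sums_mult mittag_leffler_sums assms)
  moreover have "s powr (\<mu> - 1) * ((- (l * s powr \<rho>)) ^ k / Gamma (\<rho> * real k + \<mu>)) =
      (- l) ^ k * power_kernel (\<rho> * real k + \<mu>) s" for k
  proof -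
    have "(- (l * s powr \<rho>)) ^ k = ((- l) * s powr \<rho>) ^ k" by simp
    also have "\<dots> = (- l) ^ k * s powr (\<rho> * real k)"
      using assms powr_realpow[of "s powr \<rho>" k] powr_powr[of s \<rho> "real k"]
      by (simp only: power_mult_distrib) simp
    finally have "(- (l * s powr \<rho>)) ^ k = (- l) ^ k * s powr (\<rho> * real k)" .
    then show ?thesis by (simp add: power_kernel_def powr_add powr_diff)
  qed
  ultimately show ?thesis by simp
qed

lemma ml_kernel_norm_summable:
  assumes "\<rho> > 0" "\<mu> > 0" "s > 0"
  shows "summable (\<lambda>k. norm ((- l) ^ k * power_kernel (\<rho> * real k + \<mu>) s))"
proof -
  have "norm ((- l) ^ k * power_kernel (\<rho> * real k + \<mu>) s) =
      (- (- \<bar>l\<bar>)) ^ k * power_kernel (\<rho> * real k + \<mu>) s" for k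
    using power_kernel_nonneg[of "\<rho> * real k + \<mu>" s] assms
    by (simp add: abs_mult power_abs add_nonneg_pos)
  then show ?thesis
    using sums_summable[OF ml_kernel_sums[OF assms, of "- \<bar>l\<bar>"]] by simp
qed

lemma set_integral_sums:
  fixes g :: "nat \<Rightarrow> 'b \<Rightarrow> 'a :: {banach, second_countable_topology}"
  assumes i: "\<And>k. set_integrable M A (g k)"
    and s: "\<And>x. x \<in> A \<Longrightarrow> (\<lambda>k. g k x) sums G x" 
    and ns: "\<And>x. x \<in> A \<Longrightarrow> summable (\<lambda>k. norm (g k x))" 
    and n: "summable (\<lambda>k. set_lebesgue_integral M A (\<lambda>x. norm (g k x)))"
  shows "set_integrable M A G"
    and "(\<lambda>k. set_lebesgue_integral M A (g k)) sums set_lebesgue_integral M A G"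
proof -
  have 1: "AE x in M. summable (\<lambda>k. norm (indicator A x *\<^sub>R g k x))"
    using ns by (intro AE_I2) (auto simp: indicator_def)
  have 2: "summable (\<lambda>k. LINT x|M. norm (indicator A x *\<^sub>R g k x))"
    using n by (simp add: set_lebesgue_integral_def)
  have E: "indicator A x *\<^sub>R G x = (\<Sum>k. indicator A x *\<^sub>R g k x)" for x
    using s[of x] by (auto simp: indicator_def sums_iff)
  show "set_integrable M A G" unfolding set_integrable_def E
    by (rule integrable_suminf[OF i[unfolded set_integrable_def] 1 2])
  show "(\<lambda>k. set_lebesgue_integral M A (g k)) sums set_lebesgue_integral M A G"
    unfolding set_lebesgue_integral_def E
    by (rule sums_integral[OF i[unfolded set_integrable_def] 1 2])
qed

text \<open>A Mittag-Leffler kernel is a power series in power kernels, so the composition rule for fractional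
  integrals applies term by term; the series of absolute values is the kernel for \<open>- \<bar>l\<bar>\<close>.\<close>

lemma half_conv_power_ml_kernel:
  assumes "\<rho> > 0" "\<mu> > 0" "\<alpha> > 0" "t > 0"
  shows "set_integrable lborel {0<..<t} (\<lambda>s. power_kernel \<alpha> (t - s) *\<^sub>R ml_kernel \<rho> \<mu> l s)"
    and "half_conv (power_kernel \<alpha>) (ml_kernel \<rho> \<mu> l) t = ml_kernel \<rho> (\<mu> + \<alpha>) l t"
proof -
  let ?g = "\<lambda>k s. (- l) ^ k * (power_kernel \<alpha> (t - s) * power_kernel (\<rho> * real k + \<mu>) s)"
  have pos: "\<rho> * real k + \<mu> > 0" for k using assms by (simp add: add_nonneg_pos)
  have B: "set_integrable lborel {0<..<t} (\<lambda>s. power_kernel \<alpha> (t - s) * power_kernel (\<rho> * real k + \<mu>) s)"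
      "set_lebesgue_integral lborel {0<..<t} (\<lambda>s. power_kernel \<alpha> (t - s) * power_kernel (\<rho> * real k + \<mu>) s)
        = power_kernel (\<rho> * real k + (\<mu> + \<alpha>)) t" for k
    using has_bochner_integral_power_kernel[OF assms(3) pos assms(4), of k]
    by (simp_all add: has_bochner_integral_iff set_integrable_def set_lebesgue_integral_def add_ac)
  have n: "norm (?g k s) = \<bar>l\<bar> ^ k * (power_kernel \<alpha> (t - s) * power_kernel (\<rho> * real k + \<mu>) s)" for k s
    using power_kernel_nonneg[OF pos, of k s] power_kernel_nonneg[OF assms(3), of "t - s"]
    by (simp add: abs_mult power_abs)
  have i: "set_integrable lborel {0<..<t} (?g k)" for k
    using B(1) by simp
  have s: "(\<lambda>k. ?g k s) sums (power_kernel \<alpha> (t - s) * ml_kernel \<rho> \<mu> l s)" if "s \<in> {0<..<t}" for s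
    using sums_mult[OF ml_kernel_sums[OF assms(1,2), of s l], of "power_kernel \<alpha> (t - s)"] that
    by (simp add: mult_ac)
  have ns: "summable (\<lambda>k. norm (?g k s))" if "s \<in> {0<..<t}" for s
  proof -
    have "summable (\<lambda>k. norm (power_kernel \<alpha> (t - s)) * norm ((- l) ^ k * power_kernel (\<rho> * real k + \<mu>) s))"
      by (intro summable_mult ml_kernel_norm_summable) (use assms that in auto)
    also have "(\<lambda>k. norm (power_kernel \<alpha> (t - s)) * norm ((- l) ^ k * power_kernel (\<rho> * real k + \<mu>) s)) =
        (\<lambda>k. norm (?g k s))"
      by (simp only: norm_mult mult_ac)
    finally show ?thesis .
  qed
  have "(\<lambda>k. (- (- \<bar>l\<bar>)) ^ k * power_kernel (\<rho> * real k + (\<mu> + \<alpha>)) t) sums ml_kernel \<rho> (\<mu> + \<alpha>) (- \<bar>l\<bar>) t"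
    by (rule ml_kernel_sums) (use assms in auto)
  then have ni: "summable (\<lambda>k. set_lebesgue_integral lborel {0<..<t} (\<lambda>s. norm (?g k s)))"
    unfolding n using B(2) by (simp add: sums_iff)
  note S = set_integral_sums[OF i s ns ni]
  show "set_integrable lborel {0<..<t} (\<lambda>s. power_kernel \<alpha> (t - s) *\<^sub>R ml_kernel \<rho> \<mu> l s)"
    using S(1) by simp
  have "(\<lambda>k. (- l) ^ k * power_kernel (\<rho> * real k + (\<mu> + \<alpha>)) t) sums
      half_conv (power_kernel \<alpha>) (ml_kernel \<rho> \<mu> l) t"
    unfolding half_conv_def using S(2) B(2) by simp
  moreover have "(\<lambda>k. (- l) ^ k * power_kernel (\<rho> * real k + (\<mu> + \<alpha>)) t) sums ml_kernel \<rho> (\<mu> + \<alpha>) l t"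
    by (rule ml_kernel_sums) (use assms in auto)
  ultimately show "half_conv (power_kernel \<alpha>) (ml_kernel \<rho> \<mu> l) t = ml_kernel \<rho> (\<mu> + \<alpha>) l t"
    by (rule sums_unique2)
qed

text \<open>In the Cauchy product of the two series, each of the \<open>m + 1\<close> terms of degree \<open>m\<close> has the same
  integral, and the factor \<open>m + 1\<close> is absorbed by the functional equation of \<open>\<Gamma>\<close>. The identity
  expresses \<open>t e(t)\<close> by quantities whose decay is known, which yields the decay of \<open>e\<close>.\<close>

lemma half_conv_ml_kernel_ml_kernel:
  assumes "\<rho> > 0" "t > 0"
  shows "set_integrable lborel {0<..<t} (\<lambda>s. ml_kernel \<rho> \<rho> l (t - s) *\<^sub>R ml_kernel \<rho> 1 l s)"
    and "half_conv (ml_kernel \<rho> \<rho> l) (ml_kernel \<rho> 1 l) t = t * ml_kernel \<rho> \<rho> l t / \<rho>"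
proof -
  let ?p = "\<lambda>m s. \<Sum>i\<le>m. power_kernel (\<rho> * real i + \<rho>) (t - s) * power_kernel (\<rho> * real (m - i) + 1) s"
  let ?g = "\<lambda>m s. (- l) ^ m * ?p m s"
  have pos: "\<rho> * real k + \<rho> > 0" "\<rho> * real k + 1 > 0" for k using assms by (simp_all add: add_nonneg_pos)
  have p0: "?p m s \<ge> 0" for m s
    by (intro sum_nonneg mult_nonneg_nonneg power_kernel_nonneg pos)
  have Q: "real (Suc m) * power_kernel (\<rho> * real (Suc m) + 1) t = t / \<rho> * power_kernel (\<rho> * real m + \<rho>) t" for m
  proof -
    have x: "\<rho> * real (Suc m) = \<rho> * real m + \<rho>" by (simp add: algebra_simps)
    have "Gamma ((\<rho> * real m + \<rho>) + 1) = (\<rho> * real m + \<rho>) * Gamma (\<rho> * real m + \<rho>)"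
      using Gamma_plus1[of "\<rho> * real m + \<rho>"] pos(1)[of m] by (metis less_irrefl nonpos_Ints_nonpos not_le)
    then show ?thesis using assms pos(1)[of m] unfolding power_kernel_def x
      by (simp add: powr_diff divide_simps) (simp add: x[symmetric] algebra_simps)
  qed
  have B: "set_integrable lborel {0<..<t} (?p m)"
      "set_lebesgue_integral lborel {0<..<t} (?p m) = t / \<rho> * power_kernel (\<rho> * real m + \<rho>) t" for m
  proof -
    have b: "set_integrable lborel {0<..<t} (\<lambda>s. power_kernel (\<rho> * real i + \<rho>) (t - s) * power_kernel (\<rho> * real (m - i) + 1) s)"
      "set_lebesgue_integral lborel {0<..<t} (\<lambda>s. power_kernel (\<rho> * real i + \<rho>) (t - s) * power_kernel (\<rho> * real (m - i) + 1) s)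
         = power_kernel (\<rho> * real (Suc m) + 1) t" if "i \<le> m" for i
    proof -
      have "\<rho> * real i + \<rho> + (\<rho> * real (m - i) + 1) = \<rho> * real (Suc m) + 1"
        using that by (simp add: of_nat_diff algebra_simps)
      then show "set_integrable lborel {0<..<t} (\<lambda>s. power_kernel (\<rho> * real i + \<rho>) (t - s) * power_kernel (\<rho> * real (m - i) + 1) s)"
        "set_lebesgue_integral lborel {0<..<t} (\<lambda>s. power_kernel (\<rho> * real i + \<rho>) (t - s) * power_kernel (\<rho> * real (m - i) + 1) s)
         = power_kernel (\<rho> * real (Suc m) + 1) t"
        using has_bochner_integral_power_kernel[OF pos(1)[of i] pos(2)[of "m - i"] assms(2)]
        by (simp_all only: has_bochner_integral_iff set_integrable_def set_lebesgue_integral_def)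
    qed
    show "set_integrable lborel {0<..<t} (?p m)"
      using b(1) unfolding set_integrable_def scaleR_sum_right
      by (intro Bochner_Integration.integrable_sum) auto
    have "set_lebesgue_integral lborel {0<..<t} (?p m) =
        (\<Sum>i\<le>m. power_kernel (\<rho> * real (Suc m) + 1) t)"
      using b unfolding set_integrable_def set_lebesgue_integral_def scaleR_sum_right
      by (subst Bochner_Integration.integral_sum) (auto intro!: sum.cong)
    also have "\<dots> = real (Suc m) * power_kernel (\<rho> * real (Suc m) + 1) t" by simp
    finally show "set_lebesgue_integral lborel {0<..<t} (?p m) = t / \<rho> * power_kernel (\<rho> * real m + \<rho>) t"
      unfolding Q .
  qed
  have n: "norm (?g m s) = (- (- \<bar>l\<bar>)) ^ m * ?p m s" for m s
    using p0[of s m] by (simp add: abs_mult power_abs)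
  have i: "set_integrable lborel {0<..<t} (?g k)" for k
    using B(1) by simp
  have s: "(\<lambda>m. (- l) ^ m * ?p m s) sums (ml_kernel \<rho> \<rho> l (t - s) * ml_kernel \<rho> 1 l s)" if "s \<in> {0<..<t}" for s l :: real
  proof -
    have "(\<lambda>m. \<Sum>i\<le>m. ((- l) ^ i * power_kernel (\<rho> * real i + \<rho>) (t - s)) *
        ((- l) ^ (m - i) * power_kernel (\<rho> * real (m - i) + 1) s)) sums
       ((\<Sum>k. (- l) ^ k * power_kernel (\<rho> * real k + \<rho>) (t - s)) *
        (\<Sum>k. (- l) ^ k * power_kernel (\<rho> * real k + 1) s))"
      by (rule Cauchy_product_sums; rule ml_kernel_norm_summable) (use assms that in auto)
    moreover have "(\<Sum>k. (- l) ^ k * power_kernel (\<rho> * real k + \<rho>) (t - s)) = ml_kernel \<rho> \<rho> l (t - s)"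
      by (rule sums_unique[symmetric], rule ml_kernel_sums) (use assms that in auto)
    moreover have "(\<Sum>k. (- l) ^ k * power_kernel (\<rho> * real k + 1) s) = ml_kernel \<rho> 1 l s"
      by (rule sums_unique[symmetric], rule ml_kernel_sums) (use assms that in auto)
    moreover have "(\<Sum>i\<le>m. ((- l) ^ i * power_kernel (\<rho> * real i + \<rho>) (t - s)) *
        ((- l) ^ (m - i) * power_kernel (\<rho> * real (m - i) + 1) s)) = (- l) ^ m * ?p m s" for m
    proof -
      have e: "(- l) ^ i * (- l) ^ (m - i) = (- l) ^ m" if "i \<le> m" for i
        using that by (simp flip: power_add)
      have "((- l) ^ i * x) * ((- l) ^ (m - i) * y) = (- l) ^ m * (x * y)" if "i \<le> m" for i x y
        unfolding e[OF that, symmetric] by (simp only: mult_ac)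
      then show ?thesis unfolding sum_distrib_left by (intro sum.cong) auto
    qed
    ultimately show ?thesis by simp
  qed
  have ns: "summable (\<lambda>k. norm (?g k x))" if "x \<in> {0<..<t}" for x
    unfolding n using s[OF that, of "- \<bar>l\<bar>"] by (simp add: sums_iff)
  have fin: "(\<lambda>k. t / \<rho> * ((- l) ^ k * power_kernel (\<rho> * real k + \<rho>) t)) sums (t / \<rho> * ml_kernel \<rho> \<rho> l t)" for l
    by (intro sums_mult ml_kernel_sums) (use assms in auto)
  have ni: "summable (\<lambda>k. set_lebesgue_integral lborel {0<..<t} (\<lambda>s. norm (?g k s)))"
    unfolding n using fin[of "- \<bar>l\<bar>"] B(2) by (simp add: sums_iff mult_ac)
  note S = set_integral_sums[OF i s ns ni]
  show "set_integrable lborel {0<..<t} (\<lambda>s. ml_kernel \<rho> \<rho> l (t - s) *\<^sub>R ml_kernel \<rho> 1 l s)"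
    using S(1) by simp
  have "(\<lambda>k. t / \<rho> * ((- l) ^ k * power_kernel (\<rho> * real k + \<rho>) t)) sums
      half_conv (ml_kernel \<rho> \<rho> l) (ml_kernel \<rho> 1 l) t"
    unfolding half_conv_def using S(2) B(2) by (simp add: mult_ac)
  from sums_unique2[OF this fin]
  show "half_conv (ml_kernel \<rho> \<rho> l) (ml_kernel \<rho> 1 l) t = t * ml_kernel \<rho> \<rho> l t / \<rho>" by simp
qed

lemma power_kernel_has_derivative:
  assumes "\<alpha> > 0" "s > 0"
  shows "(power_kernel (\<alpha> + 1) has_real_derivative power_kernel \<alpha> s) (at s)"
proof -
  have "Gamma (\<alpha> + 1) = \<alpha> * Gamma \<alpha>" 
    using Gamma_plus1[of "\<alpha>"] assms by (metis less_irrefl nonpos_Ints_nonpos not_le)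
  moreover have "((\<lambda>s. s powr \<alpha> / Gamma (\<alpha> + 1)) has_real_derivative (\<alpha> * s powr (\<alpha> - 1)) / Gamma (\<alpha> + 1)) (at s)"
    by (rule DERIV_cdivide) (use assms in \<open>auto intro!: derivative_eq_intros simp: powr_diff\<close>)
  ultimately show ?thesis using assms by (simp add: power_kernel_def[abs_def])
qed

text \<open>The extremum principle for the Riemann-Liouville derivative. Write \<open>h = h(t\<^sub>0) + w\<close> with \<open>w \<ge> 0\<close>.
  The constant part contributes a negative derivative. For the \<open>w\<close> part, moving the endpoint forward
  to \<open>t\<^sub>0\<close> only lowers the weights of the past, and the newly added piece is of order
  \<open>(t\<^sub>0 - t)\<^sup>2\<^sup>-\<^sup>\<rho>\<close>, since \<open>w\<close> vanishes linearly at \<open>t\<^sub>0\<close>.\<close>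

lemma rl_derivative_negative_at_negative_minimum:
  fixes h :: "real \<Rightarrow> real"
  assumes \<rho>: "0 < \<rho>" "\<rho> < 1" and t0: "t0 > 0"
    and hd: "(h has_real_derivative H) (at_left t0)"
    and int: "\<And>t. 0 < t \<Longrightarrow> t \<le> t0 \<Longrightarrow>
       set_integrable lborel {0<..<t} (\<lambda>s. power_kernel (1 - \<rho>) (t - s) *\<^sub>R h s)"
    and min: "\<And>s. 0 < s \<Longrightarrow> s \<le> t0 \<Longrightarrow> h t0 \<le> h s" and neg: "h t0 < 0"
    and D: "(half_conv (power_kernel (1 - \<rho>)) h has_real_derivative D) (at_left t0)"
  shows "D < 0"
proof -
  define k where "k = power_kernel (1 - \<rho>)"
  define P where "P = power_kernel (2 - \<rho>)"
  define m where "m = h t0"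
  define C where "C = (\<bar>H\<bar> + 1) / Gamma (1 - \<rho>)"
  have G: "Gamma (1 - \<rho>) > 0" using \<rho> by (intro Gamma_real_pos) auto
  have knn: "k s \<ge> 0" for s using \<rho> by (auto simp: k_def intro: power_kernel_nonneg)
  have "((\<lambda>s. (h s - h t0) / (s - t0)) \<longlongrightarrow> H) (at_left t0)"
    using hd by (simp add: has_field_derivative_iff)
  then have "eventually (\<lambda>s. \<bar>(h s - h t0) / (s - t0) - H\<bar> < 1) (at_left t0)"
    using tendstoD[of _ H _ 1] by (auto simp: dist_real_def)
  then obtain b where b: "b < t0" "\<And>s. b < s \<Longrightarrow> s < t0 \<Longrightarrow> \<bar>(h s - h t0) / (s - t0) - H\<bar> < 1"
    unfolding eventually_at_left_field by blast
  have lip: "h s - m \<le> (\<bar>H\<bar> + 1) * (t0 - s)" if "b < s" "s < t0" for s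
  proof -
    have "\<bar>(h s - h t0) / (s - t0)\<bar> \<le> \<bar>H\<bar> + 1" using b(2)[OF that] by linarith
    then have "\<bar>h s - h t0\<bar> \<le> (\<bar>H\<bar> + 1) * \<bar>s - t0\<bar>"
      using that by (simp add: field_simps)
    then show ?thesis using that by (simp add: m_def)
  qed
  have one: "set_integrable lborel {0<..<t} (\<lambda>s. k (t - s))"
     "set_lebesgue_integral lborel {0<..<t} (\<lambda>s. k (t - s)) = P t" if "t > 0" for t
  proof -
    have "has_bochner_integral lborel (\<lambda>s. indicator {0<..<t} s *\<^sub>R (power_kernel (1 - \<rho>) (t - s) * power_kernel 1 s))
        (power_kernel (1 - \<rho> + 1) t)"
      by (rule has_bochner_integral_power_kernel) (use \<rho> that in auto)
    also have "(\<lambda>s. indicator {0<..<t} s *\<^sub>R (power_kernel (1 - \<rho>) (t - s) * power_kernel 1 s)) =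
        (\<lambda>s. indicator {0<..<t} s *\<^sub>R k (t - s))"
      by (auto simp: indicator_def power_kernel_1 k_def)
    finally show "set_integrable lborel {0<..<t} (\<lambda>s. k (t - s))"
     "set_lebesgue_integral lborel {0<..<t} (\<lambda>s. k (t - s)) = P t"
      by (simp_all add: has_bochner_integral_iff set_integrable_def set_lebesgue_integral_def P_def)
  qed
  define W where "W = (\<lambda>t. set_lebesgue_integral lborel {0<..<t} (\<lambda>s. k (t - s) * (h s - m)))"
  have Wi: "set_integrable lborel {0<..<t} (\<lambda>s. k (t - s) * (h s - m))"
    and K: "half_conv k h t = m * P t + W t" if "0 < t" "t \<le> t0" for t
  proof -
    have 1: "set_integrable lborel {0<..<t} (\<lambda>s. k (t - s) * h s)" using int[OF that] by (simp add: k_def)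
    have 2: "set_integrable lborel {0<..<t} (\<lambda>s. k (t - s) * m)" using one(1)[of t] that by simp
    show "set_integrable lborel {0<..<t} (\<lambda>s. k (t - s) * (h s - m))"
      using set_integral_diff(1)[OF 1 2] by (simp add: right_diff_distrib)
    show "half_conv k h t = m * P t + W t"
      using set_integral_diff(2)[OF 1 2] one(2)[of t] that
      unfolding W_def half_conv_def real_scaleR_def right_diff_distrib
      by (simp add: mult.commute)
  qed
  have key: "half_conv k h t0 - half_conv k h t \<le> m * (P t0 - P t) + C * (t0 - t) powr (1 - \<rho>) * (t0 - t)"
    if t: "b < t" "0 < t" "t < t0" for t
  proof -
    define c where "c = C * (t0 - t) powr (1 - \<rho>)"
    have ci: "integrable lborel (\<lambda>s. indicator {t..t0} s * c)"
      "(LINT s|lborel. indicator {t..t0} s * c) = c * (t0 - t)"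
      using t by simp_all
    have "W t0 \<le> (LINT s|lborel. indicator {0<..<t} s *\<^sub>R (k (t - s) * (h s - m)) + indicator {t..t0} s * c)"
      unfolding W_def set_lebesgue_integral_def
    proof (rule integral_mono)
      show "integrable lborel (\<lambda>s. indicator {0<..<t0} s *\<^sub>R (k (t0 - s) * (h s - m)))"
        using Wi[of t0] t0 by (simp add: set_integrable_def)
      show "integrable lborel (\<lambda>s. indicator {0<..<t} s *\<^sub>R (k (t - s) * (h s - m)) + indicator {t..t0} s * c)"
        using Wi[of t] t ci(1) by (auto simp: set_integrable_def)
      fix s :: real
      consider "s \<le> 0 \<or> s > t0 \<or> s = t0" | "0 < s" "s < t" | "t \<le> s" "s < t0" by linarith
      then show "indicator {0<..<t0} s *\<^sub>R (k (t0 - s) * (h s - m)) \<le>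
          indicator {0<..<t} s *\<^sub>R (k (t - s) * (h s - m)) + indicator {t..t0} s * c"
      proof cases
        case 1
        have "c \<ge> 0" using G by (simp add: c_def C_def)
        then show ?thesis using 1 t by (auto simp: indicator_def)
      next
        case 2
        have "k (t0 - s) \<le> k (t - s)"
          using 2 t \<rho> G unfolding k_def power_kernel_def
          by (intro divide_right_mono powr_mono2') auto
        moreover have "h s \<ge> m" using min[of s] 2 t by (simp add: m_def)
        ultimately show ?thesis using 2 t by (auto intro: mult_right_mono)
      next
        case 3
        have "k (t0 - s) * (h s - m) \<le> k (t0 - s) * ((\<bar>H\<bar> + 1) * (t0 - s))"
          using lip[of s] 3 t knn by (intro mult_left_mono) auto
        also have "\<dots> = C * (t0 - s) powr (1 - \<rho>)"
          using 3 by (simp add: k_def power_kernel_def C_def powr_diff powr_minus field_simps)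
        also have "\<dots> \<le> C * (t0 - t) powr (1 - \<rho>)"
          using 3 \<rho> G by (intro mult_left_mono powr_mono2) (auto simp: C_def)
        finally show ?thesis using 3 t by (simp add: c_def)
      qed
    qed
    also have "\<dots> = W t + c * (t0 - t)"
      unfolding W_def set_lebesgue_integral_def
      using Wi[of t] t ci by (subst Bochner_Integration.integral_add) (auto simp: set_integrable_def)
    finally show ?thesis using K[of t0] K[of t] t t0 by (simp add: c_def algebra_simps)
  qed
  have "((\<lambda>t. (half_conv k h t - half_conv k h t0) / (t - t0)) \<longlongrightarrow> D) (at_left t0)"
    using D by (simp add: has_field_derivative_iff k_def)
  moreover have "((\<lambda>t. m * ((P t - P t0) / (t - t0)) + C * (t0 - t) powr (1 - \<rho>)) \<longlongrightarrow> m * k t0 + C * 0) (at_left t0)"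
  proof (intro tendsto_add tendsto_mult tendsto_const)
    have "(power_kernel (1 - \<rho> + 1) has_real_derivative power_kernel (1 - \<rho>) t0) (at t0)"
      by (rule power_kernel_has_derivative) (use \<rho> t0 in auto)
    then have "(P has_real_derivative k t0) (at_left t0)"
      unfolding P_def k_def using \<rho> by (auto intro: has_field_derivative_at_within)
    then show "((\<lambda>t. (P t - P t0) / (t - t0)) \<longlongrightarrow> k t0) (at_left t0)"
      by (simp add: has_field_derivative_iff)
    have "((\<lambda>t. (t0 - t) powr (1 - \<rho>)) \<longlongrightarrow> (t0 - t0) powr (1 - \<rho>)) (at_left t0)"
      using \<rho> by (intro tendsto_powr2 tendsto_intros) (auto simp: eventually_at_left_field intro: exI[of _ "t0 - 1"])
    then show "((\<lambda>t. (t0 - t) powr (1 - \<rho>)) \<longlongrightarrow> 0) (at_left t0)" by simp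
  qed
  moreover have "eventually (\<lambda>t. (half_conv k h t - half_conv k h t0) / (t - t0) \<le>
      m * ((P t - P t0) / (t - t0)) + C * (t0 - t) powr (1 - \<rho>)) (at_left t0)"
    unfolding eventually_at_left_field
  proof (intro exI[of _ "max b 0"] conjI allI impI)
    show "max b 0 < t0" using b t0 by simp
    fix t assume t: "max b 0 < t" "t < t0"
    then have "(half_conv k h t0 - half_conv k h t) / (t0 - t) \<le> (m * (P t0 - P t) + C * (t0 - t) powr (1 - \<rho>) * (t0 - t)) / (t0 - t)"
      using key[of t] by (intro divide_right_mono) auto
    also have "\<dots> = m * ((P t0 - P t) / (t0 - t)) + C * (t0 - t) powr (1 - \<rho>)"
      using t by (simp add: add_divide_distrib)
    finally show "(half_conv k h t - half_conv k h t0) / (t - t0) \<le>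
      m * ((P t - P t0) / (t - t0)) + C * (t0 - t) powr (1 - \<rho>)"
      by (metis minus_diff_eq minus_divide_divide)
  qed
  ultimately have "D \<le> m * k t0 + C * 0"
    by (intro tendsto_le[OF _ _ _]) (auto simp: trivial_limit_at_left_real)
  also have "\<dots> < 0"
  proof -
    have "k t0 > 0" using t0 G by (simp add: k_def power_kernel_def)
    then show ?thesis using neg mult_neg_pos[of m "k t0"] by (simp add: m_def)
  qed
  finally show ?thesis .
qed

section \<open>Positivity and decay of the Mittag-Leffler kernels\<close>

lemma mittag_leffler_differentiable:
  assumes "\<rho> > 0" "\<mu> > 0"
  shows "\<exists>D. (mittag_leffler \<rho> \<mu> has_real_derivative D) (at z)"
proof -
  define c where "c = (\<lambda>k. 1 / Gamma (\<rho> * real k + \<mu>))"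
  have s: "summable (\<lambda>k. c k * z ^ k)" for z
    using mittag_leffler_summable[of \<rho> \<mu> z] assms by (simp add: c_def)
  have E: "mittag_leffler \<rho> \<mu> = (\<lambda>z. \<Sum>k. c k * z ^ k)"
    using mittag_leffler_powser[of \<rho> \<mu>] assms by (auto simp: c_def)
  show ?thesis unfolding E by (blast intro: termdiffs_strong_converges_everywhere[OF s])
qed

lemma ml_kernel_differentiable:
  assumes "\<rho> > 0" "\<mu> > 0" "s > 0"
  shows "\<exists>D. (ml_kernel \<rho> \<mu> l has_real_derivative D) (at s)"
proof -
  obtain D where D: "(mittag_leffler \<rho> \<mu> has_real_derivative D) (at (- (l * s powr \<rho>)))"
    using mittag_leffler_differentiable[OF assms(1,2)] by blast
  have "((\<lambda>s. - (l * s powr \<rho>)) has_real_derivative - (l * (\<rho> * s powr (\<rho> - 1)))) (at s)"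
    using assms by (auto intro!: derivative_eq_intros simp: powr_diff)
  note 1 = DERIV_chain2[OF D this]
  have "((\<lambda>s. s powr (\<mu> - 1)) has_real_derivative (\<mu> - 1) * s powr (\<mu> - 1 - 1)) (at s)"
    using assms by (intro has_real_derivative_powr)
  from DERIV_mult[OF this 1] show ?thesis unfolding ml_kernel_def by blast
qed

lemma ml_kernel_1_has_derivative:
  assumes "\<rho> > 0" "s > 0"
  shows "(ml_kernel \<rho> 1 l has_real_derivative - (l * ml_kernel \<rho> \<rho> l s)) (at s)"
proof -
  have "((\<lambda>s. 1 - l * ml_kernel \<rho> (\<rho> + 1) l s) has_real_derivative 0 - l * ml_kernel \<rho> \<rho> l s) (at s)"
    by (intro DERIV_diff DERIV_const DERIV_cmult ml_kernel_has_derivative assms)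
  then have "((\<lambda>s. 1 - l * ml_kernel \<rho> (\<rho> + 1) l s) has_real_derivative - (l * ml_kernel \<rho> \<rho> l s)) (at s)"
    by simp
  then show ?thesis
    by (rule has_field_derivative_transform_within_open[where S = "{0<..}"])
      (use assms ml_kernel_rec[of \<rho> 1] in \<open>auto simp: power_kernel_1 add.commute\<close>)
qed

text \<open>Near \<open>0\<close> the kernel is positive, so a negative value would make it attain a negative minimum at
  some \<open>t\<^sub>0 > 0\<close>. There its Riemann-Liouville derivative \<open>E' = - l e\<close> would be nonnegative, against the
  extremum principle.\<close>

lemma ml_kernel_nonneg:
  assumes \<rho>: "0 < \<rho>" "\<rho> < 1" and l: "l \<ge> 0" and s0: "s0 > 0"
  shows "ml_kernel \<rho> \<rho> l s0 \<ge> 0"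
proof (rule ccontr)
  let ?e = "ml_kernel \<rho> \<rho> l"
  assume "\<not> ?e s0 \<ge> 0"
  then have neg: "?e s0 < 0" by simp
  have "continuous_on {0..} (\<lambda>s. mittag_leffler \<rho> \<rho> (- (l * s powr \<rho>)))"
    using \<rho> by (intro continuous_intros continuous_on_powr') auto
  then have L: "((\<lambda>s. mittag_leffler \<rho> \<rho> (- (l * s powr \<rho>))) \<longlongrightarrow> mittag_leffler \<rho> \<rho> (- (l * 0 powr \<rho>))) (at 0 within {0..})"
    unfolding continuous_on_def by (rule bspec) simp
  have "((\<lambda>s. mittag_leffler \<rho> \<rho> (- (l * s powr \<rho>))) \<longlongrightarrow> 1 / Gamma \<rho>) (at_right 0)"
    using tendsto_within_subset[OF L Ioi_le_Ico] by simp
  moreover have "1 / Gamma \<rho> > 0" using \<rho> by simp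
  ultimately have "eventually (\<lambda>s. mittag_leffler \<rho> \<rho> (- (l * s powr \<rho>)) > 0) (at_right 0)"
    by (rule order_tendstoD)
  then obtain d where d: "d > 0" "\<And>s. 0 < s \<Longrightarrow> s < d \<Longrightarrow> mittag_leffler \<rho> \<rho> (- (l * s powr \<rho>)) > 0"
    unfolding eventually_at_right_field by auto
  have epos: "?e s > 0" if "0 < s" "s < d" for s
    using d(2)[OF that] that by (simp add: ml_kernel_def)
  define b where "b = min (d / 2) s0"
  have b: "0 < b" "b < d" "b \<le> s0" using d s0 by (auto simp: b_def)
  have "continuous_on {b..s0} ?e"
    using continuous_on_ml_kernel[of \<rho> \<rho> l] \<rho> b by (auto elim: continuous_on_subset)
  then obtain t0 where t0: "t0 \<in> {b..s0}" "\<And>s. s \<in> {b..s0} \<Longrightarrow> ?e t0 \<le> ?e s"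
    using continuous_attains_inf[of "{b..s0}" ?e] b by auto
  have et0: "?e t0 < 0" using t0(2)[of s0] neg b by auto
  have t0p: "t0 > 0" using t0 b by auto
  obtain H where H: "(?e has_real_derivative H) (at t0)"
    using ml_kernel_differentiable[of \<rho> \<rho> t0 l] \<rho> t0p by auto
  have conv: "half_conv (power_kernel (1 - \<rho>)) ?e t = ml_kernel \<rho> 1 l t" if "t > 0" for t
    using half_conv_power_ml_kernel(2)[of \<rho> \<rho> "1 - \<rho>" t l] \<rho> that by simp
  have "(ml_kernel \<rho> 1 l has_real_derivative - (l * ?e t0)) (at t0)"
    using ml_kernel_1_has_derivative[of \<rho> t0 l] \<rho> t0p by simp
  then have "(half_conv (power_kernel (1 - \<rho>)) ?e has_real_derivative - (l * ?e t0)) (at t0)"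
    by (rule has_field_derivative_transform_within_open[where S = "{0<..}"]) (use t0p conv in auto)
  then have D: "(half_conv (power_kernel (1 - \<rho>)) ?e has_real_derivative - (l * ?e t0)) (at_left t0)"
    by (rule has_field_derivative_at_within)
  have H': "(?e has_real_derivative H) (at_left t0)"
    using H by (rule has_field_derivative_at_within)
  have min: "?e t0 \<le> ?e s" if "0 < s" "s \<le> t0" for s
  proof (cases "s < b")
    case True
    then show ?thesis using epos[of s] that b et0 by auto
  next
    case False
    then show ?thesis using t0 that by auto
  qed
  have int: "set_integrable lborel {0<..<t} (\<lambda>s. power_kernel (1 - \<rho>) (t - s) *\<^sub>R ?e s)" if "0 < t" "t \<le> t0" for t
    using half_conv_power_ml_kernel(1)[of \<rho> \<rho> "1 - \<rho>" t l] \<rho> that by simp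
  have "- (l * ?e t0) < 0"
    by (rule rl_derivative_negative_at_negative_minimum[OF \<rho> t0p H' int min et0 D])
  moreover have "l * ?e t0 \<le> 0" using l et0 by (simp add: mult_nonneg_nonpos)
  ultimately show False by simp
qed

lemma ml_kernel_nonneg_shift:
  assumes "0 < \<rho>" "\<rho> < 1" "l \<ge> 0" "t > 0" "\<alpha> > 0"
  shows "ml_kernel \<rho> (\<rho> + \<alpha>) l t \<ge> 0"
proof -
  have "ml_kernel \<rho> (\<rho> + \<alpha>) l t = half_conv (power_kernel \<alpha>) (ml_kernel \<rho> \<rho> l) t"
    by (rule half_conv_power_ml_kernel(2)[symmetric]) (use assms in auto)
  also have "\<dots> \<ge> 0"
    unfolding half_conv_def set_lebesgue_integral_def
    by (intro Bochner_Integration.integral_nonneg)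
      (auto simp: indicator_def intro!: mult_nonneg_nonneg power_kernel_nonneg ml_kernel_nonneg assms)
  finally show ?thesis .
qed

lemma ml_kernel_1_nonneg: "0 < \<rho> \<Longrightarrow> \<rho> < 1 \<Longrightarrow> l \<ge> 0 \<Longrightarrow> t > 0 \<Longrightarrow> ml_kernel \<rho> 1 l t \<ge> 0"
  using ml_kernel_nonneg_shift[of \<rho> l t "1 - \<rho>"] by simp

lemma ml_kernel_1_le_1: "0 < \<rho> \<Longrightarrow> \<rho> < 1 \<Longrightarrow> l \<ge> 0 \<Longrightarrow> t > 0 \<Longrightarrow> ml_kernel \<rho> 1 l t \<le> 1"
  using ml_kernel_nonneg_shift[of \<rho> l t 1] ml_kernel_rec[of \<rho> 1 t l]
  by (simp add: power_kernel_1 add.commute)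

lemma ml_kernel_le_power_kernel:
  "0 < \<rho> \<Longrightarrow> \<rho> < 1 \<Longrightarrow> l \<ge> 0 \<Longrightarrow> t > 0 \<Longrightarrow> ml_kernel \<rho> \<rho> l t \<le> power_kernel \<rho> t"
  using ml_kernel_nonneg_shift[of \<rho> l t \<rho>] ml_kernel_rec[of \<rho> \<rho> t l] by simp

lemma ml_kernel_1_antimono:
  assumes "0 < \<rho>" "\<rho> < 1" "l \<ge> 0" "0 < s" "s \<le> t"
  shows "ml_kernel \<rho> 1 l t \<le> ml_kernel \<rho> 1 l s"
proof (rule DERIV_nonpos_imp_nonincreasing[OF assms(5)])
  fix x assume "s \<le> x" "x \<le> t"
  then show "\<exists>y. (ml_kernel \<rho> 1 l has_real_derivative y) (at x) \<and> y \<le> 0"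
    using ml_kernel_1_has_derivative[of \<rho> x l] ml_kernel_nonneg[of \<rho> l x] assms
    by (intro exI[of _ "- (l * ml_kernel \<rho> \<rho> l x)"]) auto
qed

text \<open>As \<open>E\<close> decreases, its fractional integral of order \<open>\<rho>\<close> up to \<open>t\<close> is at least
  \<open>E(t) t\<^sup>\<rho> / \<Gamma>(1 + \<rho>)\<close>; the Volterra equation of \<open>E\<close> bounds \<open>l\<close> times that integral by \<open>1\<close>.\<close>

lemma ml_kernel_1_decay:
  assumes "0 < \<rho>" "\<rho> < 1" "l \<ge> 0" "t > 0"
  shows "l * t powr \<rho> * ml_kernel \<rho> 1 l t \<le> Gamma (1 + \<rho>)"
proof -
  let ?E = "ml_kernel \<rho> 1 l"
  have B: "set_integrable lborel {0<..<t} (\<lambda>s. power_kernel \<rho> (t - s))"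
    "set_lebesgue_integral lborel {0<..<t} (\<lambda>s. power_kernel \<rho> (t - s)) = power_kernel (1 + \<rho>) t"
  proof -
    have "has_bochner_integral lborel
      (\<lambda>s. indicator {0<..<t} s *\<^sub>R (power_kernel \<rho> (t - s) * power_kernel 1 s)) (power_kernel (\<rho> + 1) t)"
      by (rule has_bochner_integral_power_kernel) (use assms in auto)
    also have "(\<lambda>s. indicator {0<..<t} s *\<^sub>R (power_kernel \<rho> (t - s) * power_kernel 1 s)) =
        (\<lambda>s. indicator {0<..<t} s *\<^sub>R power_kernel \<rho> (t - s))"
      by (auto simp: indicator_def power_kernel_1)
    finally show "set_integrable lborel {0<..<t} (\<lambda>s. power_kernel \<rho> (t - s))"
      "set_lebesgue_integral lborel {0<..<t} (\<lambda>s. power_kernel \<rho> (t - s)) = power_kernel (1 + \<rho>) t"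
      by (simp_all add: has_bochner_integral_iff set_integrable_def set_lebesgue_integral_def add.commute)
  qed
  have "?E t * power_kernel (1 + \<rho>) t = set_lebesgue_integral lborel {0<..<t} (\<lambda>s. power_kernel \<rho> (t - s) * ?E t)"
    using B by simp
  also have "\<dots> \<le> set_lebesgue_integral lborel {0<..<t} (\<lambda>s. power_kernel \<rho> (t - s) * ?E s)"
  proof (rule set_integral_mono)
    show "set_integrable lborel {0<..<t} (\<lambda>s. power_kernel \<rho> (t - s) * ?E s)"
      using half_conv_power_ml_kernel(1)[of \<rho> 1 \<rho> t l] assms by simp
    show "power_kernel \<rho> (t - s) * ?E t \<le> power_kernel \<rho> (t - s) * ?E s" if "s \<in> {0<..<t}" for s
      using that assms by (intro mult_left_mono power_kernel_nonneg ml_kernel_1_antimono) auto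
  qed (use B in auto)
  also have "\<dots> = ml_kernel \<rho> (1 + \<rho>) l t"
    using half_conv_power_ml_kernel(2)[of \<rho> 1 \<rho> t l] assms by (simp add: half_conv_def)
  finally have 1: "l * (?E t * power_kernel (1 + \<rho>) t) \<le> l * ml_kernel \<rho> (1 + \<rho>) l t"
    using assms by (intro mult_left_mono)
  have "?E t = 1 - l * ml_kernel \<rho> (1 + \<rho>) l t"
    using ml_kernel_rec[of \<rho> 1 t l] assms by (simp add: power_kernel_1)
  then have "l * (?E t * power_kernel (1 + \<rho>) t) \<le> 1"
    using 1 ml_kernel_1_nonneg[OF assms] by linarith
  moreover have "Gamma (1 + \<rho>) > 0" using assms by (intro Gamma_real_pos) auto
  ultimately show ?thesis by (simp add: power_kernel_def field_simps)
qed

lemma set_integral_reflect: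
  fixes F :: "real \<Rightarrow> 'a :: {banach, second_countable_topology}"
  shows "set_integrable lborel {0<..<t} (\<lambda>s. F (t - s)) \<longleftrightarrow> set_integrable lborel {0<..<t} F"
    and "set_lebesgue_integral lborel {0<..<t} (\<lambda>s. F (t - s)) = set_lebesgue_integral lborel {0<..<t} F"
proof -
  have E: "indicator {0<..<t} s *\<^sub>R F (t - s) = indicator {0<..<t} (t + (-1) * s) *\<^sub>R F (t + (-1) * s)" for s
    by (auto simp: indicator_def)
  show "set_integrable lborel {0<..<t} (\<lambda>s. F (t - s)) \<longleftrightarrow> set_integrable lborel {0<..<t} F"
    unfolding set_integrable_def E
    by (subst lborel_integrable_real_affine_iff) auto
  show "set_lebesgue_integral lborel {0<..<t} (\<lambda>s. F (t - s)) = set_lebesgue_integral lborel {0<..<t} F"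
    unfolding set_lebesgue_integral_def E
    by (subst (2) lborel_integral_real_affine[where c = "-1" and t = t]) auto
qed

lemma ml_kernel_integral:
  assumes "0 < \<rho>" "t > 0"
  shows "set_integrable lborel {0<..<t} (ml_kernel \<rho> \<rho> l)"
    "set_lebesgue_integral lborel {0<..<t} (ml_kernel \<rho> \<rho> l) = ml_kernel \<rho> (\<rho> + 1) l t"
proof -
  have E: "indicator {0<..<t} s *\<^sub>R (power_kernel 1 (t - s) *\<^sub>R ml_kernel \<rho> \<rho> l s) =
      indicator {0<..<t} s *\<^sub>R ml_kernel \<rho> \<rho> l s" for s
    by (auto simp: indicator_def power_kernel_1)
  show "set_integrable lborel {0<..<t} (ml_kernel \<rho> \<rho> l)"
    using half_conv_power_ml_kernel(1)[of \<rho> \<rho> 1 t l] assms by (simp only: set_integrable_def E)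
  show "set_lebesgue_integral lborel {0<..<t} (ml_kernel \<rho> \<rho> l) = ml_kernel \<rho> (\<rho> + 1) l t"
    using half_conv_power_ml_kernel(2)[of \<rho> \<rho> 1 t l] assms
    by (simp only: set_lebesgue_integral_def half_conv_def E)
qed

text \<open>The convolution for \<open>t e(t)\<close> is split at \<open>s = t / 2\<close>. For smaller \<open>s\<close> the factor \<open>e(t - s)\<close> is taken
  out at its bound \<open>A\<close> and \<open>E\<close> is integrated by its decay; for larger \<open>s\<close> the factor \<open>E(s)\<close> is at most
  \<open>E(t / 2)\<close> and \<open>e\<close> has total mass at most \<open>1 / l\<close>.\<close>

lemma ml_kernel_bootstrap:
  assumes \<rho>: "0 < \<rho>" "\<rho> < 1" and l: "l > 0" and t: "t > 0"
    and A: "\<And>s. t / 2 \<le> s \<Longrightarrow> s \<le> t \<Longrightarrow> ml_kernel \<rho> \<rho> l s \<le> A"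
  shows "t * ml_kernel \<rho> \<rho> l t / \<rho> \<le>
    A * (Gamma (1 + \<rho>) / l) * Gamma (1 - \<rho>) * power_kernel (2 - \<rho>) t + ml_kernel \<rho> 1 l (t / 2) / l"
proof -
  let ?e = "ml_kernel \<rho> \<rho> l" and ?E = "ml_kernel \<rho> 1 l"
  define c where "c = Gamma (1 + \<rho>) / l * Gamma (1 - \<rho>)"
  have G: "Gamma (1 - \<rho>) > 0" "Gamma (1 + \<rho>) > 0" using \<rho> by (auto intro: Gamma_real_pos)
  have A0: "A \<ge> 0" using A[of t] t ml_kernel_nonneg[of \<rho> l t] \<rho> l by auto
  have B: "set_integrable lborel {0<..<t} (power_kernel (1 - \<rho>))"
    "set_lebesgue_integral lborel {0<..<t} (power_kernel (1 - \<rho>)) = power_kernel (2 - \<rho>) t"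
  proof -
    have "has_bochner_integral lborel
      (\<lambda>s. indicator {0<..<t} s *\<^sub>R (power_kernel 1 (t - s) * power_kernel (1 - \<rho>) s)) (power_kernel (1 + (1 - \<rho>)) t)"
      by (rule has_bochner_integral_power_kernel) (use \<rho> t in auto)
    also have "(\<lambda>s. indicator {0<..<t} s *\<^sub>R (power_kernel 1 (t - s) * power_kernel (1 - \<rho>) s)) =
        (\<lambda>s. indicator {0<..<t} s *\<^sub>R power_kernel (1 - \<rho>) s)"
      by (auto simp: indicator_def power_kernel_1)
    finally show "set_integrable lborel {0<..<t} (power_kernel (1 - \<rho>))"
      "set_lebesgue_integral lborel {0<..<t} (power_kernel (1 - \<rho>)) = power_kernel (2 - \<rho>) t"
      by (simp_all add: has_bochner_integral_iff set_integrable_def set_lebesgue_integral_def)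
  qed
  have ei: "set_integrable lborel {0<..<t} (\<lambda>s. ?e (t - s))"
    "set_lebesgue_integral lborel {0<..<t} (\<lambda>s. ?e (t - s)) = ml_kernel \<rho> (1 + \<rho>) l t"
    using ml_kernel_integral[of \<rho> t l] \<rho> t set_integral_reflect[of t ?e] by (simp_all add: add.commute)
  have "t * ?e t / \<rho> = set_lebesgue_integral lborel {0<..<t} (\<lambda>s. ?e (t - s) * ?E s)"
    using half_conv_ml_kernel_ml_kernel(2)[of \<rho> t l] \<rho> t by (simp add: half_conv_def)
  also have "\<dots> \<le> set_lebesgue_integral lborel {0<..<t} (\<lambda>s. A * c * power_kernel (1 - \<rho>) s + ?E (t / 2) * ?e (t - s))"
  proof (rule set_integral_mono)
    show "set_integrable lborel {0<..<t} (\<lambda>s. ?e (t - s) * ?E s)"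
      using half_conv_ml_kernel_ml_kernel(1)[of \<rho> t l] \<rho> t by simp
    show "set_integrable lborel {0<..<t} (\<lambda>s. A * c * power_kernel (1 - \<rho>) s + ?E (t / 2) * ?e (t - s))"
      using B(1) ei(1) by (intro set_integral_add set_integrable_mult_right)
    fix s assume s: "s \<in> {0<..<t}"
    have e0: "?e (t - s) \<ge> 0" using s \<rho> l by (intro ml_kernel_nonneg) auto
    have E0: "?E s \<ge> 0" using s \<rho> l by (intro ml_kernel_1_nonneg) auto
    have p0: "A * c * power_kernel (1 - \<rho>) s \<ge> 0"
      using A0 G l \<rho> unfolding c_def by (intro mult_nonneg_nonneg power_kernel_nonneg) auto
    have E2: "?E (t / 2) \<ge> 0" using t \<rho> l by (intro ml_kernel_1_nonneg) auto
    show "?e (t - s) * ?E s \<le> A * c * power_kernel (1 - \<rho>) s + ?E (t / 2) * ?e (t - s)"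
    proof (cases "s \<ge> t / 2")
      case True
      then have "?E s \<le> ?E (t / 2)" using t \<rho> l by (intro ml_kernel_1_antimono) auto
      then have "?e (t - s) * ?E s \<le> ?e (t - s) * ?E (t / 2)" using e0 by (rule mult_left_mono)
      then show ?thesis using p0 by (simp add: mult.commute)
    next
      case False
      have "l * s powr \<rho> * ?E s \<le> Gamma (1 + \<rho>)" using ml_kernel_1_decay[of \<rho> l s] \<rho> l s by auto
      then have "?E s \<le> Gamma (1 + \<rho>) / l * s powr (- \<rho>)"
        using l s by (simp add: powr_minus field_simps)
      also have "\<dots> = c * power_kernel (1 - \<rho>) s"
        using G by (simp add: c_def power_kernel_def)
      finally have "?e (t - s) * ?E s \<le> A * (c * power_kernel (1 - \<rho>) s)"
        using A[of "t - s"] False s A0 E0 by (intro mult_mono) auto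
      moreover have "?E (t / 2) * ?e (t - s) \<ge> 0" using E2 e0 by simp
      ultimately show ?thesis by (simp add: mult.assoc)
    qed
  qed
  also have "\<dots> = A * c * power_kernel (2 - \<rho>) t + ?E (t / 2) * ml_kernel \<rho> (1 + \<rho>) l t"
    using B ei by (subst set_integral_add(2)) auto
  also have "\<dots> \<le> A * c * power_kernel (2 - \<rho>) t + ?E (t / 2) * (1 / l)"
  proof -
    have "l * ml_kernel \<rho> (1 + \<rho>) l t \<le> 1"
      using ml_kernel_rec[of \<rho> 1 t l] ml_kernel_1_nonneg[of \<rho> l t] \<rho> l t by (simp add: power_kernel_1)
    then have "ml_kernel \<rho> (1 + \<rho>) l t \<le> 1 / l" using l by (simp add: field_simps)
    moreover have "?E (t / 2) \<ge> 0" using t \<rho> l by (intro ml_kernel_1_nonneg) auto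
    ultimately show ?thesis by (intro add_left_mono mult_left_mono)
  qed
  finally show ?thesis by (simp add: c_def mult_ac)
qed

text \<open>Two rounds of the preceding estimate: the trivial bound of \<open>e\<close> by the power kernel gives
  \<open>e(t) \<le> C / (l t)\<close>, and this bound, inserted again, gives the square.\<close>

lemma ml_kernel_decay:
  assumes \<rho>: "0 < \<rho>" "\<rho> < 1"
  obtains C where "C > 0" "\<And>l t. l > 0 \<Longrightarrow> t > 0 \<Longrightarrow> ml_kernel \<rho> \<rho> l t \<le> C * t powr (\<rho> - 1) / (l * t powr \<rho>)\<^sup>2"
proof -
  let ?e = "ml_kernel \<rho> \<rho>" and ?E = "ml_kernel \<rho> 1"
  have G: "Gamma (1 - \<rho>) > 0" "Gamma (1 + \<rho>) > 0" "Gamma \<rho> > 0" "Gamma (2 - \<rho>) > 0"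
    using \<rho> by (auto intro: Gamma_real_pos)
  define K where "K = Gamma (1 + \<rho>) * Gamma (1 - \<rho>) / Gamma (2 - \<rho>)"
  have K: "K > 0" using G by (simp add: K_def)
  have boot: "t * ?e l t \<le> \<rho> * (A * K / l * t powr (1 - \<rho>) + ?E l (t / 2) / l)"
    if "l > 0" "t > 0" "\<And>s. t / 2 \<le> s \<Longrightarrow> s \<le> t \<Longrightarrow> ?e l s \<le> A" for l t A
    using ml_kernel_bootstrap[OF \<rho> that] \<rho> by (simp add: K_def power_kernel_def field_simps)
  define C1 where "C1 = \<rho> * ((1 / 2) powr (\<rho> - 1) / Gamma \<rho> * K + 1)"
  have C1: "C1 > 0" using \<rho> K G by (simp add: C1_def add_pos_pos)
  have r1: "?e l t \<le> C1 / (l * t)" if lt: "l > 0" "t > 0" for l t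
  proof -
    have "t * ?e l t \<le> \<rho> * (((t / 2) powr (\<rho> - 1) / Gamma \<rho>) * K / l * t powr (1 - \<rho>) + ?E l (t / 2) / l)"
    proof (rule boot[OF lt])
      fix s assume s: "t / 2 \<le> s" "s \<le> t"
      have "?e l s \<le> power_kernel \<rho> s" using \<rho> lt s by (intro ml_kernel_le_power_kernel) auto
      also have "\<dots> \<le> (t / 2) powr (\<rho> - 1) / Gamma \<rho>"
        unfolding power_kernel_def using s lt \<rho> G by (intro divide_right_mono powr_mono2') auto
      finally show "?e l s \<le> (t / 2) powr (\<rho> - 1) / Gamma \<rho>" .
    qed
    also have "((t / 2) powr (\<rho> - 1) / Gamma \<rho>) * K / l * t powr (1 - \<rho>) = (1 / 2) powr (\<rho> - 1) / Gamma \<rho> * K / l"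
    proof -
      have "(t / 2) powr (\<rho> - 1) * t powr (1 - \<rho>) = (1 / 2) powr (\<rho> - 1) * (t powr (\<rho> - 1) * t powr (1 - \<rho>))"
        using lt powr_mult[of t "1 / 2" "\<rho> - 1"] by simp
      also have "\<dots> = (1 / 2) powr (\<rho> - 1)" using lt by (simp flip: powr_add)
      finally show ?thesis by (simp add: field_simps)
    qed
    also have "\<rho> * ((1 / 2) powr (\<rho> - 1) / Gamma \<rho> * K / l + ?E l (t / 2) / l) \<le>
        \<rho> * ((1 / 2) powr (\<rho> - 1) / Gamma \<rho> * K / l + 1 / l)"
      using \<rho> lt by (intro mult_left_mono add_left_mono divide_right_mono ml_kernel_1_le_1) auto
    also have "\<dots> = C1 / l" by (simp add: C1_def add_divide_distrib distrib_left)
    finally show ?thesis using lt by (simp add: field_simps)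
  qed
  define C2 where "C2 = \<rho> * (2 * C1 * K + Gamma (1 + \<rho>) * 2 powr \<rho>)"
  have C2: "C2 > 0" using \<rho> K G C1 by (simp add: C2_def add_pos_pos)
  show thesis
  proof (rule that[OF C2])
    fix l t :: real assume lt: "l > 0" "t > 0"
    have "t * ?e l t \<le> \<rho> * ((2 * C1 / (l * t)) * K / l * t powr (1 - \<rho>) + ?E l (t / 2) / l)"
    proof (rule boot[OF lt])
      fix s assume s: "t / 2 \<le> s" "s \<le> t"
      have "?e l s \<le> C1 / (l * s)" using lt s by (intro r1) auto
      also have "\<dots> \<le> C1 / (l * (t / 2))"
        using lt s C1 by (intro divide_left_mono mult_left_mono) auto
      finally show "?e l s \<le> 2 * C1 / (l * t)" by (simp add: mult.commute)
    qed
    also have "\<dots> \<le> \<rho> * ((2 * C1 / (l * t)) * K / l * t powr (1 - \<rho>) + (Gamma (1 + \<rho>) / (l * (t / 2) powr \<rho>)) / l)"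
    proof -
      have "l * (t / 2) powr \<rho> * ?E l (t / 2) \<le> Gamma (1 + \<rho>)"
        using \<rho> lt by (intro ml_kernel_1_decay) auto
      then have "?E l (t / 2) \<le> Gamma (1 + \<rho>) / (l * (t / 2) powr \<rho>)"
        using lt by (simp add: field_simps)
      then show ?thesis using \<rho> lt by (intro mult_left_mono add_left_mono divide_right_mono) auto
    qed
    also have "\<dots> = t * (C2 * t powr (\<rho> - 1) / (l * t powr \<rho>)\<^sup>2)"
    proof -
      have "(t / 2) powr \<rho> = t powr \<rho> / 2 powr \<rho>" using lt by (simp add: powr_divide)
      then show ?thesis using lt
        by (simp add: C2_def powr_diff field_simps power2_eq_square)
    qed
    finally show "?e l t \<le> C2 * t powr (\<rho> - 1) / (l * t powr \<rho>)\<^sup>2"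
      using lt(2) by (rule mult_left_le_imp_le)
  qed
qed

text \<open>For \<open>\<theta> = 2\<close> the bound of \<open>e\<close> gains two powers of the weight, as needed for an initial value with
  coefficients in the class of order \<open>a - 2\<close>. For \<open>\<theta> = 1 - \<epsilon>\<close> it gains a little less than one power
  but stays integrable in time at \<open>0\<close>, as needed for the source term.\<close>

lemma ml_kernel_uniform_bounds:
  fixes \<rho> T :: real
  assumes \<rho>: "0 < \<rho>" "\<rho> < 1" and T: "T > 0"
  obtains C where "C > 0"
    "\<And>l t. l \<ge> 0 \<Longrightarrow> 0 < t \<Longrightarrow> t \<le> T \<Longrightarrow> ml_kernel \<rho> 1 l t \<le> C / ((1 + l) * t powr \<rho>)"
    "\<And>l t \<theta>. l \<ge> 0 \<Longrightarrow> 0 < t \<Longrightarrow> t \<le> T \<Longrightarrow> 0 \<le> \<theta> \<Longrightarrow> \<theta> \<le> 2 \<Longrightarrow>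
       ml_kernel \<rho> \<rho> l t \<le> C * t powr (\<rho> - 1) * ((1 + l) * t powr \<rho>) powr (- \<theta>)"
proof -
  obtain C0 where C0: "C0 > 0" "\<And>l t. l > 0 \<Longrightarrow> t > 0 \<Longrightarrow> ml_kernel \<rho> \<rho> l t \<le> C0 * t powr (\<rho> - 1) / (l * t powr \<rho>)\<^sup>2"
    using ml_kernel_decay[OF \<rho>] by blast
  have G: "Gamma (1 + \<rho>) > 0" "Gamma \<rho> > 0" using \<rho> by (auto intro: Gamma_real_pos)
  define Y where "Y = T powr \<rho> + 1"
  have Y: "Y \<ge> 1" by (simp add: Y_def)
  define C1 where "C1 = max 1 (max (Gamma (1 + \<rho>)) (max C0 (1 / Gamma \<rho>)))"
  have C1: "C1 \<ge> 1" "C1 \<ge> Gamma (1 + \<rho>)" "C1 \<ge> C0" "C1 \<ge> 1 / Gamma \<rho>" by (auto simp: C1_def)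
  have y: "(1 + l) * t powr \<rho> \<le> Y * max 1 (l * t powr \<rho>)" "(1 + l) * t powr \<rho> > 0"
    if "l \<ge> 0" "0 < t" "t \<le> T" for l t
  proof -
    have "t powr \<rho> \<le> T powr \<rho>" using that \<rho> by (intro powr_mono2) auto
    then have "(1 + l) * t powr \<rho> \<le> T powr \<rho> * 1 + 1 * (l * t powr \<rho>)" by (simp add: algebra_simps)
    also have "\<dots> \<le> T powr \<rho> * max 1 (l * t powr \<rho>) + 1 * max 1 (l * t powr \<rho>)"
      by (intro add_mono mult_left_mono) auto
    finally show "(1 + l) * t powr \<rho> \<le> Y * max 1 (l * t powr \<rho>)" by (simp add: Y_def algebra_simps)
    show "(1 + l) * t powr \<rho> > 0" using that by simp
  qed
  show thesis
  proof (rule that[of "C1 * Y\<^sup>2"])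
    show "C1 * Y\<^sup>2 > 0" using C1(1) Y by simp
    fix l t :: real assume lt: "l \<ge> 0" "0 < t" "t \<le> T"
    define x where "x = max 1 (l * t powr \<rho>)"
    have x: "x \<ge> 1" by (simp add: x_def)
    have yx: "(1 + l) * t powr \<rho> \<le> Y * x" "(1 + l) * t powr \<rho> > 0"
      using y[OF lt] by (simp_all add: x_def)
    have "x * ml_kernel \<rho> 1 l t \<le> C1"
      using ml_kernel_1_le_1[of \<rho> l t] ml_kernel_1_decay[of \<rho> l t] \<rho> lt C1 by (auto simp: x_def max_def)
    then have "ml_kernel \<rho> 1 l t \<le> C1 / x" using x by (simp add: field_simps)
    also have "\<dots> = C1 * Y / (Y * x)" using Y by simp
    also have "\<dots> \<le> C1 * Y / ((1 + l) * t powr \<rho>)"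
      using yx C1 Y by (intro divide_left_mono) auto
    also have "\<dots> \<le> C1 * Y\<^sup>2 / ((1 + l) * t powr \<rho>)"
      using yx C1 Y by (intro divide_right_mono mult_left_mono) (auto simp: power2_eq_square)
    finally show "ml_kernel \<rho> 1 l t \<le> C1 * Y\<^sup>2 / ((1 + l) * t powr \<rho>)" .
    fix \<theta> :: real assume \<theta>: "0 \<le> \<theta>" "\<theta> \<le> 2"
    have "ml_kernel \<rho> \<rho> l t \<le> C1 * t powr (\<rho> - 1) / x\<^sup>2"
    proof (cases "l * t powr \<rho> \<le> 1")
      case True
      have "ml_kernel \<rho> \<rho> l t \<le> (1 / Gamma \<rho>) * t powr (\<rho> - 1)"
        using ml_kernel_le_power_kernel[of \<rho> l t] \<rho> lt by (simp add: power_kernel_def)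
      also have "\<dots> \<le> C1 * t powr (\<rho> - 1)" using C1 by (intro mult_right_mono) auto
      finally show ?thesis using True by (simp add: x_def)
    next
      case False
      then have "l > 0" using lt by (metis linorder_not_less order_le_less mult_zero_left zero_le_one)
      then have "ml_kernel \<rho> \<rho> l t \<le> C0 * t powr (\<rho> - 1) / (l * t powr \<rho>)\<^sup>2" using C0 lt by auto
      also have "\<dots> \<le> C1 * t powr (\<rho> - 1) / (l * t powr \<rho>)\<^sup>2"
        using C1 by (intro divide_right_mono mult_right_mono) auto
      finally show ?thesis using False by (simp add: x_def max_def)
    qed
    also have "\<dots> = C1 * Y\<^sup>2 * t powr (\<rho> - 1) * (Y * x) powr (- 2)"
    proof -
      have "Y * x > 0" using Y x by simp
      then have "(Y * x) powr (- 2) = 1 / (Y * x)\<^sup>2" by (simp add: powr_minus powr_realpow divide_inverse)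
      then show ?thesis using Y x by (simp add: field_simps)
    qed
    also have "\<dots> \<le> C1 * Y\<^sup>2 * t powr (\<rho> - 1) * (Y * x) powr (- \<theta>)"
    proof -
      have "1 \<le> Y * x" using mult_mono[of 1 Y 1 x] Y x by simp
      then show ?thesis using \<theta> C1 by (intro mult_left_mono powr_mono) auto
    qed
    also have "\<dots> \<le> C1 * Y\<^sup>2 * t powr (\<rho> - 1) * ((1 + l) * t powr \<rho>) powr (- \<theta>)"
      using \<theta> C1 yx by (intro mult_left_mono powr_mono2') auto
    finally show "ml_kernel \<rho> \<rho> l t \<le> C1 * Y\<^sup>2 * t powr (\<rho> - 1) * ((1 + l) * t powr \<rho>) powr (- \<theta>)" .
  qed
qed

section \<open>Convolutions on the half-line\<close>

lemma power_kernel_pos: "\<alpha> > 0 \<Longrightarrow> s > 0 \<Longrightarrow> power_kernel \<alpha> s > 0"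
  unfolding power_kernel_def by simp

lemma half_conv_cong:
  assumes "\<And>s. 0 < s \<Longrightarrow> s < t \<Longrightarrow> k s = k' s" "\<And>s. 0 < s \<Longrightarrow> s < t \<Longrightarrow> c s = c' s"
  shows "half_conv k c t = half_conv k' c' t"
  unfolding half_conv_def set_lebesgue_integral_def
  by (intro Bochner_Integration.integral_cong) (auto simp: indicator_def assms)

lemma half_conv_dominated:
  fixes c :: "real \<Rightarrow> 'a::{banach, second_countable_topology}"
  assumes "\<alpha> > 0" "\<beta> > 0" "t > 0" and k[measurable]: "k \<in> borel_measurable borel"
    and c: "set_borel_measurable lborel {0<..<t} c"
    and kb: "\<And>s. 0 < s \<Longrightarrow> s < t \<Longrightarrow> \<bar>k s\<bar> \<le> A * power_kernel \<alpha> s"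
    and cb: "\<And>s. 0 < s \<Longrightarrow> s < t \<Longrightarrow> norm (c s) \<le> K * power_kernel \<beta> s"
  shows "set_integrable lborel {0<..<t} (\<lambda>s. k (t - s) *\<^sub>R c s)"
    and "set_lebesgue_integral lborel {0<..<t} (\<lambda>s. norm (k (t - s) *\<^sub>R c s)) \<le> A * K * power_kernel (\<alpha> + \<beta>) t"
    and "norm (half_conv k c t) \<le> A * K * power_kernel (\<alpha> + \<beta>) t"
proof -
  have A: "A \<ge> 0"
    using order_trans[OF abs_ge_zero kb[of "t / 2"]] power_kernel_pos[of \<alpha> "t / 2"] assms(1,3)
    by (simp add: zero_le_mult_iff)
  have b: "norm (k (t - s) *\<^sub>R c s) \<le> A * K * (power_kernel \<alpha> (t - s) * power_kernel \<beta> s)" if "0 < s" "s < t" for s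
  proof -
    have "\<bar>k (t - s)\<bar> * norm (c s) \<le> (A * power_kernel \<alpha> (t - s)) * (K * power_kernel \<beta> s)"
      using kb[of "t - s"] cb[of s] that A power_kernel_pos[of \<alpha> "t - s"] assms(1)
      by (intro mult_mono) auto
    then show ?thesis by (simp add: mult_ac)
  qed
  have dom: "has_bochner_integral lborel
     (\<lambda>s. A * K * (indicator {0<..<t} s *\<^sub>R (power_kernel \<alpha> (t - s) * power_kernel \<beta> s))) (A * K * power_kernel (\<alpha> + \<beta>) t)"
    by (intro has_bochner_integral_mult_right has_bochner_integral_power_kernel assms)
  have meas: "(\<lambda>s. indicator {0<..<t} s *\<^sub>R (k (t - s) *\<^sub>R c s)) \<in> borel_measurable lborel"
  proof -
    have [measurable]: "(\<lambda>s. indicator {0<..<t} s *\<^sub>R c s) \<in> borel_measurable lborel"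
      using c by (simp add: set_borel_measurable_def)
    have "(\<lambda>s. k (t - s) *\<^sub>R (indicator {0<..<t} s *\<^sub>R c s)) \<in> borel_measurable lborel" by measurable
    then show ?thesis by (simp add: mult.commute)
  qed
  show i: "set_integrable lborel {0<..<t} (\<lambda>s. k (t - s) *\<^sub>R c s)"
    unfolding set_integrable_def
  proof (rule Bochner_Integration.integrable_bound[OF _ meas])
    show "integrable lborel (\<lambda>s. A * K * (indicator {0<..<t} s *\<^sub>R (power_kernel \<alpha> (t - s) * power_kernel \<beta> s)))"
      using dom by (simp add: has_bochner_integral_iff)
    show "AE s in lborel. norm (indicator {0<..<t} s *\<^sub>R (k (t - s) *\<^sub>R c s)) \<le>
        norm (A * K * (indicator {0<..<t} s *\<^sub>R (power_kernel \<alpha> (t - s) * power_kernel \<beta> s)))"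
    proof (rule AE_I2)
      fix s
      show "norm (indicator {0<..<t} s *\<^sub>R (k (t - s) *\<^sub>R c s)) \<le>
        norm (A * K * (indicator {0<..<t} s *\<^sub>R (power_kernel \<alpha> (t - s) * power_kernel \<beta> s)))"
      proof (cases "s \<in> {0<..<t}")
        case True
        then have "norm (k (t - s) *\<^sub>R c s) \<le> \<bar>A * K * (power_kernel \<alpha> (t - s) * power_kernel \<beta> s)\<bar>"
          using b[of s] by (intro order_trans[OF _ abs_ge_self]) auto
        then show ?thesis using True by simp
      qed simp
    qed
  qed
  show 2: "set_lebesgue_integral lborel {0<..<t} (\<lambda>s. norm (k (t - s) *\<^sub>R c s)) \<le> A * K * power_kernel (\<alpha> + \<beta>) t"
    using dom unfolding has_bochner_integral_iff set_lebesgue_integral_def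
  proof (elim conjE)
    assume d: "integrable lborel (\<lambda>s. A * K * (indicator {0<..<t} s *\<^sub>R (power_kernel \<alpha> (t - s) * power_kernel \<beta> s)))"
      "(LINT s|lborel. A * K * (indicator {0<..<t} s *\<^sub>R (power_kernel \<alpha> (t - s) * power_kernel \<beta> s))) = A * K * power_kernel (\<alpha> + \<beta>) t"
    show "(LINT s|lborel. indicator {0<..<t} s *\<^sub>R norm (k (t - s) *\<^sub>R c s)) \<le> A * K * power_kernel (\<alpha> + \<beta>) t"
      unfolding d(2)[symmetric]
    proof (rule integral_mono[OF _ d(1)])
      show "integrable lborel (\<lambda>s. indicator {0<..<t} s *\<^sub>R norm (k (t - s) *\<^sub>R c s))"
        using set_integrable_norm[OF i] by (simp add: set_integrable_def)
      fix s show "indicator {0<..<t} s *\<^sub>R norm (k (t - s) *\<^sub>R c s)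
          \<le> A * K * (indicator {0<..<t} s *\<^sub>R (power_kernel \<alpha> (t - s) * power_kernel \<beta> s))"
        using b[of s] by (cases "s \<in> {0<..<t}") auto
    qed
  qed
  have "norm (half_conv k c t) \<le> set_lebesgue_integral lborel {0<..<t} (\<lambda>s. norm (k (t - s) *\<^sub>R c s))"
    unfolding half_conv_def by (rule set_integral_norm_bound[OF i])
  with 2 show "norm (half_conv k c t) \<le> A * K * power_kernel (\<alpha> + \<beta>) t" by simp
qed

text \<open>Fubini's theorem on the triangle \<open>0 < r < s < t\<close>, followed by a translation in the inner
  integral.\<close>

lemma half_conv_assoc:
  fixes c :: "real \<Rightarrow> 'a::{banach, second_countable_topology}"
  assumes t: "t > 0" and a[measurable]: "a \<in> borel_measurable borel" and b[measurable]: "b \<in> borel_measurable borel"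
    and a0: "\<And>s. s > 0 \<Longrightarrow> a s \<ge> 0" and b0: "\<And>s. s > 0 \<Longrightarrow> b s \<ge> 0"
    and c: "set_borel_measurable lborel {0<..<t} c"
    and ab: "\<And>\<tau>. 0 < \<tau> \<Longrightarrow> \<tau> < t \<Longrightarrow> set_integrable lborel {0<..<\<tau>} (\<lambda>s. a (\<tau> - s) *\<^sub>R b s)"
    and int: "set_integrable lborel {0<..<t} (\<lambda>s. half_conv a b (t - s) *\<^sub>R c s)"
  shows "set_integrable lborel {0<..<t} (\<lambda>s. a (t - s) *\<^sub>R half_conv b c s)"
    and "half_conv a (half_conv b c) t = half_conv (half_conv a b) c t"
proof -
  define c' where "c' = (\<lambda>s. indicator {0<..<t} s *\<^sub>R c s)"
  have [measurable]: "c' \<in> borel_measurable borel"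
    using c by (simp add: c'_def set_borel_measurable_def)
  define W where "W = (\<lambda>r s. (if 0 < r \<and> r < s \<and> s < t then a (t - s) * b (s - r) else 0))"
  have W0: "W r s \<ge> 0" for r s using a0 b0 by (auto simp: W_def)
  define F where "F = (\<lambda>r s. W r s *\<^sub>R c' r)"
  have Fm: "case_prod F \<in> borel_measurable (lborel \<Otimes>\<^sub>M lborel)"
    unfolding F_def W_def by measurable
  have Wsub: "W r (r + 1 * y) = indicator {0<..<t - r} y *\<^sub>R (a ((t - r) - y) *\<^sub>R b y)" if "0 < r" for r y
    using that by (auto simp: W_def indicator_def algebra_simps)
  have Wi: "integrable lborel (W r)" "(LINT s|lborel. W r s) = half_conv a b (t - r)" if "r \<in> {0<..<t}" for r
  proof -
    have r: "0 < r" using that by auto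
    have "integrable lborel (\<lambda>y. W r (r + 1 * y))"
      using ab[of "t - r"] that unfolding Wsub[OF r] by (simp add: set_integrable_def)
    then show "integrable lborel (W r)"
      by (subst (asm) lborel_integrable_real_affine_iff) auto
    have "(LINT s|lborel. W r s) = \<bar>1\<bar> *\<^sub>R (LINT y|lborel. W r (r + 1 * y))"
      by (rule lborel_integral_real_affine) simp
    then show "(LINT s|lborel. W r s) = half_conv a b (t - r)"
      unfolding Wsub[OF r] by (simp add: half_conv_def set_lebesgue_integral_def)
  qed
  have W00: "W r = (\<lambda>s. 0)" if "r \<notin> {0<..<t}" for r
    using that by (auto simp: W_def)
  have Fi: "integrable lborel (F r)" "(LINT s|lborel. norm (F r s)) = norm (indicator {0<..<t} r *\<^sub>R (half_conv a b (t - r) *\<^sub>R c r))"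
     "(LINT s|lborel. F r s) = indicator {0<..<t} r *\<^sub>R (half_conv a b (t - r) *\<^sub>R c r)" for r
  proof -
    show "integrable lborel (F r)"
      using Wi[of r] W00[of r] by (cases "r \<in> {0<..<t}") (auto simp: F_def)
    show "(LINT s|lborel. F r s) = indicator {0<..<t} r *\<^sub>R (half_conv a b (t - r) *\<^sub>R c r)"
      using Wi[of r] W00[of r] by (cases "r \<in> {0<..<t}") (auto simp: F_def c'_def)
    have "half_conv a b (t - r) \<ge> 0" if "r \<in> {0<..<t}"
      using Wi(2)[OF that, symmetric] W0 by (simp add: Bochner_Integration.integral_nonneg)
    moreover have "norm (F r s) = W r s * norm (c' r)" for s using W0 by (simp add: F_def)
    ultimately show "(LINT s|lborel. norm (F r s)) = norm (indicator {0<..<t} r *\<^sub>R (half_conv a b (t - r) *\<^sub>R c r))"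
      using Wi[of r] W00[of r] by (cases "r \<in> {0<..<t}") (auto simp: c'_def)
  qed
  have P: "integrable (lborel \<Otimes>\<^sub>M lborel) (case_prod F)"
  proof (rule lborel_pair.Fubini_integrable[OF Fm])
    show "integrable lborel (\<lambda>r. LINT s|lborel. norm (case_prod F (r, s)))"
      using integrable_norm[OF int[unfolded set_integrable_def]] by (simp add: Fi(2) del: norm_scaleR)
    show "AE r in lborel. integrable lborel (\<lambda>s. case_prod F (r, s))"
      using Fi(1) by (intro AE_I2) simp
  qed
  have inner: "(LINT r|lborel. F r s) = indicator {0<..<t} s *\<^sub>R (a (t - s) *\<^sub>R half_conv b c s)" for s
  proof (cases "s \<in> {0<..<t}")
    case True
    have "F r s = a (t - s) *\<^sub>R (indicator {0<..<s} r *\<^sub>R (b (s - r) *\<^sub>R c r))" for r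
      using True by (auto simp: F_def W_def c'_def indicator_def)
    then show ?thesis using True by (simp add: half_conv_def set_lebesgue_integral_def del: scaleR_scaleR)
  next
    case False
    have "F r s = 0" for r
      using False by (auto simp: F_def W_def)
    then show ?thesis using False by simp
  qed
  show "set_integrable lborel {0<..<t} (\<lambda>s. a (t - s) *\<^sub>R half_conv b c s)"
    using lborel_pair.integrable_snd[OF P] by (simp add: set_integrable_def inner)
  show "half_conv a (half_conv b c) t = half_conv (half_conv a b) c t"
    using lborel_pair.Fubini_integral[OF P] unfolding inner Fi(3)
    by (simp add: half_conv_def[of a] half_conv_def[of "half_conv a b"] set_lebesgue_integral_def)
qed

lemma power_kernel_scale: "t > 0 \<Longrightarrow> s \<ge> 0 \<Longrightarrow> power_kernel \<alpha> (t * s) = t powr (\<alpha> - 1) * power_kernel \<alpha> s"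
  by (simp add: power_kernel_def powr_mult)

text \<open>The substitution \<open>s = t \<sigma>\<close> moves the dependence on \<open>t\<close> from the domain of integration into the
  integrand. The bounds are homogeneous, so the dominating function is a Beta density times a
  convergent sequence.\<close>

lemma half_conv_continuous_on:
  fixes c :: "real \<Rightarrow> 'a::{banach, second_countable_topology}"
  assumes \<alpha>: "\<alpha> > 0" and \<beta>: "\<beta> > 0" and kc: "continuous_on {0<..} k" and cc: "continuous_on {0<..T} c"
    and kb: "\<And>s. 0 < s \<Longrightarrow> s \<le> T \<Longrightarrow> \<bar>k s\<bar> \<le> A * power_kernel \<alpha> s"
    and cb: "\<And>s. 0 < s \<Longrightarrow> s \<le> T \<Longrightarrow> norm (c s) \<le> K * power_kernel \<beta> s"
  shows "continuous_on {0<..T} (half_conv k c)"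
  unfolding continuous_on_sequentially
proof (intro ballI allI impI, elim conjE)
  fix x :: "nat \<Rightarrow> real" and t
  assume t: "t \<in> {0<..T}" and x: "\<forall>n. x n \<in> {0<..T}" and lim: "x \<longlonglongrightarrow> t"
  define S where "S = (\<lambda>t s. indicator {0<..<1} s *\<^sub>R (t *\<^sub>R (k (t - t * s) *\<^sub>R c (t * s))))"
  have rep: "half_conv k c t = (LINT s|lborel. S t s)" if "t \<in> {0<..T}" for t
  proof -
    have "half_conv k c t = \<bar>t\<bar> *\<^sub>R (LINT s|lborel. indicator {0<..<t} (0 + t * s) *\<^sub>R (k (t - (0 + t * s)) *\<^sub>R c (0 + t * s)))"
      unfolding half_conv_def set_lebesgue_integral_def
      by (rule lborel_integral_real_affine) (use that in auto)
    also have "\<dots> = (LINT s|lborel. \<bar>t\<bar> *\<^sub>R (indicator {0<..<t} (0 + t * s) *\<^sub>R (k (t - (0 + t * s)) *\<^sub>R c (0 + t * s))))"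
      by (rule integral_scaleR_right[symmetric])
    also have "\<dots> = (LINT s|lborel. S t s)"
    proof (rule Bochner_Integration.integral_cong)
      fix s :: real
      have "t * s \<in> {0<..<t} \<longleftrightarrow> s \<in> {0<..<1}" using that by (auto simp: zero_less_mult_iff)
      then show "\<bar>t\<bar> *\<^sub>R (indicator {0<..<t} (0 + t * s) *\<^sub>R (k (t - (0 + t * s)) *\<^sub>R c (0 + t * s))) = S t s"
        using that by (auto simp: S_def indicator_def)
    qed simp
    finally show ?thesis .
  qed
  have mem: "t * s \<in> {0<..T}" "t - t * s \<in> {0<..T}" if "t \<in> {0<..T}" "s \<in> {0<..<1}" for t s
  proof -
    have "t * s < t * 1" "0 < t * s" using that by (auto intro: mult_strict_left_mono)
    then show "t * s \<in> {0<..T}" "t - t * s \<in> {0<..T}" using that by auto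
  qed
  have Sm: "S t \<in> borel_measurable lborel" if "t \<in> {0<..T}" for t
    unfolding S_def measurable_lborel2
    by (rule borel_measurable_continuous_on_indicator)
      (use mem[OF that] in \<open>auto intro!: continuous_intros continuous_on_compose2[OF kc] continuous_on_compose2[OF cc]\<close>)
  have AK: "A \<ge> 0" "K \<ge> 0"
    using order_trans[OF abs_ge_zero kb[of t]] order_trans[OF norm_ge_zero cb[of t]]
      power_kernel_pos[of \<alpha> t] power_kernel_pos[of \<beta> t] \<alpha> \<beta> t
    by (auto simp: zero_le_mult_iff)
  have Sb: "norm (S t s) \<le> A * K * t powr (\<alpha> + \<beta> - 1) * (indicator {0<..<1} s *\<^sub>R (power_kernel \<alpha> (1 - s) * power_kernel \<beta> s))"
    if "t \<in> {0<..T}" for t s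
  proof (cases "s \<in> {0<..<1}")
    case True
    have "norm (S t s) = t * (\<bar>k (t - t * s)\<bar> * norm (c (t * s)))"
      using True that by (simp add: S_def abs_mult)
    also have "\<dots> \<le> t * ((A * power_kernel \<alpha> (t - t * s)) * (K * power_kernel \<beta> (t * s)))"
      using mem[OF that True] that AK \<alpha> by (intro mult_left_mono mult_mono kb cb mult_nonneg_nonneg power_kernel_nonneg) auto
    also have "t - t * s = t * (1 - s)" by (simp add: algebra_simps)
    also have "t * ((A * power_kernel \<alpha> (t * (1 - s))) * (K * power_kernel \<beta> (t * s))) =
        A * K * (t * t powr (\<alpha> - 1) * t powr (\<beta> - 1)) * (power_kernel \<alpha> (1 - s) * power_kernel \<beta> s)"
      using that True by (simp add: power_kernel_scale)
    also have "t * t powr (\<alpha> - 1) * t powr (\<beta> - 1) = t powr (\<alpha> + \<beta> - 1)"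
      using that by (simp add: powr_diff powr_add)
    finally show ?thesis using True by simp
  qed (simp add: S_def)
  have "(\<lambda>n. A * K * x n powr (\<alpha> + \<beta> - 1)) \<longlonglongrightarrow> A * K * t powr (\<alpha> + \<beta> - 1)"
    using t by (intro tendsto_intros lim) auto
  then obtain B where B: "\<And>n. \<bar>A * K * x n powr (\<alpha> + \<beta> - 1)\<bar> \<le> B"
    using convergent_imp_Bseq[of "\<lambda>n. A * K * x n powr (\<alpha> + \<beta> - 1)"] by (auto simp: convergent_def Bseq_def)
  have "(\<lambda>n. LINT s|lborel. S (x n) s) \<longlonglongrightarrow> (LINT s|lborel. S t s)"
  proof (rule integral_dominated_convergence)
    show "S t \<in> borel_measurable lborel" by (rule Sm[OF t])
    show "S (x n) \<in> borel_measurable lborel" for n using x by (intro Sm) auto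
    show "integrable lborel (\<lambda>s. B * (indicator {0<..<1} s *\<^sub>R (power_kernel \<alpha> (1 - s) * power_kernel \<beta> s)))"
      using has_bochner_integral_power_kernel[OF \<alpha> \<beta>, of 1]
      by (intro integrable_mult_right) (auto simp: has_bochner_integral_iff)
    show "AE s in lborel. (\<lambda>n. S (x n) s) \<longlonglongrightarrow> S t s"
    proof (rule AE_I2)
      fix s
      show "(\<lambda>n. S (x n) s) \<longlonglongrightarrow> S t s"
      proof (cases "s \<in> {0<..<1}")
        case True
        have "(\<lambda>n. k (x n - x n * s)) \<longlonglongrightarrow> k (t - t * s)"
          by (rule continuous_on_tendsto_compose[OF kc]) (use mem[OF _ True] x t in \<open>auto intro!: tendsto_intros lim\<close>)
        moreover have "(\<lambda>n. c (x n * s)) \<longlonglongrightarrow> c (t * s)"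
          by (rule continuous_on_tendsto_compose[OF cc]) (use mem[OF _ True] x t in \<open>auto intro!: tendsto_intros lim\<close>)
        ultimately show ?thesis unfolding S_def by (intro tendsto_intros lim)
      qed (simp add: S_def)
    qed
    show "AE s in lborel. norm (S (x n) s) \<le> B * (indicator {0<..<1} s *\<^sub>R (power_kernel \<alpha> (1 - s) * power_kernel \<beta> s))" for n
    proof (rule AE_I2)
      fix s
      have "norm (S (x n) s) \<le> A * K * x n powr (\<alpha> + \<beta> - 1) * (indicator {0<..<1} s *\<^sub>R (power_kernel \<alpha> (1 - s) * power_kernel \<beta> s))"
        using x by (intro Sb) auto
      also have "\<dots> \<le> B * (indicator {0<..<1} s *\<^sub>R (power_kernel \<alpha> (1 - s) * power_kernel \<beta> s))"
        using B[of n] \<alpha> \<beta> by (intro mult_right_mono scaleR_nonneg_nonneg mult_nonneg_nonneg power_kernel_nonneg) auto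
      finally show "norm (S (x n) s) \<le> B * (indicator {0<..<1} s *\<^sub>R (power_kernel \<alpha> (1 - s) * power_kernel \<beta> s))" .
    qed
  qed
  then show "(half_conv k c \<circ> x) \<longlonglongrightarrow> half_conv k c t"
    using rep x t by (simp add: comp_def)
qed

lemma at_within_half: "0 < t \<Longrightarrow> t \<le> T \<Longrightarrow> at t within {0<..T} = at t within {t / 2..(T::real)}"
  by (rule at_within_nhd[of _ "{t / 2<..}"]) auto

text \<open>The integrand may be singular at \<open>0\<close>, so the fundamental theorem is used on \<open>[t / 2, T]\<close> only.\<close>

lemma initial_integral_has_vector_derivative:
  fixes g :: "real \<Rightarrow> complex"
  assumes gc: "continuous_on {0<..T} g" and gi: "set_integrable lborel {0<..<T} g" and t: "0 < t" "t \<le> T"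
  shows "((\<lambda>t. set_lebesgue_integral lborel {0<..<t} g) has_vector_derivative g t) (at t within {0<..T})"
proof -
  define I where "I = set_lebesgue_integral lborel {0<..<t / 2} g"
  have gc': "continuous_on {t / 2..r} g" if "r \<le> T" for r
    using gc by (rule continuous_on_subset) (use that t in auto)
  have eq: "set_lebesgue_integral lborel {0<..<r} g = I + integral {t / 2..r} g" if r: "r \<in> {t / 2..T}" for r
  proof -
    have i2: "set_integrable lborel {t / 2..r} g"
      using r by (intro borel_integrable_atLeastAtMost' gc') auto
    have "set_lebesgue_integral lborel {0<..<r} g = set_lebesgue_integral lborel ({0<..<t / 2} \<union> {t / 2..<r}) g"
    proof (cases "r = t / 2")
      case False
      then have "{0<..<r} = {0<..<t / 2} \<union> {t / 2..<r}" using r t by auto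
      then show ?thesis by simp
    qed auto
    also have "\<dots> = I + set_lebesgue_integral lborel {t / 2..<r} g"
      unfolding I_def
    proof (rule set_integral_Un)
      show "set_integrable lborel {0<..<t / 2} g" using gi by (rule set_integrable_subset) (use t in auto)
      show "set_integrable lborel {t / 2..<r} g" using i2 by (rule set_integrable_subset) auto
    qed auto
    also have "set_lebesgue_integral lborel {t / 2..<r} g = set_lebesgue_integral lborel {t / 2..r} g"
    proof (rule set_integral_cong_set)
      have "set_integrable lborel {t / 2..<r} g" using i2 by (rule set_integrable_subset) auto
      then show "set_borel_measurable lborel {t / 2..<r} g" "set_borel_measurable lborel {t / 2..r} g"
        using i2 by (auto simp: set_integrable_def set_borel_measurable_def dest: borel_measurable_integrable)
      show "AE x in lborel. (x \<in> {t / 2..r}) = (x \<in> {t / 2..<r})"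
        using AE_lborel_singleton[of r] by eventually_elim auto
    qed
    also have "\<dots> = integral {t / 2..r} g"
      by (rule set_borel_integral_eq_integral(2)[OF i2])
    finally show ?thesis .
  qed
  have "((\<lambda>r. integral {t / 2..r} g) has_vector_derivative g t) (at t within {t / 2..T})"
    by (rule integral_has_vector_derivative[OF gc'[OF order_refl]]) (use t in auto)
  then have "((\<lambda>r. I + integral {t / 2..r} g) has_vector_derivative 0 + g t) (at t within {t / 2..T})"
    by (intro has_vector_derivative_add has_vector_derivative_const)
  then have "((\<lambda>t. set_lebesgue_integral lborel {0<..<t} g) has_vector_derivative g t) (at t within {t / 2..T})"
    using t by (intro has_vector_derivative_transform[OF _ eq]) auto
  then show ?thesis using t by (simp add: at_within_half)
qed

lemma continuous_on_set_borel_measurable: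
  fixes c :: "real \<Rightarrow> 'a::{banach, second_countable_topology}"
  assumes "continuous_on {0<..T} c" "t \<le> T"
  shows "set_borel_measurable lborel {0<..<t} c"
  unfolding set_borel_measurable_def measurable_lborel2
  by (rule borel_measurable_continuous_on_indicator) (use assms in \<open>auto elim: continuous_on_subset\<close>)

lemma ml_kernel_shift_le:
  assumes "0 < \<rho>" "\<rho> < 1" "l \<ge> 0" "t > 0" "\<alpha> \<ge> 0"
  shows "\<bar>ml_kernel \<rho> (\<rho> + \<alpha>) l t\<bar> \<le> 1 * power_kernel (\<rho> + \<alpha>) t"
proof -
  have "ml_kernel \<rho> (\<rho> + \<alpha>) l t \<ge> 0"
    using ml_kernel_nonneg_shift[of \<rho> l t \<alpha>] ml_kernel_nonneg[of \<rho> l t] assms by (cases "\<alpha> = 0") auto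
  moreover have "ml_kernel \<rho> (\<rho> + (\<alpha> + \<rho>)) l t \<ge> 0"
    using ml_kernel_nonneg_shift[of \<rho> l t "\<alpha> + \<rho>"] assms by auto
  ultimately show ?thesis using ml_kernel_rec[of \<rho> "\<rho> + \<alpha>" t l] assms by (simp add: add.assoc)
qed

text \<open>All claims follow from the corresponding ones for \<open>e\<close> by associativity: fractional integration of
  \<open>e * c\<close> is \<open>E * c\<close>, and \<open>E = 1 - l (1 * e)\<close> turns \<open>E * c\<close> into the integral of \<open>c - l (e * c)\<close>.\<close>

lemma duhamel_half_conv:
  fixes c :: "real \<Rightarrow> complex"
  assumes \<rho>: "0 < \<rho>" "\<rho> < 1" and l: "l \<ge> 0" and T: "T > 0"
    and cc: "continuous_on {0<..T} c"
    and cb: "\<And>s. 0 < s \<Longrightarrow> s \<le> T \<Longrightarrow> norm (c s) \<le> K * power_kernel \<rho> s"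
  defines "D \<equiv> half_conv (ml_kernel \<rho> \<rho> l) c" and "Q \<equiv> half_conv (ml_kernel \<rho> 1 l) c"
  shows "continuous_on {0<..T} D"
    and "\<And>t. 0 < t \<Longrightarrow> t \<le> T \<Longrightarrow> set_integrable lborel {0<..<t} (\<lambda>s. power_kernel (1 - \<rho>) (t - s) *\<^sub>R D s)"
    and "\<And>t. 0 < t \<Longrightarrow> t \<le> T \<Longrightarrow> half_conv (power_kernel (1 - \<rho>)) D t = Q t"
    and "\<And>t. 0 < t \<Longrightarrow> t \<le> T \<Longrightarrow> (Q has_vector_derivative (c t - l *\<^sub>R D t)) (at t within {0<..T})"
proof -
  have kb: "\<bar>ml_kernel \<rho> (\<rho> + \<alpha>) l s\<bar> \<le> 1 * power_kernel (\<rho> + \<alpha>) s" if "0 < s" "\<alpha> \<ge> 0" for s \<alpha>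
    using that \<rho> l by (intro ml_kernel_shift_le) auto
  have cm: "set_borel_measurable lborel {0<..<t} c" if "t \<le> T" for t
    by (rule continuous_on_set_borel_measurable[OF cc that])
  have dom: "set_integrable lborel {0<..<t} (\<lambda>s. ml_kernel \<rho> (\<rho> + \<alpha>) l (t - s) *\<^sub>R c s)"
    if "0 < t" "t \<le> T" "\<alpha> \<ge> 0" for t \<alpha>
  proof (rule half_conv_dominated(1)[of "\<rho> + \<alpha>" \<rho> t _ _ 1 K])
    show "ml_kernel \<rho> (\<rho> + \<alpha>) l \<in> borel_measurable borel"
      by (rule borel_measurable_ml_kernel) (use \<rho> that in auto)
  qed (use \<rho> that cm kb cb in auto)
  have assoc: "set_integrable lborel {0<..<t} (\<lambda>s. power_kernel \<alpha> (t - s) *\<^sub>R D s)"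
     "half_conv (power_kernel \<alpha>) D t = half_conv (ml_kernel \<rho> (\<rho> + \<alpha>) l) c t"
    if t: "0 < t" "t \<le> T" and \<alpha>: "\<alpha> > 0" for t \<alpha>
  proof -
    have hc: "half_conv (power_kernel \<alpha>) (ml_kernel \<rho> \<rho> l) s = ml_kernel \<rho> (\<rho> + \<alpha>) l s" if "s > 0" for s
      using half_conv_power_ml_kernel(2)[of \<rho> \<rho> \<alpha> s l] \<rho> that \<alpha> by simp
    have int: "set_integrable lborel {0<..<t} (\<lambda>s. half_conv (power_kernel \<alpha>) (ml_kernel \<rho> \<rho> l) (t - s) *\<^sub>R c s)"
      using dom[OF t, of \<alpha>] \<alpha> by (subst set_integrable_cong[OF refl refl]) (auto simp: hc)
    have ab: "set_integrable lborel {0<..<\<tau>} (\<lambda>s. power_kernel \<alpha> (\<tau> - s) *\<^sub>R ml_kernel \<rho> \<rho> l s)" if "0 < \<tau>" "\<tau> < t" for \<tau>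
      using half_conv_power_ml_kernel(1)[of \<rho> \<rho> \<alpha> \<tau> l] \<rho> that \<alpha> by simp
    note A = half_conv_assoc[OF t(1) borel_measurable_power_kernel borel_measurable_ml_kernel
        power_kernel_nonneg[OF \<alpha>] ml_kernel_nonneg[OF \<rho> l] cm[OF t(2)] ab int]
    show "set_integrable lborel {0<..<t} (\<lambda>s. power_kernel \<alpha> (t - s) *\<^sub>R D s)"
      unfolding D_def using \<rho> by (intro A(1)) auto
    have "half_conv (power_kernel \<alpha>) D t = half_conv (half_conv (power_kernel \<alpha>) (ml_kernel \<rho> \<rho> l)) c t"
      unfolding D_def using \<rho> by (intro A(2)) auto
    also have "\<dots> = half_conv (ml_kernel \<rho> (\<rho> + \<alpha>) l) c t"
      by (rule half_conv_cong) (simp_all add: hc)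
    finally show "half_conv (power_kernel \<alpha>) D t = half_conv (ml_kernel \<rho> (\<rho> + \<alpha>) l) c t" .
  qed
  show Dc: "continuous_on {0<..T} D"
    unfolding D_def
  proof (rule half_conv_continuous_on[of \<rho> \<rho> _ _ _ 1 K])
    show "continuous_on {0<..} (ml_kernel \<rho> \<rho> l)" by (rule continuous_on_ml_kernel) (use \<rho> in auto)
    show "\<bar>ml_kernel \<rho> \<rho> l s\<bar> \<le> 1 * power_kernel \<rho> s" if "0 < s" "s \<le> T" for s
      using kb[of s 0] that by simp
  qed (use \<rho> cc cb in auto)
  fix t assume t: "0 < t" "t \<le> T"
  show "set_integrable lborel {0<..<t} (\<lambda>s. power_kernel (1 - \<rho>) (t - s) *\<^sub>R D s)"
    using assoc(1)[OF t] \<rho> by auto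
  show "half_conv (power_kernel (1 - \<rho>)) D t = Q t"
    using assoc(2)[OF t, of "1 - \<rho>"] \<rho> by (auto simp: Q_def)
  have ci: "set_integrable lborel {0<..<r} c" if "0 < r" "r \<le> T" for r
  proof -
    have "set_integrable lborel {0<..<r} (\<lambda>s. power_kernel 1 (r - s) *\<^sub>R c s)"
      by (rule half_conv_dominated(1)[of 1 \<rho> r _ _ 1 K])
        (use \<rho> that cm cb in \<open>auto simp: power_kernel_1\<close>)
    then show ?thesis by (subst (asm) set_integrable_cong[OF refl refl]) (auto simp: power_kernel_1)
  qed
  have Di: "set_integrable lborel {0<..<r} D"
    "set_lebesgue_integral lborel {0<..<r} D = half_conv (ml_kernel \<rho> (\<rho> + 1) l) c r" if r: "0 < r" "r \<le> T" for r
  proof -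
    show "set_integrable lborel {0<..<r} D"
      using assoc(1)[OF r zero_less_one] by (subst (asm) set_integrable_cong[OF refl refl]) (auto simp: power_kernel_1)
    have "set_lebesgue_integral lborel {0<..<r} D = half_conv (power_kernel 1) D r"
      unfolding half_conv_def by (rule set_lebesgue_integral_cong) (auto simp: power_kernel_1)
    then show "set_lebesgue_integral lborel {0<..<r} D = half_conv (ml_kernel \<rho> (\<rho> + 1) l) c r"
      using assoc(2)[OF r, of 1] by simp
  qed
  have Qeq: "Q r = set_lebesgue_integral lborel {0<..<r} (\<lambda>s. c s - l *\<^sub>R D s)" if r: "0 < r" "r \<le> T" for r
  proof -
    have "Q r = set_lebesgue_integral lborel {0<..<r} (\<lambda>s. c s - l *\<^sub>R (ml_kernel \<rho> (\<rho> + 1) l (r - s) *\<^sub>R c s))"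
      unfolding Q_def half_conv_def
    proof (rule set_lebesgue_integral_cong)
      show "\<forall>s. s \<in> {0<..<r} \<longrightarrow> ml_kernel \<rho> 1 l (r - s) *\<^sub>R c s = c s - l *\<^sub>R (ml_kernel \<rho> (\<rho> + 1) l (r - s) *\<^sub>R c s)"
        using ml_kernel_rec[of \<rho> 1 _ l] \<rho> by (auto simp: power_kernel_1 scaleR_diff_left add.commute)
    qed auto
    also have "\<dots> = set_lebesgue_integral lborel {0<..<r} c - l *\<^sub>R half_conv (ml_kernel \<rho> (\<rho> + 1) l) c r"
      unfolding half_conv_def using ci[OF r] dom[OF r, of 1]
      by (subst set_integral_diff(2)) (auto simp: set_integral_scaleR_right simp del: scaleR_scaleR)
    also have "\<dots> = set_lebesgue_integral lborel {0<..<r} (\<lambda>s. c s - l *\<^sub>R D s)"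
      using ci[OF r] Di[OF r] by (subst set_integral_diff(2)) auto
    finally show ?thesis .
  qed
  have "((\<lambda>r. set_lebesgue_integral lborel {0<..<r} (\<lambda>s. c s - l *\<^sub>R D s)) has_vector_derivative (c t - l *\<^sub>R D t)) (at t within {0<..T})"
  proof (rule initial_integral_has_vector_derivative[OF _ _ t])
    show "continuous_on {0<..T} (\<lambda>s. c s - l *\<^sub>R D s)" by (intro continuous_intros cc Dc)
    show "set_integrable lborel {0<..<T} (\<lambda>s. c s - l *\<^sub>R D s)"
      using ci[of T] Di(1)[of T] T by auto
  qed
  then show "(Q has_vector_derivative (c t - l *\<^sub>R D t)) (at t within {0<..T})"
    by (rule has_vector_derivative_transform[rotated 2]) (use t Qeq in auto)
qed

section \<open>Periodic functions and characters of the torus\<close>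

abbreviation torus_char :: "int ^ 'n \<Rightarrow> real ^ 'n \<Rightarrow> complex" where
  "torus_char n x \<equiv> cis (real_vec n \<bullet> x)"

lemma real_vec_inner: "real_vec n \<bullet> x = (\<Sum>j\<in>UNIV. real_of_int (n $ j) * x $ j)"
  by (simp add: inner_vec_def real_vec_def)

lemma real_vec_0 [simp]: "real_vec 0 = 0"
  by (simp add: real_vec_def vec_eq_iff)

lemma real_vec_add: "real_vec (m + n) = real_vec m + real_vec n"
  by (simp add: real_vec_def vec_eq_iff)

lemma real_vec_uminus: "real_vec (- n) = - real_vec n"
  by (simp add: real_vec_def vec_eq_iff)

lemma real_vec_axis_inner: "real_vec n \<bullet> axis j s = real_of_int (n $ j) * s"
  by (simp add: inner_axis real_vec_def)

lemma torus_char_add: "torus_char (m + n) x = torus_char m x * torus_char n x"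
  by (simp add: real_vec_add inner_add_left cis_mult)

lemma torus_char_shift: "torus_char n (x + axis j s) = torus_char n x * cis (real_of_int (n $ j) * s)"
  by (simp add: inner_add_right real_vec_axis_inner cis_mult)

lemma continuous_on_torus_char: "continuous_on A (torus_char n)"
  by (intro continuous_intros)

lemma periodic_torus_char: "periodic (torus_char n)"
proof -
  have "cis (real_of_int k * (2 * pi)) = 1" for k
    using cis_multiple_2pi[of "real_of_int k"] by (simp add: mult_ac)
  then show ?thesis by (simp add: periodic_def torus_char_shift)
qed

lemma torus_char_in_C_torus: "torus_char n \<in> C_torus"
  by (auto simp: C_torus_def periodic_torus_char intro!: continuous_intros)

lemma C_torus_diff: "g \<in> C_torus \<Longrightarrow> h \<in> C_torus \<Longrightarrow> (\<lambda>x. g x - h x) \<in> C_torus"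
  by (auto simp: C_torus_def periodic_def intro: continuous_intros)

lemma C_torus_cmult: "g \<in> C_torus \<Longrightarrow> (\<lambda>x. c * g x) \<in> C_torus"
  by (auto simp: C_torus_def periodic_def intro: continuous_intros)

lemma C_torus_sum: "(\<And>i. i \<in> F \<Longrightarrow> g i \<in> C_torus) \<Longrightarrow> (\<lambda>x. \<Sum>i\<in>F. g i x) \<in> C_torus"
proof -
  assume g: "\<And>i. i \<in> F \<Longrightarrow> g i \<in> C_torus"
  have "periodic (\<lambda>x. \<Sum>i\<in>F. g i x)"
    unfolding periodic_def using g by (auto simp: C_torus_def periodic_def intro!: sum.cong)
  moreover have "continuous_on UNIV (\<lambda>x. \<Sum>i\<in>F. g i x)"
    by (rule continuous_on_sum) (use g in \<open>auto simp: C_torus_def\<close>)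
  ultimately show "(\<lambda>x. \<Sum>i\<in>F. g i x) \<in> C_torus" by (simp add: C_torus_def)
qed

lemma trig_sum_in_C_torus: "(\<lambda>x. \<Sum>n\<in>F. c n * torus_char n x) \<in> C_torus"
  by (rule C_torus_sum, rule C_torus_cmult, rule torus_char_in_C_torus)

section \<open>Integration over the torus\<close>

abbreviation torus_cbox :: "(real ^ 'n) set" where
  "torus_cbox \<equiv> cbox (\<chi> i. - pi) (\<chi> i. pi)"

lemma mem_torus_cbox: "x \<in> torus_cbox \<longleftrightarrow> (\<forall>j. - pi \<le> x $ j \<and> x $ j \<le> pi)"
  by (simp add: mem_box_cart)

lemma torus_borel [measurable]: "(torus :: (real ^ 'n) set) \<in> sets borel"
proof -
  have "torus = (\<Inter>j. {x :: real ^ 'n. - pi < x $ j} \<inter> {x. x $ j \<le> pi})"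
    by (auto simp: torus_def)
  moreover have "{x :: real ^ 'n. - pi < x $ j} \<inter> {x. x $ j \<le> pi} \<in> sets borel" for j
    by (intro sets.Int borel_open borel_closed open_Collect_less closed_Collect_le continuous_intros)
  moreover have "(\<Inter>j. {x :: real ^ 'n. - pi < x $ j} \<inter> {x. x $ j \<le> pi}) \<in> sets borel"
    by (intro sets.finite_INT calculation(2)) auto
  ultimately show ?thesis by simp
qed

lemma axis_1_in_Basis: "axis j (1 :: real) \<in> Basis"
  by (auto simp: Basis_vec_def)

lemma AE_torus_cbox: "AE x in lborel. x \<in> (torus_cbox :: (real ^ 'n) set) \<longleftrightarrow> x \<in> torus"
proof -
  have "AE x :: real ^ 'n in lborel. \<forall>j. x $ j \<noteq> - pi"
  proof (rule AE_finite_allI[OF finite_class.finite_UNIV, simplified])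
    fix j :: 'n
    have "axis j (1 :: real) \<in> Basis" by (rule axis_1_in_Basis)
    from AE_lborel_inner_neq[OF this, of "- pi"]
    show "AE x :: real ^ 'n in lborel. x $ j \<noteq> - pi" by (simp add: inner_axis)
  qed
  then show ?thesis
    by eventually_elim (auto simp: mem_torus_cbox torus_def order_less_le)
qed

lemma torus_integral:
  fixes f :: "real ^ 'n \<Rightarrow> 'a::euclidean_space"
  assumes "continuous_on UNIV f"
  shows "set_integrable lborel torus f"
    and "set_lebesgue_integral lborel torus f = integral torus_cbox f"
proof -
  have i: "set_integrable lborel (torus_cbox :: (real ^ 'n) set) f"
    unfolding set_integrable_def
    by (intro borel_integrable_compact compact_cbox continuous_on_subset[OF assms]) auto
  then show t: "set_integrable lborel torus f"
    by (rule set_integrable_subset) (auto simp: mem_torus_cbox torus_def order_less_imp_le)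
  have "set_lebesgue_integral lborel torus f = set_lebesgue_integral lborel torus_cbox f"
    by (rule set_integral_cong_set)
      (use i t AE_torus_cbox in \<open>auto simp: set_integrable_def set_borel_measurable_def dest: borel_measurable_integrable\<close>)
  also have "\<dots> = integral torus_cbox f"
    by (rule set_borel_integral_eq_integral(2)[OF i])
  finally show "set_lebesgue_integral lborel torus f = integral torus_cbox f" .
qed

lemma integral_cis_period:
  "integral {- pi..pi} (\<lambda>y. cis (real_of_int k * y)) = (if k = 0 then 2 * pi else 0)"
proof (cases "k = 0")
  case True
  then show ?thesis by (simp add: scaleR_conv_of_real)
next
  case False
  define c where "c = \<i> * of_int k"
  have c0: "c \<noteq> 0" using False by (simp add: c_def)
  have E: "cis (real_of_int k * y) = exp (c * of_real y)" for y
    unfolding cis_conv_exp c_def by (simp add: mult.assoc)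
  have d: "((\<lambda>y. cis (real_of_int k * y) / c) has_vector_derivative cis (real_of_int k * y)) (at y within S)" for y S
  proof -
    have "((\<lambda>w. exp (c * w)) has_field_derivative exp (c * of_real y) * c) (at (of_real y))"
      by (rule derivative_eq_intros refl)+ simp
    from DERIV_cdivide[OF this, of c]
    have "((\<lambda>w. exp (c * w) / c) has_field_derivative exp (c * of_real y)) (at (of_real y))"
      using c0 by simp
    then have "((\<lambda>y. exp (c * of_real y) / c) has_vector_derivative exp (c * of_real y)) (at y)"
      by (rule has_vector_derivative_real_field)
    then show ?thesis unfolding E by (rule has_vector_derivative_at_within)
  qed
  have "((\<lambda>y. cis (real_of_int k * y)) has_integral
      (cis (real_of_int k * pi) / c - cis (real_of_int k * - pi) / c)) {- pi..pi}"
    by (rule fundamental_theorem_of_calculus[OF _ d]) simp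
  moreover have "cis (real_of_int k * pi) = cis (real_of_int k * - pi)"
  proof -
    have "cis (real_of_int k * pi) = cis (real_of_int k * - pi) * cis (2 * pi * real_of_int k)"
      unfolding cis_mult by (rule arg_cong[where f = cis]) (simp add: algebra_simps)
    also have "cis (2 * pi * real_of_int k) = 1" by (rule cis_multiple_2pi) auto
    finally show ?thesis by simp
  qed
  ultimately show ?thesis using False by (simp add: integral_unique)
qed

text \<open>The cell is a product of intervals and the character a product of functions of one coordinate, so
  the integral factors.\<close>

lemma torus_char_orthogonality:
  "set_lebesgue_integral lborel torus (torus_char (n :: int ^ 'n)) = (if n = 0 then (2 * pi) ^ CARD('n) else 0)"
proof -
  interpret P: product_sigma_finite "\<lambda>_::real ^ 'n. lborel :: real measure" ..
  define q where "q = (\<lambda>b y. indicator {- pi<..pi} y *\<^sub>R cis ((real_vec n \<bullet> b) * y))"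
  have qm [measurable]: "q b \<in> borel_measurable borel" for b
  proof -
    have [measurable]: "(\<lambda>y. cis ((real_vec n \<bullet> b) * y)) \<in> borel_measurable borel"
      by (intro borel_measurable_continuous_onI continuous_intros)
    show ?thesis unfolding q_def by measurable
  qed
  have prod: "indicator torus x *\<^sub>R torus_char n x = (\<Prod>b\<in>Basis. q b (x \<bullet> b))" for x
  proof (cases "x \<in> torus")
    case True
    have "x \<bullet> b \<in> {- pi<..pi}" if "b \<in> Basis" for b
      using that True by (auto simp: Basis_vec_def torus_def inner_axis)
    then have "(\<Prod>b\<in>Basis. q b (x \<bullet> b)) = (\<Prod>b\<in>Basis. cis ((real_vec n \<bullet> b) * (x \<bullet> b)))"
      by (intro prod.cong) (auto simp: q_def)
    also have "\<dots> = cis (\<Sum>b\<in>Basis. (real_vec n \<bullet> b) * (x \<bullet> b))"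
    proof -
      have "(\<Prod>b\<in>F. cis ((real_vec n \<bullet> b) * (x \<bullet> b))) = cis (\<Sum>b\<in>F. (real_vec n \<bullet> b) * (x \<bullet> b))"
        if "finite F" for F
        using that by induction (auto simp: cis_mult)
      then show ?thesis by simp
    qed
    also have "\<dots> = torus_char n x" by (simp only: euclidean_inner[of "real_vec n" x])
    finally show ?thesis using True by simp
  next
    case False
    then obtain j where j: "x $ j \<notin> {- pi<..pi}" by (auto simp: torus_def)
    have "(axis j 1 :: real ^ 'n) \<in> Basis" by (rule axis_1_in_Basis)
    moreover have "q (axis j 1) (x \<bullet> axis j 1) = 0" using j by (simp add: q_def inner_axis)
    ultimately have "(\<Prod>b\<in>Basis. q b (x \<bullet> b)) = 0" by (intro prod_zero) auto
    then show ?thesis using False by simp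
  qed
  have q1: "integrable lborel (q b)" "integral\<^sup>L lborel (q b) = (if real_vec n \<bullet> b = 0 then 2 * pi else 0)" if "b \<in> Basis" for b
  proof -
    obtain j where j: "b = axis j 1" using \<open>b \<in> Basis\<close> by (auto simp: Basis_vec_def)
    have k: "real_vec n \<bullet> b = real_of_int (n $ j)" by (simp add: j real_vec_axis_inner)
    have "set_integrable lborel {- pi..pi} (\<lambda>y. cis (real_of_int (n $ j) * y))"
      by (intro borel_integrable_atLeastAtMost' continuous_intros)
    then have i: "set_integrable lborel {- pi..pi} (\<lambda>y. cis (real_of_int (n $ j) * y))" .
    then have i2: "set_integrable lborel {- pi<..pi} (\<lambda>y. cis (real_of_int (n $ j) * y))"
      by (rule set_integrable_subset) auto
    then show "integrable lborel (q b)" by (simp add: q_def k set_integrable_def)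
    have "set_lebesgue_integral lborel {- pi<..pi} (\<lambda>y. cis (real_of_int (n $ j) * y)) =
        set_lebesgue_integral lborel {- pi..pi} (\<lambda>y. cis (real_of_int (n $ j) * y))"
    proof (rule set_integral_cong_set)
      show "AE x in lborel. (x \<in> {- pi..pi}) = (x \<in> {- pi<..pi})"
        using AE_lborel_singleton[of "- pi"] by eventually_elim auto
    qed (use i i2 in \<open>auto simp: set_integrable_def set_borel_measurable_def dest: borel_measurable_integrable\<close>)
    also have "\<dots> = integral {- pi..pi} (\<lambda>y. cis (real_of_int (n $ j) * y))"
      by (rule set_borel_integral_eq_integral(2)[OF i])
    also have "\<dots> = (if n $ j = 0 then 2 * pi else 0)" by (rule integral_cis_period)
    finally show "integral\<^sup>L lborel (q b) = (if real_vec n \<bullet> b = 0 then 2 * pi else 0)"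
      by (simp add: q_def[abs_def] k set_lebesgue_integral_def)
  qed
  have "set_lebesgue_integral lborel torus (torus_char n) = (LINT x|lborel. (\<Prod>b\<in>Basis. q b (x \<bullet> b)))"
    unfolding set_lebesgue_integral_def prod ..
  also have "\<dots> = (LINT f|(\<Pi>\<^sub>M b\<in>Basis. lborel). (\<Prod>b\<in>Basis. q b ((\<Sum>b\<in>Basis. f b *\<^sub>R b) \<bullet> (b :: real ^ 'n))))"
    unfolding lborel_eq[where 'a = "real ^ 'n"] by (rule integral_distr; measurable)
  also have "\<dots> = (LINT f|(\<Pi>\<^sub>M b\<in>Basis. lborel). (\<Prod>b\<in>(Basis :: (real ^ 'n) set). q b (f b)))"
    by (intro Bochner_Integration.integral_cong prod.cong refl) (simp only: inner_sum_left_Basis)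
  also have "\<dots> = (\<Prod>b\<in>(Basis :: (real ^ 'n) set). integral\<^sup>L lborel (q b))"
    by (rule P.product_integral_prod[OF finite_Basis q1(1)])
  also have "\<dots> = (\<Prod>b\<in>(Basis :: (real ^ 'n) set). if real_vec n \<bullet> b = 0 then 2 * pi else 0)"
    by (simp add: q1(2))
  also have "\<dots> = (if n = 0 then (2 * pi) ^ CARD('n) else 0)"
  proof (cases "n = 0")
    case False
    then obtain j where "n $ j \<noteq> 0" by (auto simp: vec_eq_iff)
    then have "real_vec n \<bullet> (axis j 1) \<noteq> 0" by (simp add: real_vec_axis_inner)
    moreover have "(axis j 1 :: real ^ 'n) \<in> Basis" by (rule axis_1_in_Basis)
    ultimately have "(\<Prod>b\<in>(Basis :: (real ^ 'n) set). if real_vec n \<bullet> b = 0 then 2 * pi else 0) = 0"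
      by (intro prod_zero bexI[of _ "axis j 1"]) simp_all
    then show ?thesis using False by simp
  qed simp
  finally show ?thesis .
qed

lemma fourier_coeff_integrable:
  assumes "continuous_on UNIV (g :: real ^ 'n \<Rightarrow> complex)"
  shows "set_integrable lborel torus (\<lambda>x. g x * cis (- (real_vec n \<bullet> x)))"
  by (intro torus_integral(1) continuous_intros assms)

lemma fourier_coeff_eq_integral:
  assumes "continuous_on UNIV (g :: real ^ 'n \<Rightarrow> complex)"
  shows "fourier_coeff g n = integral torus_cbox (\<lambda>x. g x * cis (- (real_vec n \<bullet> x))) / (2 * pi) ^ CARD('n)"
  unfolding fourier_coeff_def
  by (subst torus_integral(2)) (intro continuous_intros assms, rule refl)

lemma fourier_coeff_diff:
  assumes "continuous_on UNIV g" "continuous_on UNIV h"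
  shows "fourier_coeff (\<lambda>x. g x - h x) n = fourier_coeff g n - fourier_coeff h n"
  using set_integral_diff(2)[OF fourier_coeff_integrable[OF assms(1)] fourier_coeff_integrable[OF assms(2)], of n n]
  unfolding fourier_coeff_def left_diff_distrib diff_divide_distrib[symmetric] by (simp only:)

lemma fourier_coeff_char:
  "fourier_coeff (\<lambda>x. c * torus_char m x) n = (if m = n then c else 0)"
proof -
  have "c * torus_char m x * cis (- (real_vec n \<bullet> x)) = c * torus_char (m - n) x" for x
    using torus_char_add[of m "- n" x] by (simp add: real_vec_uminus)
  then have "fourier_coeff (\<lambda>x. c * torus_char m x) n = c * set_lebesgue_integral lborel torus (torus_char (m - n)) / (2 * pi) ^ CARD('a)"
    unfolding fourier_coeff_def by (simp only: set_integral_mult_right)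
  then show ?thesis by (simp add: torus_char_orthogonality)
qed

lemma fourier_coeff_trig_sum:
  assumes "finite F"
  shows "fourier_coeff (\<lambda>x. \<Sum>m\<in>F. c m * torus_char m x) n = (if n \<in> F then c n else 0)"
proof -
  have "fourier_coeff (\<lambda>x. \<Sum>m\<in>F. c m * torus_char m x) n = (\<Sum>m\<in>F. fourier_coeff (\<lambda>x. c m * torus_char m x) n)"
    unfolding fourier_coeff_def sum_distrib_right sum_divide_distrib[symmetric] set_lebesgue_integral_def scaleR_sum_right
  proof (subst Bochner_Integration.integral_sum)
    fix m
    have "set_integrable lborel torus (\<lambda>x. (c m * torus_char m x) * cis (- (real_vec n \<bullet> x)))"
      by (intro fourier_coeff_integrable continuous_intros)
    then show "integrable lborel (\<lambda>x. indicator torus x *\<^sub>R (c m * torus_char m x * cis (- (real_vec n \<bullet> x))))"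
      by (simp add: set_integrable_def)
  qed simp
  also have "\<dots> = (if n \<in> F then c n else 0)"
    using assms by (simp add: fourier_coeff_char)
  finally show ?thesis .
qed

lemma norm_fourier_coeff_le:
  fixes g :: "real ^ 'n \<Rightarrow> complex"
  assumes g: "continuous_on UNIV g" and B: "\<And>x. norm (g x) \<le> B"
  shows "norm (fourier_coeff g n) \<le> B"
proof -
  have c: "set_integrable lborel torus (\<lambda>x :: real ^ 'n. B)" by (intro torus_integral(1) continuous_intros)
  have "of_real (set_lebesgue_integral lborel torus (\<lambda>x :: real ^ 'n. 1 :: real)) = set_lebesgue_integral lborel torus (torus_char (0 :: int ^ 'n))"
    unfolding set_lebesgue_integral_def integral_complex_of_real[symmetric]
    by (intro Bochner_Integration.integral_cong) (auto simp: indicator_def)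
  also have "\<dots> = of_real ((2 * pi) ^ CARD('n))"
    unfolding torus_char_orthogonality by simp
  finally have one: "set_lebesgue_integral lborel torus (\<lambda>x :: real ^ 'n. 1 :: real) = (2 * pi) ^ CARD('n)"
    by (simp only: of_real_eq_iff)
  have i: "set_integrable lborel torus (\<lambda>x. g x * cis (- (real_vec n \<bullet> x)))"
    by (rule fourier_coeff_integrable[OF g])
  have "norm (set_lebesgue_integral lborel torus (\<lambda>x. g x * cis (- (real_vec n \<bullet> x)))) \<le>
      set_lebesgue_integral lborel torus (\<lambda>x. norm (g x * cis (- (real_vec n \<bullet> x))))"
    by (rule set_integral_norm_bound[OF i])
  also have "\<dots> \<le> set_lebesgue_integral lborel torus (\<lambda>x :: real ^ 'n. B)"
    by (rule set_integral_mono[OF set_integrable_norm[OF i] c]) (simp add: norm_mult B)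
  also have "\<dots> = B * set_lebesgue_integral lborel torus (\<lambda>x :: real ^ 'n. 1)"
    using set_integral_mult_right[of lborel torus B "\<lambda>x :: real ^ 'n. 1"] by simp
  finally have "norm (set_lebesgue_integral lborel torus (\<lambda>x. g x * cis (- (real_vec n \<bullet> x)))) \<le> B * (2 * pi) ^ CARD('n)"
    unfolding one .
  then show ?thesis
    by (simp add: fourier_coeff_def norm_divide norm_power norm_mult field_simps)
qed

section \<open>Density of trigonometric polynomials and uniqueness of Fourier coefficients\<close>

definition torus_embed :: "real ^ 'n \<Rightarrow> complex ^ 'n" where
  "torus_embed x = (\<chi> j. cis (x $ j))"

definition arg_vec :: "complex ^ 'n \<Rightarrow> real ^ 'n" where
  "arg_vec z = (\<chi> j. Arg (z $ j))"

lemma cis_Arg_unit: "norm w = 1 \<Longrightarrow> cis (Arg w) = w"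
  using rcis_cmod_Arg[of w] by (simp add: rcis_def)

lemma torus_embed_arg_vec: "(\<And>j. norm (z $ j) = 1) \<Longrightarrow> torus_embed (arg_vec z) = z"
proof -
  assume n: "\<And>j. norm (z $ j) = 1"
  have "cis (Arg (z $ j)) = z $ j" for j
    using n by (rule cis_Arg_unit)
  then show ?thesis by (simp add: torus_embed_def arg_vec_def vec_eq_iff)
qed

lemma arg_vec_mem: "arg_vec z \<in> torus_cbox"
  using Arg_bounded by (auto simp: mem_torus_cbox arg_vec_def order_less_imp_le)

lemma periodic_int_shift:
  assumes "periodic g"
  shows "g (x + axis j (2 * pi * of_int k)) = g x"
proof -
  have nat: "g (x + axis j (2 * pi * real m)) = g x" for m x
  proof (induction m)
    case 0
    have "axis j (0 :: real) = 0" by (simp add: axis_def vec_eq_iff)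
    then have "x + axis j (2 * pi * real 0) = x" by simp
    then show ?case by (simp only:)
  next
    case (Suc m)
    have "x + axis j (2 * pi * real (Suc m)) = (x + axis j (2 * pi * real m)) + axis j (2 * pi)"
      by (auto simp: axis_def vec_eq_iff algebra_simps)
    then show ?case using Suc assms by (metis periodic_def)
  qed
  show ?thesis
  proof (cases "k \<ge> 0")
    case True
    then show ?thesis using nat[of x "nat k"] by simp
  next
    case False
    have "(x + axis j (2 * pi * of_int k)) + axis j (2 * pi * real (nat (- k))) = x"
      using False by (auto simp: axis_def vec_eq_iff algebra_simps)
    then show ?thesis using nat[of "x + axis j (2 * pi * of_int k)" "nat (- k)"] by (simp only:)
  qed
qed

lemma periodic_sum_shift:
  assumes "periodic g" "finite J"
  shows "g (x + (\<Sum>j\<in>J. axis j (2 * pi * of_int (k j)))) = g x"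
  using assms(2)
proof (induction J)
  case (insert i J)
  have "x + (\<Sum>j\<in>insert i J. axis j (2 * pi * of_int (k j))) =
      (x + (\<Sum>j\<in>J. axis j (2 * pi * of_int (k j)))) + axis i (2 * pi * of_int (k i))"
    using insert by (simp add: add_ac)
  then show ?case using insert.IH by (simp only: periodic_int_shift[OF assms(1)])
qed simp

lemma periodic_embed_eq:
  assumes "periodic g" and e: "torus_embed x = torus_embed y"
  shows "g x = g y"
proof -
  have "\<exists>k :: int. x $ j = y $ j + 2 * pi * of_int k" for j
  proof -
    have "cis (x $ j) = cis (y $ j)" using e by (simp add: torus_embed_def vec_eq_iff)
    then have "\<exists>n :: int. \<i> * complex_of_real (x $ j) = \<i> * complex_of_real (y $ j) + (of_int (2 * n) * pi) * \<i>"
      by (simp only: cis_conv_exp exp_eq)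
    then obtain n :: int where "\<i> * complex_of_real (x $ j) = \<i> * complex_of_real (y $ j) + (of_int (2 * n) * pi) * \<i>" ..
    then have "Im (\<i> * complex_of_real (x $ j)) = Im (\<i> * complex_of_real (y $ j) + (of_int (2 * n) * pi) * \<i>)"
      by (rule arg_cong)
    then have "x $ j = y $ j + 2 * pi * of_int n" by simp
    then show ?thesis ..
  qed
  then have "\<forall>j. \<exists>k :: int. x $ j = y $ j + 2 * pi * of_int k" ..
  from choice[OF this] obtain k :: "'a \<Rightarrow> int" where k: "\<And>j. x $ j = y $ j + 2 * pi * of_int (k j)" by blast
  have "(\<Sum>j\<in>UNIV. axis j (2 * pi * of_int (k j))) $ i = 2 * pi * of_int (k i)" for i
    unfolding sum_component by (simp add: axis_def)
  then have "x = y + (\<Sum>j\<in>UNIV. axis j (2 * pi * of_int (k j)))"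
    using k by (simp add: vec_eq_iff)
  then show ?thesis using periodic_sum_shift[OF assms(1) finite_class.finite_UNIV, of y k] by simp
qed

lemma torus_embed_reduce: "torus_embed (arg_vec (torus_embed x)) = torus_embed x"
  by (rule torus_embed_arg_vec) (simp add: torus_embed_def)

lemma periodic_reduce:
  assumes "periodic g"
  shows "g (arg_vec (torus_embed x)) = g x"
  by (rule periodic_embed_eq[OF assms torus_embed_reduce])

lemma continuous_on_torus_embed: "continuous_on A torus_embed"
  unfolding torus_embed_def by (intro continuous_intros)

lemma compact_range_torus_embed: "compact (range (torus_embed :: real ^ 'n \<Rightarrow> _))"
proof -
  have "range (torus_embed :: real ^ 'n \<Rightarrow> _) = torus_embed ` torus_cbox"
  proof
    show "range (torus_embed :: real ^ 'n \<Rightarrow> _) \<subseteq> torus_embed ` torus_cbox"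
    proof
      fix z assume "z \<in> range (torus_embed :: real ^ 'n \<Rightarrow> _)"
      then obtain x where "z = torus_embed x" ..
      then have "z = torus_embed (arg_vec (torus_embed x))" by (simp add: torus_embed_reduce)
      then show "z \<in> torus_embed ` torus_cbox" using arg_vec_mem by (rule image_eqI)
    qed
  qed auto
  then show ?thesis
    using compact_continuous_image[OF continuous_on_torus_embed compact_cbox] by simp
qed

text \<open>The principal argument jumps, but by periodicity it may be replaced near \<open>z\<^sub>0\<close> by the continuous
  choice \<open>Arg z\<^sub>0 + Arg (z / z\<^sub>0)\<close> in every coordinate.\<close>

lemma continuous_on_torus_factor:
  fixes g :: "real ^ 'n \<Rightarrow> complex"
  assumes g: "g \<in> C_torus"
  shows "continuous_on (range torus_embed) (\<lambda>z. g (arg_vec z))"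
  unfolding continuous_on_def
proof
  fix z0 :: "complex ^ 'n" assume z0: "z0 \<in> range torus_embed"
  have n1: "norm (z $ j) = 1" if "z \<in> range torus_embed" for z :: "complex ^ 'n" and j
    using that by (auto simp: torus_embed_def)
  define Y where "Y = (\<lambda>z. \<chi> j. Arg (z0 $ j) + Arg (z $ j / z0 $ j))"
  have z0n: "z0 $ j \<noteq> 0" for j using n1[OF z0, of j] by auto
  have "((\<lambda>z. Arg (z $ j / z0 $ j)) \<longlongrightarrow> Arg (z0 $ j / z0 $ j)) (at z0 within range torus_embed)" for j
  proof (rule isCont_tendsto_compose[where g = Arg])
    show "isCont Arg (z0 $ j / z0 $ j)" using z0n[of j] by (intro continuous_at_Arg) simp
    show "((\<lambda>z. z $ j / z0 $ j) \<longlongrightarrow> z0 $ j / z0 $ j) (at z0 within range torus_embed)"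
      using z0n[of j] by (intro tendsto_intros) auto
  qed
  then have Y: "(Y \<longlongrightarrow> Y z0) (at z0 within range torus_embed)"
    unfolding Y_def by (intro tendsto_vec_lambda tendsto_add tendsto_const)
  have "isCont g (Y z0)" using g by (simp add: C_torus_def continuous_on_eq_continuous_at)
  from isCont_tendsto_compose[OF this Y]
  have L: "((\<lambda>z. g (Y z)) \<longlongrightarrow> g (Y z0)) (at z0 within range torus_embed)" .
  have eq: "g (Y z) = g (arg_vec z)" if z: "z \<in> range torus_embed" for z
  proof (rule periodic_embed_eq)
    show "periodic g" using g by (simp add: C_torus_def)
    have "cis (Arg (z0 $ j) + Arg (z $ j / z0 $ j)) = z $ j" for j
    proof -
      have "cis (Arg (z0 $ j) + Arg (z $ j / z0 $ j)) = z0 $ j * (z $ j / z0 $ j)"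
        unfolding cis_mult[symmetric] using n1[OF z0, of j] n1[OF z, of j] by (simp add: cis_Arg_unit norm_divide)
      then show ?thesis using z0n[of j] by simp
    qed
    then have "torus_embed (Y z) = z" by (simp add: torus_embed_def Y_def vec_eq_iff)
    then show "torus_embed (Y z) = torus_embed (arg_vec z)"
      using torus_embed_arg_vec[OF n1[OF z]] by simp
  qed
  show "((\<lambda>z. g (arg_vec z)) \<longlongrightarrow> g (arg_vec z0)) (at z0 within range torus_embed)"
    using L unfolding eq[OF z0]
    by (rule Lim_transform_eventually) (auto simp: eventually_at_filter eq intro!: always_eventually)
qed

definition trig_polys :: "(real ^ 'n \<Rightarrow> complex) set" where
  "trig_polys = {p. \<exists>F c. finite F \<and> p = (\<lambda>x. \<Sum>n\<in>F. c n * torus_char n x)}"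

lemma trig_polys_monomial: "(\<lambda>x. c * torus_char n x) \<in> trig_polys"
  unfolding trig_polys_def by (auto intro!: exI[of _ "{n}"] exI[of _ "\<lambda>_. c"])

lemma trig_polys_add:
  assumes "p \<in> trig_polys" "q \<in> trig_polys"
  shows "(\<lambda>x. p x + q x) \<in> trig_polys"
proof -
  obtain F c where F: "finite F" "p = (\<lambda>x. \<Sum>n\<in>F. c n * torus_char n x)"
    using assms(1) by (auto simp: trig_polys_def)
  obtain G d where G: "finite G" "q = (\<lambda>x. \<Sum>n\<in>G. d n * torus_char n x)"
    using assms(2) by (auto simp: trig_polys_def)
  define e where "e = (\<lambda>n. (if n \<in> F then c n else 0) + (if n \<in> G then d n else 0))"
  have "p x + q x = (\<Sum>n\<in>F \<union> G. e n * torus_char n x)" for x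
  proof -
    have "(\<Sum>n\<in>F \<union> G. (if n \<in> F then c n else 0) * torus_char n x) = p x"
      unfolding F(2) by (rule sum.mono_neutral_cong_right) (use F(1) G(1) in auto)
    moreover have "(\<Sum>n\<in>F \<union> G. (if n \<in> G then d n else 0) * torus_char n x) = q x"
      unfolding G(2) by (rule sum.mono_neutral_cong_right) (use F(1) G(1) in auto)
    ultimately show ?thesis unfolding e_def distrib_right sum.distrib by simp
  qed
  then have "(\<lambda>x. p x + q x) = (\<lambda>x. \<Sum>n\<in>F \<union> G. e n * torus_char n x)" by (rule ext)
  then show ?thesis unfolding trig_polys_def using F(1) G(1) by blast
qed

lemma trig_polys_sum:
  assumes "\<And>i. i \<in> I \<Longrightarrow> p i \<in> trig_polys"
  shows "(\<lambda>x. \<Sum>i\<in>I. p i x) \<in> trig_polys"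
proof (cases "finite I")
  case True
  then show ?thesis using assms
  proof (induction I)
    case empty
    show ?case using trig_polys_monomial[of 0] by simp
  next
    case (insert i I)
    then show ?case using trig_polys_add[of "p i" "\<lambda>x. \<Sum>i\<in>I. p i x"] by simp
  qed
next
  case False
  then show ?thesis using trig_polys_monomial[of 0] by simp
qed

lemma trig_polys_mult:
  assumes "p \<in> trig_polys" "q \<in> trig_polys"
  shows "(\<lambda>x. p x * q x) \<in> trig_polys"
proof -
  obtain F c where F: "finite F" "p = (\<lambda>x. \<Sum>n\<in>F. c n * torus_char n x)"
    using assms(1) by (auto simp: trig_polys_def)
  obtain G d where G: "finite G" "q = (\<lambda>x. \<Sum>n\<in>G. d n * torus_char n x)"
    using assms(2) by (auto simp: trig_polys_def)
  have "(c n * torus_char n x) * (d m * torus_char m x) = (c n * d m) * torus_char (n + m) x" for n m x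
    unfolding torus_char_add by (simp only: mult_ac)
  then have "(\<lambda>x. p x * q x) = (\<lambda>x. \<Sum>n\<in>F. \<Sum>m\<in>G. (c n * d m) * torus_char (n + m) x)"
    unfolding F(2) G(2) by (simp only: sum_product)
  also have "\<dots> \<in> trig_polys"
    by (rule trig_polys_sum, rule trig_polys_sum, rule trig_polys_monomial)
  finally show ?thesis .
qed

lemma trig_polys_const: "(\<lambda>x. c) \<in> trig_polys"
  using trig_polys_monomial[of c 0] by simp

lemma trig_polys_cmult: "p \<in> trig_polys \<Longrightarrow> (\<lambda>x. c * p x) \<in> trig_polys"
  by (rule trig_polys_mult[OF trig_polys_const])

lemma trig_polys_cos_sin:
  "(\<lambda>x. complex_of_real (cos (x $ j))) \<in> trig_polys" "(\<lambda>x. complex_of_real (sin (x $ j))) \<in> trig_polys"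
proof -
  have a: "torus_char (axis j 1) x = cis (x $ j)" "torus_char (- axis j 1) x = cis (- (x $ j))" for x
  proof -
    have "real_vec (axis j 1) = axis j 1" by (simp add: real_vec_def axis_def vec_eq_iff)
    then show "torus_char (axis j 1) x = cis (x $ j)" "torus_char (- axis j 1) x = cis (- (x $ j))"
      by (simp_all add: real_vec_uminus inner_axis')
  qed
  have c: "complex_of_real (cos y) = (1 / 2) * cis y + (1 / 2) * cis (- y)"
    and s: "complex_of_real (sin y) = (- \<i> / 2) * cis y + (\<i> / 2) * cis (- y)" for y
    by (auto simp: complex_eq_iff)
  show "(\<lambda>x. complex_of_real (cos (x $ j))) \<in> trig_polys"
    unfolding c a[symmetric] by (rule trig_polys_add; rule trig_polys_monomial)
  show "(\<lambda>x. complex_of_real (sin (x $ j))) \<in> trig_polys"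
    unfolding s a[symmetric] by (rule trig_polys_add; rule trig_polys_monomial)
qed

text \<open>A real-linear form on the embedded torus is a combination of \<open>cos x\<^sub>j\<close> and \<open>sin x\<^sub>j\<close>, and
  trigonometric polynomials form an algebra.\<close>

lemma trig_polys_real_polynomial:
  fixes P :: "complex ^ 'n \<Rightarrow> real"
  assumes "real_polynomial_function P"
  shows "(\<lambda>x. complex_of_real (P (torus_embed x))) \<in> trig_polys"
  using assms
proof (induction P)
  case (linear f)
  interpret bounded_linear f by (rule linear)
  have "f (torus_embed x) = (\<Sum>j\<in>UNIV. cos (x $ j) * f (axis j 1) + sin (x $ j) * f (axis j \<i>))" for x
  proof -
    have "torus_embed x = (\<Sum>j\<in>UNIV. cos (x $ j) *\<^sub>R axis j 1 + sin (x $ j) *\<^sub>R axis j \<i>)"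
    proof -
      have "(\<Sum>j\<in>UNIV. cos (x $ j) *\<^sub>R axis j 1 + sin (x $ j) *\<^sub>R axis j \<i>) $ i =
          (\<Sum>j\<in>UNIV. if j = i then cis (x $ i) else 0)" for i
        unfolding sum_component by (rule sum.cong) (auto simp: axis_def complex_eq_iff)
      then show ?thesis by (simp add: vec_eq_iff torus_embed_def)
    qed
    then show ?thesis by (simp add: sum add scaleR)
  qed
  then have "(\<lambda>x. complex_of_real (f (torus_embed x))) =
     (\<lambda>x. \<Sum>j\<in>UNIV. of_real (f (axis j 1)) * of_real (cos (x $ j)) + of_real (f (axis j \<i>)) * of_real (sin (x $ j)))"
    by (simp add: mult.commute)
  also have "\<dots> \<in> trig_polys"
    by (rule trig_polys_sum, rule trig_polys_add; rule trig_polys_cmult; rule trig_polys_cos_sin)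
  finally show ?case .
next
  case (const c)
  then show ?case by (rule trig_polys_const)
next
  case (add f g)
  then show ?case unfolding of_real_add by (intro trig_polys_add)
next
  case (mult f g)
  then show ?case unfolding of_real_mult by (intro trig_polys_mult)
qed

text \<open>The Stone-Weierstrass theorem on the compact image of the torus under \<open>x \<mapsto> (cis x\<^sub>j)\<^sub>j\<close>.\<close>

lemma trig_polys_dense:
  fixes g :: "real ^ 'n \<Rightarrow> complex"
  assumes g: "g \<in> C_torus" and e: "e > 0"
  obtains p where "p \<in> trig_polys" "\<And>x. norm (g x - p x) < e"
proof -
  obtain P where P: "polynomial_function P" "\<forall>z\<in>range torus_embed. norm (g (arg_vec z) - P z) < e"
    using Stone_Weierstrass_polynomial_function[OF compact_range_torus_embed continuous_on_torus_factor[OF g] e] by auto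
  have r: "real_polynomial_function (Re \<circ> P)" "real_polynomial_function (Im \<circ> P)"
    using P(1) bounded_linear_Re bounded_linear_Im by (auto simp: polynomial_function_def)
  define p where "p = (\<lambda>x. complex_of_real ((Re \<circ> P) (torus_embed x)) + \<i> * complex_of_real ((Im \<circ> P) (torus_embed x)))"
  show thesis
  proof (rule that[of p])
    show "p \<in> trig_polys"
      unfolding p_def by (intro trig_polys_add trig_polys_cmult trig_polys_real_polynomial r)
    have pP: "p x = P (torus_embed x)" for x
      by (simp add: p_def complex_eq_iff)
    have "periodic g" using g by (simp add: C_torus_def)
    then show "norm (g x - p x) < e" for x
      unfolding pP using P(2) periodic_reduce[of g x] by (metis rangeI)
  qed
qed

text \<open>Such a \<open>g\<close> is orthogonal to all trigonometric polynomials, and the conjugate of \<open>g\<close> is a uniform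
  limit of those; hence the integral of \<open>\<bar>g\<bar>\<^sup>2\<close> vanishes.\<close>

lemma C_torus_zero_fourier_imp_zero:
  fixes g :: "real ^ 'n \<Rightarrow> complex"
  assumes g: "g \<in> C_torus" and z: "\<And>n. fourier_coeff g n = 0"
  shows "g x = 0"
proof -
  have gc: "continuous_on UNIV g" and gp: "periodic g" using g by (auto simp: C_torus_def)
  have cg: "(\<lambda>x. cnj (g x)) \<in> C_torus"
    using g by (auto simp: C_torus_def periodic_def intro: continuous_intros)
  have tz: "set_lebesgue_integral lborel torus (\<lambda>x. g x * (c * torus_char m x)) = 0" for m c
  proof -
    have "set_lebesgue_integral lborel torus (\<lambda>x. g x * cis (- (real_vec (- m) \<bullet> x))) = 0"
      using z[of "- m"] by (simp add: fourier_coeff_def)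
    then have "c * set_lebesgue_integral lborel torus (\<lambda>x. g x * torus_char m x) = 0"
      by (simp add: real_vec_uminus)
    then show ?thesis
      unfolding set_integral_mult_right[symmetric] by (simp only: mult.left_commute)
  qed
  have pz: "set_lebesgue_integral lborel torus (\<lambda>x. g x * p x) = 0" if p: "p \<in> trig_polys" for p
  proof -
    obtain F c where F: "finite F" "p = (\<lambda>x. \<Sum>n\<in>F. c n * torus_char n x)"
      using p by (auto simp: trig_polys_def)
    have i: "set_integrable lborel torus (\<lambda>x. g x * (c m * torus_char m x))" for m
      by (intro torus_integral(1) continuous_on_mult gc continuous_on_torus_char continuous_on_const)
    have "set_lebesgue_integral lborel torus (\<lambda>x. g x * p x) =
      (\<Sum>m\<in>F. set_lebesgue_integral lborel torus (\<lambda>x. g x * (c m * torus_char m x)))"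
      unfolding F(2) set_lebesgue_integral_def sum_distrib_left scaleR_sum_right
      by (rule Bochner_Integration.integral_sum) (rule i[unfolded set_integrable_def])
    then show ?thesis by (simp only: tz sum.neutral_const)
  qed
  define I where "I = set_lebesgue_integral lborel torus (\<lambda>x. norm (g x))"
  have ni: "set_integrable lborel torus (\<lambda>x. norm (g x))"
    by (intro torus_integral(1) continuous_intros gc)
  have I0: "I \<ge> 0" unfolding I_def set_lebesgue_integral_def by (rule Bochner_Integration.integral_nonneg) simp
  define S where "S = set_lebesgue_integral lborel torus (\<lambda>x. g x * cnj (g x))"
  have "norm S \<le> e * I" if e: "e > 0" for e
  proof -
    obtain p where p: "p \<in> trig_polys" "\<And>x. norm (cnj (g x) - p x) < e"
      using trig_polys_dense[OF cg e] by blast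
    have pc: "continuous_on UNIV p"
      using p(1) trig_sum_in_C_torus by (auto simp: trig_polys_def C_torus_def)
    have i1: "set_integrable lborel torus (\<lambda>x. g x * cnj (g x))" "set_integrable lborel torus (\<lambda>x. g x * p x)"
      "set_integrable lborel torus (\<lambda>x. g x * (cnj (g x) - p x))"
      by (intro torus_integral(1) continuous_intros gc pc)+
    have "S = set_lebesgue_integral lborel torus (\<lambda>x. g x * (cnj (g x) - p x))"
      using set_integral_diff(2)[OF i1(1,2)] pz[OF p(1)] by (simp add: S_def right_diff_distrib)
    also have "norm \<dots> \<le> set_lebesgue_integral lborel torus (\<lambda>x. norm (g x * (cnj (g x) - p x)))"
      by (rule set_integral_norm_bound[OF i1(3)])
    also have "\<dots> \<le> set_lebesgue_integral lborel torus (\<lambda>x. e * norm (g x))"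
    proof (rule set_integral_mono[OF set_integrable_norm[OF i1(3)]])
      show "set_integrable lborel torus (\<lambda>x. e * norm (g x))" using ni by simp
      fix x show "norm (g x * (cnj (g x) - p x)) \<le> e * norm (g x)"
        unfolding norm_mult 
        using mult_right_mono[OF less_imp_le[OF p(2)[of x]] norm_ge_zero[of "g x"]] by (simp only: mult.commute)
    qed
    also have "\<dots> = e * I" by (simp add: I_def)
    finally show ?thesis .
  qed
  then have "norm S \<le> 0"
  proof -
    assume h: "\<And>e. e > 0 \<Longrightarrow> norm S \<le> e * I"
    have "((\<lambda>e. e * I) \<longlongrightarrow> 0 * I) (at_right 0)" by (intro tendsto_intros)
    then show "norm S \<le> 0"
      by (intro tendsto_lowerbound[of "\<lambda>e. e * I" "0" "at_right 0"])
        (auto simp: eventually_at_right_field h intro: exI[of _ 1])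
  qed
  then have S0: "S = 0" by simp
  have "complex_of_real (set_lebesgue_integral lborel torus (\<lambda>x. (norm (g x))\<^sup>2)) = S"
    unfolding S_def set_lebesgue_integral_def integral_complex_of_real[symmetric]
    by (intro Bochner_Integration.integral_cong refl) (simp add: scaleR_conv_of_real flip: complex_norm_square)
  then have "set_lebesgue_integral lborel torus (\<lambda>x. (norm (g x))\<^sup>2) = 0" using S0 by simp
  moreover have cn: "continuous_on UNIV (\<lambda>x. (norm (g x))\<^sup>2)" by (intro continuous_intros gc)
  ultimately have "integral torus_cbox (\<lambda>x. (norm (g x))\<^sup>2) = 0"
    using torus_integral(2)[OF cn] by simp
  moreover have "(0 :: real ^ 'n) \<in> box (\<chi> i. - pi) (\<chi> i. pi)" by (simp add: mem_box_cart)
  ultimately have "\<forall>x\<in>torus_cbox. (norm (g x))\<^sup>2 = 0"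
    using integral_cbox_eq_0_iff[of "\<chi> i. - pi" "\<chi> i. pi" "\<lambda>x. (norm (g x))\<^sup>2"] cn
    by (metis (no_types, lifting) continuous_on_subset empty_iff subset_UNIV zero_le_power2)
  then have "g (arg_vec (torus_embed x)) = 0" using arg_vec_mem[of "torus_embed x"] by simp
  then show ?thesis using periodic_reduce[OF gp, of x] by simp
qed

lemma trig_series_uniform:
  fixes c :: "int ^ 'n \<Rightarrow> complex"
  assumes "(\<lambda>n. norm (c n)) summable_on UNIV"
  shows "uniform_limit UNIV (\<lambda>F x. \<Sum>n\<in>F. c n * torus_char n x) (\<lambda>x. \<Sum>\<^sub>\<infinity>n. c n * torus_char n x)
    (finite_subsets_at_top UNIV)"
  by (rule Weierstrass_m_test_general[OF _ assms]) (simp add: norm_mult)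

lemma trig_series_in_C_torus:
  fixes c :: "int ^ 'n \<Rightarrow> complex"
  assumes "(\<lambda>n. norm (c n)) summable_on UNIV"
  shows "(\<lambda>x. \<Sum>\<^sub>\<infinity>n. c n * torus_char n x) \<in> C_torus"
proof -
  have "continuous_on UNIV (\<lambda>x. \<Sum>\<^sub>\<infinity>n. c n * torus_char n x)"
  proof (rule uniform_limit_theorem[OF _ trig_series_uniform[OF assms]])
    show "\<forall>\<^sub>F F in finite_subsets_at_top UNIV. continuous_on UNIV (\<lambda>x. \<Sum>n\<in>F. c n * torus_char n x)"
      using trig_sum_in_C_torus by (intro always_eventually) (auto simp: C_torus_def)
  qed simp
  moreover have "torus_char n (x + axis j (2 * pi)) = torus_char n x" for n :: "int ^ 'n" and x j
    using periodic_torus_char[of n] by (simp only: periodic_def)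
  ultimately show ?thesis by (simp only: C_torus_def periodic_def mem_Collect_eq) simp
qed

lemma fourier_coeff_uniform_limit:
  fixes g :: "'b \<Rightarrow> real ^ 'n \<Rightarrow> complex"
  assumes u: "uniform_limit UNIV g h F" and gc: "\<forall>\<^sub>F i in F. continuous_on UNIV (g i)"
    and hc: "continuous_on UNIV h"
  shows "((\<lambda>i. fourier_coeff (g i) n) \<longlongrightarrow> fourier_coeff h n) F"
proof (rule tendstoI)
  fix e :: real assume e: "e > 0"
  have "\<forall>\<^sub>F i in F. \<forall>x\<in>UNIV. dist (g i x) (h x) < e / 2"
    using u e by (intro uniform_limitD) auto
  then show "\<forall>\<^sub>F i in F. dist (fourier_coeff (g i) n) (fourier_coeff h n) < e"
    using gc
  proof eventually_elim
    case (elim i)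
    have "norm (fourier_coeff (\<lambda>x. g i x - h x) n) \<le> e / 2"
      using elim hc by (intro norm_fourier_coeff_le continuous_intros) (auto simp: dist_norm intro: less_imp_le)
    then show ?case using e fourier_coeff_diff[OF elim(2) hc, of n] by (simp add: dist_norm)
  qed
qed

lemma fourier_coeff_trig_series:
  fixes c :: "int ^ 'n \<Rightarrow> complex"
  assumes "(\<lambda>n. norm (c n)) summable_on UNIV"
  shows "fourier_coeff (\<lambda>x. \<Sum>\<^sub>\<infinity>n. c n * torus_char n x) n = c n"
proof (rule tendsto_unique)
  show "((\<lambda>F. fourier_coeff (\<lambda>x. \<Sum>n\<in>F. c n * torus_char n x) n) \<longlongrightarrow>
      fourier_coeff (\<lambda>x. \<Sum>\<^sub>\<infinity>n. c n * torus_char n x) n) (finite_subsets_at_top UNIV)"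
  proof (rule fourier_coeff_uniform_limit[OF trig_series_uniform[OF assms]])
    show "\<forall>\<^sub>F F in finite_subsets_at_top UNIV. continuous_on UNIV (\<lambda>x. \<Sum>n\<in>F. c n * torus_char n x)"
      using trig_sum_in_C_torus by (intro always_eventually) (auto simp: C_torus_def)
    show "continuous_on UNIV (\<lambda>x. \<Sum>\<^sub>\<infinity>n. c n * torus_char n x)"
      using trig_series_in_C_torus[OF assms] by (simp add: C_torus_def)
  qed
  have "\<forall>\<^sub>F F in finite_subsets_at_top UNIV. finite F \<and> n \<in> F"
    using eventually_finite_subsets_at_top[of "\<lambda>F. finite F \<and> n \<in> F" UNIV] by (metis finite.emptyI finite.insertI insert_subset subset_UNIV empty_subsetI)
  then show "((\<lambda>F. fourier_coeff (\<lambda>x. \<Sum>n\<in>F. c n * torus_char n x) n) \<longlongrightarrow> c n) (finite_subsets_at_top UNIV)"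
    by (intro tendsto_eventually) (elim eventually_mono, simp add: fourier_coeff_trig_sum)
qed simp

text \<open>The sum of the series is continuous and has the same coefficients as \<open>g\<close>.\<close>

lemma fourier_series_eq:
  fixes g :: "real ^ 'n \<Rightarrow> complex"
  assumes g: "g \<in> C_torus" and s: "(\<lambda>n. norm (fourier_coeff g n)) summable_on UNIV"
  shows "g x = (\<Sum>\<^sub>\<infinity>n. fourier_coeff g n * torus_char n x)"
proof -
  define h where "h = (\<lambda>x. \<Sum>\<^sub>\<infinity>n. fourier_coeff g n * torus_char n x)"
  have h: "h \<in> C_torus" unfolding h_def by (rule trig_series_in_C_torus[OF s])
  have "fourier_coeff (\<lambda>x. g x - h x) n = 0" for n
    using g h fourier_coeff_diff[of g h n] fourier_coeff_trig_series[OF s, of n]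
    by (simp add: C_torus_def h_def)
  from C_torus_zero_fourier_imp_zero[OF C_torus_diff[OF g h] this, of x]
  show ?thesis by (simp add: h_def)
qed

section \<open>The maximum principle\<close>

abbreviation freq_sq :: "int ^ 'n \<Rightarrow> real" where
  "freq_sq n \<equiv> (norm (real_vec n))\<^sup>2"

text \<open>The relaxation function \<open>E\<close> in a form that makes sense at \<open>t = 0\<close>: there
  \<open>ml_kernel \<rho> 1 l\<close> has the factor \<open>0 powr 0 = 0\<close>.\<close>

definition relax :: "real \<Rightarrow> real \<Rightarrow> real \<Rightarrow> real" where
  "relax \<rho> l t = mittag_leffler \<rho> 1 (- (l * t powr \<rho>))"

lemma relax_0 [simp]: "relax \<rho> l 0 = 1"
  by (simp add: relax_def)

lemma relax_eq_ml_kernel: "t > 0 \<Longrightarrow> relax \<rho> l t = ml_kernel \<rho> 1 l t"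
  by (simp add: relax_def ml_kernel_def)

lemma continuous_on_relax:
  assumes "\<rho> > 0"
  shows "continuous_on {0..} (relax \<rho> l)"
  unfolding relax_def
  by (intro continuous_on_mittag_leffler continuous_on_minus continuous_on_mult continuous_on_const
      continuous_on_powr' continuous_on_id) (use assms in auto)

lemma freq_sq_eq: "freq_sq n = (\<Sum>j\<in>UNIV. (real_of_int (n $ j))\<^sup>2)"
  unfolding power2_norm_eq_inner real_vec_inner by (simp add: real_vec_def power2_eq_square)

lemma cos_second_difference:
  "((\<lambda>s. (2 * cos (k * s) - 2) / s\<^sup>2) \<longlongrightarrow> - (k\<^sup>2)) (at (0 :: real))"
proof -
  have "((\<lambda>s. sin (k / 2 * s)) has_real_derivative cos (k / 2 * 0) * (k / 2)) (at 0)"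
    by (auto intro!: derivative_eq_intros)
  then have "((\<lambda>s. sin (k / 2 * s) / s) \<longlongrightarrow> k / 2) (at 0)"
    by (simp add: has_field_derivative_iff)
  then have "((\<lambda>s. - 4 * (sin (k / 2 * s) / s)\<^sup>2) \<longlongrightarrow> - 4 * (k / 2)\<^sup>2) (at 0)"
    by (intro tendsto_mult tendsto_const tendsto_power)
  moreover have "- 4 * (sin (k / 2 * s) / s)\<^sup>2 = (2 * cos (k * s) - 2) / s\<^sup>2" for s
  proof -
    have "cos (k * s) = cos (2 * (k / 2 * s))" by simp
    also have "\<dots> = 1 - 2 * (sin (k / 2 * s))\<^sup>2" by (rule cos_double_sin)
    finally show ?thesis by (simp add: power_divide)
  qed
  moreover have "- 4 * (k / 2)\<^sup>2 = - (k\<^sup>2)" by (simp add: power_divide)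
  ultimately show ?thesis by simp
qed

text \<open>The right-hand side is minus the Laplacian of the real part at its maximum. Symmetric second
  differences are nonpositive there, and for a finite sum their limit can be computed term by
  term.\<close>

lemma trig_sum_laplacian_at_max:
  fixes d :: "int ^ 'n \<Rightarrow> complex"
  assumes max: "\<And>x. Re (\<Sum>n\<in>F. d n * torus_char n x) \<le> Re (\<Sum>n\<in>F. d n * torus_char n x0)"
  shows "0 \<le> (\<Sum>n\<in>F. freq_sq n * Re (d n * torus_char n x0))"
proof -
  define r where "r = (\<lambda>n. Re (d n * torus_char n x0))"
  have J: "0 \<le> (\<Sum>n\<in>F. (real_of_int (n $ j))\<^sup>2 * r n)" for j
  proof -
    have "((\<lambda>s. \<Sum>n\<in>F. r n * ((2 * cos (real_of_int (n $ j) * s) - 2) / s\<^sup>2)) \<longlongrightarrow>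
        (\<Sum>n\<in>F. r n * - ((real_of_int (n $ j))\<^sup>2))) (at 0)"
      by (intro tendsto_sum tendsto_mult tendsto_const cos_second_difference)
    moreover have "(\<Sum>n\<in>F. r n * ((2 * cos (real_of_int (n $ j) * s) - 2) / s\<^sup>2)) \<le> 0" for s
    proof -
      have "Re (d n * torus_char n (x0 + axis j s)) + Re (d n * torus_char n (x0 + axis j (- s))) - 2 * r n =
          r n * (2 * cos (real_of_int (n $ j) * s) - 2)" for n
        unfolding torus_char_shift r_def by (simp add: algebra_simps)
      then have "(\<Sum>n\<in>F. r n * (2 * cos (real_of_int (n $ j) * s) - 2)) =
          (\<Sum>n\<in>F. Re (d n * torus_char n (x0 + axis j s))) + (\<Sum>n\<in>F. Re (d n * torus_char n (x0 + axis j (- s)))) - 2 * (\<Sum>n\<in>F. r n)"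
        by (simp only: sum.distrib[symmetric] sum_subtractf[symmetric] sum_distrib_left)
      also have "\<dots> \<le> 0"
        using max[of "x0 + axis j s"] max[of "x0 + axis j (- s)"] by (simp add: r_def)
      finally have "(\<Sum>n\<in>F. r n * (2 * cos (real_of_int (n $ j) * s) - 2)) / s\<^sup>2 \<le> 0"
        by (intro divide_nonpos_nonneg) auto
      then show ?thesis unfolding sum_divide_distrib times_divide_eq_right .
    qed
    ultimately have "(\<Sum>n\<in>F. r n * - ((real_of_int (n $ j))\<^sup>2)) \<le> 0"
      by (intro tendsto_upperbound[of _ _ "at (0::real)"]) auto
    then show ?thesis by (simp add: sum_negf mult.commute)
  qed
  have "0 \<le> (\<Sum>j\<in>UNIV. \<Sum>n\<in>F. (real_of_int (n $ j))\<^sup>2 * r n)"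
    by (rule sum_nonneg) (rule J)
  also have "\<dots> = (\<Sum>n\<in>F. freq_sq n * r n)"
    unfolding freq_sq_eq sum_distrib_right by (rule sum.swap)
  finally show ?thesis by (simp add: r_def)
qed

lemma half_conv_sum:
  fixes h :: "'b \<Rightarrow> real \<Rightarrow> real"
  assumes "\<And>i. i \<in> I \<Longrightarrow> set_integrable lborel {0<..<t} (\<lambda>s. k (t - s) *\<^sub>R h i s)"
  shows "set_integrable lborel {0<..<t} (\<lambda>s. k (t - s) *\<^sub>R (\<Sum>i\<in>I. d i * h i s))"
    and "half_conv k (\<lambda>s. \<Sum>i\<in>I. d i * h i s) t = (\<Sum>i\<in>I. d i * half_conv k (h i) t)"
proof -
  have E: "indicator {0<..<t} s *\<^sub>R (k (t - s) *\<^sub>R (\<Sum>i\<in>I. d i * h i s)) =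
      (\<Sum>i\<in>I. d i * (indicator {0<..<t} s *\<^sub>R (k (t - s) *\<^sub>R h i s)))" for s
    by (simp add: sum_distrib_left mult_ac)
  have i: "integrable lborel (\<lambda>s. d i * (indicator {0<..<t} s *\<^sub>R (k (t - s) *\<^sub>R h i s)))" if "i \<in> I" for i
    using assms[OF that] by (intro integrable_mult_right) (simp only: set_integrable_def)
  show "set_integrable lborel {0<..<t} (\<lambda>s. k (t - s) *\<^sub>R (\<Sum>i\<in>I. d i * h i s))"
    unfolding set_integrable_def E by (rule Bochner_Integration.integrable_sum[OF i])
  show "half_conv k (\<lambda>s. \<Sum>i\<in>I. d i * h i s) t = (\<Sum>i\<in>I. d i * half_conv k (h i) t)"
    unfolding half_conv_def set_lebesgue_integral_def E
    by (subst Bochner_Integration.integral_sum[OF i]) simp_all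
qed

text \<open>The maximum principle for the time-fractional heat equation. If the bound failed, \<open>V\<close> would attain
  a maximum exceeding \<open>B\<close> at a time \<open>t\<^sub>0 > 0\<close>. Then \<open>h(s) = V(x\<^sub>0, 0) - V(x\<^sub>0, s)\<close> has a negative minimum at
  \<open>t\<^sub>0\<close>, so its Riemann-Liouville derivative is negative there; but by the equation that derivative is
  \<open>- \<Delta> V(x\<^sub>0, t\<^sub>0)\<close>, which is nonnegative at a maximum.\<close>

lemma trig_relax_max_principle:
  fixes c :: "int ^ 'n \<Rightarrow> complex"
  assumes \<rho>: "0 < \<rho>" "\<rho> < 1" and F: "finite F"
    and B: "\<And>x. Re (\<Sum>n\<in>F. c n * torus_char n x) \<le> B" and t1: "t1 \<ge> 0"
  shows "Re (\<Sum>n\<in>F. (c n * of_real (relax \<rho> (freq_sq n) t1)) * torus_char n x1) \<le> B"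
proof (rule ccontr)
  define V where "V = (\<lambda>x t. Re (\<Sum>n\<in>F. (c n * of_real (relax \<rho> (freq_sq n) t)) * torus_char n x))"
  assume "\<not> ?thesis"
  then have V1: "V x1 t1 > B" by (simp add: V_def)
  have Vp: "V (arg_vec (torus_embed x)) t = V x t" for x t
  proof -
    have "(\<lambda>x. \<Sum>n\<in>F. (c n * of_real (relax \<rho> (freq_sq n) t)) * torus_char n x) \<in> C_torus"
      by (rule trig_sum_in_C_torus)
    then have "periodic (\<lambda>x. \<Sum>n\<in>F. (c n * of_real (relax \<rho> (freq_sq n) t)) * torus_char n x)"
      by (simp add: C_torus_def)
    from periodic_reduce[OF this, of x] show ?thesis by (simp only: V_def)
  qed
  have rc: "continuous_on (torus_cbox \<times> {0..t1}) (\<lambda>p :: (real ^ 'n) \<times> real. relax \<rho> l (snd p))" for l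
    by (rule continuous_on_compose2[OF continuous_on_relax continuous_on_snd[OF continuous_on_id]]) (use \<rho> in auto)
  have cc: "continuous_on (torus_cbox \<times> {0..t1}) (\<lambda>p :: (real ^ 'n) \<times> real. torus_char n (fst p))" for n
    by (intro continuous_intros)
  have "continuous_on (torus_cbox \<times> {0..t1}) (\<lambda>p. V (fst p) (snd p))"
    unfolding V_def by (intro continuous_on_Re continuous_on_sum continuous_on_mult continuous_on_const continuous_on_of_real rc cc)
  moreover have "compact ((torus_cbox :: (real ^ 'n) set) \<times> {0..t1})"
    by (intro compact_Times compact_cbox compact_Icc)
  moreover have "(arg_vec (torus_embed x1), t1) \<in> (torus_cbox :: (real ^ 'n) set) \<times> {0..t1}"
    using arg_vec_mem t1 by auto
  ultimately obtain p where p: "p \<in> (torus_cbox :: (real ^ 'n) set) \<times> {0..t1}"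
      "\<And>q. q \<in> torus_cbox \<times> {0..t1} \<Longrightarrow> V (fst q) (snd q) \<le> V (fst p) (snd p)"
    using continuous_attains_sup[of "(torus_cbox :: (real ^ 'n) set) \<times> {0..t1}" "\<lambda>p. V (fst p) (snd p)"] by blast
  define x0 where "x0 = fst p"
  define t0 where "t0 = snd p"
  have t0: "0 \<le> t0" "t0 \<le> t1" using p(1) by (auto simp: t0_def)
  have Vmax: "V x t \<le> V x0 t0" if "0 \<le> t" "t \<le> t1" for x t
    using p(2)[of "(arg_vec (torus_embed x), t)"] arg_vec_mem[of "torus_embed x"] that Vp
    by (simp add: x0_def t0_def)
  have V0: "V x 0 \<le> B" for x using B[of x] by (simp add: V_def)
  have VB: "V x0 t0 > B" using Vmax[of t1 x1] V1 t1 by simp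
  then have t0p: "t0 > 0" using V0[of x0] t0(1) by (cases "t0 = 0") auto
  define r where "r = (\<lambda>n. Re (c n * torus_char n x0))"
  define d where "d = (\<lambda>n. freq_sq n * r n)"
  define h where "h = (\<lambda>s. \<Sum>n\<in>F. d n * ml_kernel \<rho> (\<rho> + 1) (freq_sq n) s)"
  have Vr: "V x0 s = (\<Sum>n\<in>F. r n * relax \<rho> (freq_sq n) s)" for s
    unfolding V_def Re_sum r_def by (intro sum.cong refl) (simp add: algebra_simps)
  have h: "h s = V x0 0 - V x0 s" if "s > 0" for s
  proof -
    have "relax \<rho> (freq_sq n) s = 1 - freq_sq n * ml_kernel \<rho> (\<rho> + 1) (freq_sq n) s" for n :: "int ^ 'n"
      using ml_kernel_rec[of \<rho> 1 s "freq_sq n"] \<rho> that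
      by (simp add: relax_eq_ml_kernel power_kernel_1 add.commute)
    then have "r n * relax \<rho> (freq_sq n) 0 - r n * relax \<rho> (freq_sq n) s = d n * ml_kernel \<rho> (\<rho> + 1) (freq_sq n) s" for n
      by (simp add: d_def right_diff_distrib mult_ac)
    then show ?thesis by (simp add: Vr h_def sum_subtractf[symmetric])
  qed
  have ci: "set_integrable lborel {0<..<t} (\<lambda>s. power_kernel (1 - \<rho>) (t - s) *\<^sub>R ml_kernel \<rho> (\<rho> + 1) l s)"
    and cv: "half_conv (power_kernel (1 - \<rho>)) (ml_kernel \<rho> (\<rho> + 1) l) t = ml_kernel \<rho> (1 + 1) l t" if "t > 0" for t l
    using half_conv_power_ml_kernel[of \<rho> "\<rho> + 1" "1 - \<rho>" t l] \<rho> that by simp_all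
  have hconv: "half_conv (power_kernel (1 - \<rho>)) h t = (\<Sum>n\<in>F. d n * ml_kernel \<rho> (1 + 1) (freq_sq n) t)" if "t > 0" for t
    unfolding h_def half_conv_sum(2)[OF ci[OF that]] cv[OF that] ..
  have dconv: "((\<lambda>t. \<Sum>n\<in>F. d n * ml_kernel \<rho> (1 + 1) (freq_sq n) t) has_real_derivative
      (\<Sum>n\<in>F. d n * ml_kernel \<rho> 1 (freq_sq n) t0)) (at t0)"
    by (intro DERIV_sum DERIV_cmult ml_kernel_has_derivative) (use \<rho> t0p in auto)
  then have "(half_conv (power_kernel (1 - \<rho>)) h has_real_derivative (\<Sum>n\<in>F. d n * ml_kernel \<rho> 1 (freq_sq n) t0)) (at t0)"
    by (rule has_field_derivative_transform_within_open[where S = "{0<..}"])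
      (use t0p hconv in auto)
  then have D: "(half_conv (power_kernel (1 - \<rho>)) h has_real_derivative (\<Sum>n\<in>F. d n * ml_kernel \<rho> 1 (freq_sq n) t0)) (at_left t0)"
    by (rule has_field_derivative_at_within)
  have "(h has_real_derivative (\<Sum>n\<in>F. d n * ml_kernel \<rho> \<rho> (freq_sq n) t0)) (at t0)"
    unfolding h_def by (intro DERIV_sum DERIV_cmult ml_kernel_has_derivative) (use \<rho> t0p in auto)
  then have hd: "(h has_real_derivative (\<Sum>n\<in>F. d n * ml_kernel \<rho> \<rho> (freq_sq n) t0)) (at_left t0)"
    by (rule has_field_derivative_at_within)
  have int: "set_integrable lborel {0<..<t} (\<lambda>s. power_kernel (1 - \<rho>) (t - s) *\<^sub>R h s)" if "0 < t" "t \<le> t0" for t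
    unfolding h_def by (rule half_conv_sum(1)[OF ci[OF that(1)]])
  have min: "h t0 \<le> h s" if "0 < s" "s \<le> t0" for s
    using Vmax[of s x0] h[OF that(1)] h[OF t0p] that t0 by simp
  have neg: "h t0 < 0" using h[OF t0p] VB V0[of x0] by simp
  have "(\<Sum>n\<in>F. d n * ml_kernel \<rho> 1 (freq_sq n) t0) < 0"
    by (rule rl_derivative_negative_at_negative_minimum[OF \<rho> t0p hd int min neg D])
  moreover have "0 \<le> (\<Sum>n\<in>F. freq_sq n * Re ((c n * of_real (relax \<rho> (freq_sq n) t0)) * torus_char n x0))"
    by (rule trig_sum_laplacian_at_max) (use Vmax[of t0] t0 in \<open>simp add: V_def\<close>)
  moreover have "(\<Sum>n\<in>F. freq_sq n * Re ((c n * of_real (relax \<rho> (freq_sq n) t0)) * torus_char n x0)) =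
      (\<Sum>n\<in>F. d n * ml_kernel \<rho> 1 (freq_sq n) t0)"
    using t0p by (intro sum.cong refl) (simp add: d_def r_def relax_eq_ml_kernel algebra_simps)
  ultimately show False by simp
qed

text \<open>Multiplying by a constant of modulus one reduces the modulus at a given point to a real part.\<close>

lemma trig_relax_contraction:
  fixes c :: "int ^ 'n \<Rightarrow> complex"
  assumes \<rho>: "0 < \<rho>" "\<rho> < 1" and F: "finite F"
    and B: "\<And>x. norm (\<Sum>n\<in>F. c n * torus_char n x) \<le> B" and t: "t \<ge> 0"
  shows "norm (\<Sum>n\<in>F. (c n * of_real (relax \<rho> (freq_sq n) t)) * torus_char n x) \<le> B"
proof -
  define z where "z = (\<Sum>n\<in>F. (c n * of_real (relax \<rho> (freq_sq n) t)) * torus_char n x)"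
  define u where "u = cis (- Arg z)"
  have "u * z = of_real (norm z)"
  proof -
    have "z = of_real (norm z) * cis (Arg z)" using rcis_cmod_Arg[of z] by (simp add: rcis_def)
    then have "u * z = u * (of_real (norm z) * cis (Arg z))" by (rule arg_cong)
    also have "\<dots> = of_real (norm z) * (cis (- Arg z) * cis (Arg z))"
      unfolding u_def by (simp only: mult.left_commute)
    finally have "u * z = of_real (norm z) * (cis (- Arg z) * cis (Arg z))" .
    then show ?thesis by (simp add: cis_mult)
  qed
  then have "norm z = Re (u * z)" by simp
  also have "u * z = (\<Sum>n\<in>F. ((u * c n) * of_real (relax \<rho> (freq_sq n) t)) * torus_char n x)"
    unfolding z_def sum_distrib_left by (intro sum.cong refl) (simp only: mult_ac)
  also have "Re \<dots> \<le> B"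
  proof (rule trig_relax_max_principle[OF \<rho> F _ t])
    fix x
    have "Re (\<Sum>n\<in>F. u * c n * torus_char n x) = Re (u * (\<Sum>n\<in>F. c n * torus_char n x))"
      by (simp add: sum_distrib_left mult.assoc)
    also have "\<dots> \<le> norm (u * (\<Sum>n\<in>F. c n * torus_char n x))" by (rule complex_Re_le_cmod)
    also have "\<dots> \<le> B" using B[of x] by (simp add: norm_mult u_def)
    finally show "Re (\<Sum>n\<in>F. u * c n * torus_char n x) \<le> B" .
  qed
  finally show ?thesis by (simp add: z_def)
qed

text \<open>The coefficients of a merely continuous \<open>\<phi>\<close> need not be summable, so at \<open>t = 0\<close> the series is of no
  use. Instead \<open>\<phi>\<close> is approximated uniformly by trigonometric polynomials; by the contraction property
  their evolutions converge uniformly on all of \<open>[0, T]\<close>. The limit is continuous up to \<open>t = 0\<close>, and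
  for \<open>t > 0\<close> its Fourier coefficients identify it with the sum of the series.\<close>

lemma relax_series_continuous:
  fixes \<phi> :: "real ^ 'n \<Rightarrow> complex"
  assumes \<rho>: "0 < \<rho>" "\<rho> < 1" and \<phi>: "\<phi> \<in> C_torus"
    and s: "\<And>t. 0 < t \<Longrightarrow> t \<le> T \<Longrightarrow> (\<lambda>n. norm (fourier_coeff \<phi> n * of_real (relax \<rho> (freq_sq n) t))) summable_on UNIV"
  obtains w where "continuous_on (UNIV \<times> {0..T}) (\<lambda>(x, t). w x t)"
    "\<And>x. 0 \<le> T \<Longrightarrow> w x 0 = \<phi> x"
    "\<And>x t. 0 < t \<Longrightarrow> t \<le> T \<Longrightarrow> w x t = (\<Sum>\<^sub>\<infinity>n. (fourier_coeff \<phi> n * of_real (relax \<rho> (freq_sq n) t)) * torus_char n x)"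
proof -
  have "\<exists>F c. finite F \<and> (\<forall>n. n \<notin> F \<longrightarrow> c n = 0) \<and> (\<forall>x. norm (\<phi> x - (\<Sum>n\<in>F. c n * torus_char n x)) < inverse (real (Suc k)))" for k
  proof -
    obtain p where p: "p \<in> trig_polys" "\<And>x. norm (\<phi> x - p x) < inverse (real (Suc k))"
      using trig_polys_dense[OF \<phi>, of "inverse (real (Suc k))"] by auto
    obtain F c where F: "finite F" "p = (\<lambda>x. \<Sum>n\<in>F. c n * torus_char n x)"
      using p(1) by (auto simp: trig_polys_def)
    have "(\<Sum>n\<in>F. (if n \<in> F then c n else 0) * torus_char n x) = p x" for x
      unfolding F(2) by (intro sum.cong) auto
    then show ?thesis using F(1) p(2)
      by (intro exI[of _ F] exI[of _ "\<lambda>n. if n \<in> F then c n else 0"]) auto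
  qed
  then have "\<forall>k. \<exists>F. \<exists>c. finite F \<and> (\<forall>n. n \<notin> F \<longrightarrow> c n = 0) \<and>
      (\<forall>x. norm (\<phi> x - (\<Sum>n\<in>F. c n * torus_char n x)) < inverse (real (Suc k)))" ..
  from choice[OF this] obtain F where "\<forall>k. \<exists>c. finite (F k) \<and> (\<forall>n. n \<notin> F k \<longrightarrow> c n = 0) \<and>
      (\<forall>x. norm (\<phi> x - (\<Sum>n\<in>F k. c n * torus_char n x)) < inverse (real (Suc k)))" ..
  from choice[OF this] obtain c where Fc: "\<forall>k. finite (F k) \<and> (\<forall>n. n \<notin> F k \<longrightarrow> c k n = 0) \<and>
      (\<forall>x. norm (\<phi> x - (\<Sum>n\<in>F k. c k n * torus_char n x)) < inverse (real (Suc k)))" ..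
  have F: "finite (F k)" and c0: "n \<notin> F k \<Longrightarrow> c k n = 0"
    and ap: "norm (\<phi> x - (\<Sum>n\<in>F k. c k n * torus_char n x)) < inverse (real (Suc k))" for k n x
    using Fc by blast+
  define S where "S = (\<lambda>k p. \<Sum>n\<in>F k. (c k n * of_real (relax \<rho> (freq_sq n) (snd p))) * torus_char n (fst p :: real ^ 'n))"
  define Y where "Y = (UNIV :: (real ^ 'n) set) \<times> {0..T}"
  have ext: "(\<Sum>n\<in>F k. c k n * g n) = (\<Sum>n\<in>F k \<union> F l. c k n * g n)" "(\<Sum>n\<in>F k. c k n * g n) = (\<Sum>n\<in>F l \<union> F k. c k n * g n)" for k l g
    by (rule sum.mono_neutral_left; use F c0 in auto)+
  have dist: "norm (S k p - S l p) \<le> inverse (real (Suc k)) + inverse (real (Suc l))" if "p \<in> Y" for k l p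
  proof -
    obtain x t where p: "p = (x, t)" by (cases p)
    have t: "t \<ge> 0" using that by (auto simp: Y_def p)
    have "S k p - S l p = (\<Sum>n\<in>F k \<union> F l. ((c k n - c l n) * of_real (relax \<rho> (freq_sq n) t)) * torus_char n x)"
      unfolding S_def p fst_conv snd_conv mult.assoc ext(1)[of k _ l] ext(2)[of l _ k]
      by (simp add: sum_subtractf[symmetric] left_diff_distrib)
    also have "norm \<dots> \<le> inverse (real (Suc k)) + inverse (real (Suc l))"
    proof (rule trig_relax_contraction[OF \<rho> _ _ t])
      show "finite (F k \<union> F l)" using F by simp
      fix x
      have "(\<Sum>n\<in>F k \<union> F l. (c k n - c l n) * torus_char n x) =
          (\<phi> x - (\<Sum>n\<in>F l. c l n * torus_char n x)) - (\<phi> x - (\<Sum>n\<in>F k. c k n * torus_char n x))"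
        unfolding ext(1)[of k _ l] ext(2)[of l _ k] by (simp add: sum_subtractf left_diff_distrib)
      also have "norm \<dots> \<le> norm (\<phi> x - (\<Sum>n\<in>F l. c l n * torus_char n x)) + norm (\<phi> x - (\<Sum>n\<in>F k. c k n * torus_char n x))"
        by (rule norm_triangle_ineq4)
      also have "\<dots> \<le> inverse (real (Suc k)) + inverse (real (Suc l))"
        using ap[of x k] ap[of x l] by linarith
      finally show "norm (\<Sum>n\<in>F k \<union> F l. (c k n - c l n) * torus_char n x) \<le> inverse (real (Suc k)) + inverse (real (Suc l))" .
    qed
    finally show ?thesis .
  qed
  have "uniformly_Cauchy_on Y S"
  proof (rule uniformly_Cauchy_onI)
    fix e :: real assume e: "e > 0"
    then obtain M where M: "inverse (real (Suc M)) < e / 2" using reals_Archimedean[of "e / 2"] by auto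
    show "\<exists>M. \<forall>p\<in>Y. \<forall>k\<ge>M. \<forall>l\<ge>M. dist (S k p) (S l p) < e"
    proof (intro exI[of _ M] ballI allI impI)
      fix p k l assume "p \<in> Y" "M \<le> k" "M \<le> l"
      have "inverse (real (Suc k)) \<le> inverse (real (Suc M))" "inverse (real (Suc l)) \<le> inverse (real (Suc M))"
        by (rule le_imp_inverse_le; use \<open>M \<le> k\<close> \<open>M \<le> l\<close> in simp)+
      then have "norm (S k p - S l p) \<le> inverse (real (Suc M)) + inverse (real (Suc M))"
        using dist[OF \<open>p \<in> Y\<close>, of k l] by linarith
      then show "dist (S k p) (S l p) < e" using M by (simp add: dist_norm)
    qed
  qed
  then obtain w where w: "uniform_limit Y S w sequentially"
    using Cauchy_uniformly_convergent uniformly_convergent_on_def by blast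
  have Sc: "continuous_on Y (S k)" for k
  proof -
    have "continuous_on Y (\<lambda>p. relax \<rho> l (snd p))" for l
      by (rule continuous_on_compose2[OF continuous_on_relax continuous_on_snd[OF continuous_on_id]])
        (use \<rho> in \<open>auto simp: Y_def\<close>)
    moreover have "continuous_on Y (\<lambda>p. torus_char n (fst p))" for n by (intro continuous_intros)
    ultimately show ?thesis unfolding S_def
      by (intro continuous_on_sum continuous_on_mult continuous_on_const continuous_on_of_real)
  qed
  have wc: "continuous_on Y w"
    by (rule uniform_limit_theorem[OF _ w]) (use Sc in auto)
  show thesis
  proof (rule that[of "\<lambda>x t. w (x, t)"])
    show "continuous_on (UNIV \<times> {0..T}) (\<lambda>(x, t). w (x, t))" using wc by (simp add: Y_def)
    fix x :: "real ^ 'n"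
    have inv0: "(\<lambda>k. inverse (real (Suc k))) \<longlonglongrightarrow> 0" by (rule LIMSEQ_inverse_real_of_nat)
    show "w (x, 0) = \<phi> x" if "0 \<le> T"
    proof (rule LIMSEQ_unique)
      show "(\<lambda>k. S k (x, 0)) \<longlonglongrightarrow> w (x, 0)"
        by (rule tendsto_uniform_limitI[OF w]) (use that in \<open>auto simp: Y_def\<close>)
      have "(\<lambda>k. \<phi> x - S k (x, 0)) \<longlonglongrightarrow> 0"
        by (rule Lim_null_comparison[OF _ inv0]) (use ap[of x] in \<open>auto simp: S_def intro!: always_eventually less_imp_le\<close>)
      from tendsto_diff[OF tendsto_const[of "\<phi> x"] this] show "(\<lambda>k. S k (x, 0)) \<longlonglongrightarrow> \<phi> x" by simp
    qed
    fix t assume t: "0 < t" "t \<le> T"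
    have tY: "(y, t) \<in> Y" for y using t by (auto simp: Y_def)
    have u: "uniform_limit UNIV (\<lambda>k y. S k (y, t)) (\<lambda>y. w (y, t)) sequentially"
      unfolding uniform_limit_iff
    proof (intro allI impI)
      fix e :: real assume "e > 0"
      then have "\<forall>\<^sub>F k in sequentially. \<forall>p\<in>Y. dist (S k p) (w p) < e" using w by (simp add: uniform_limit_iff)
      then show "\<forall>\<^sub>F k in sequentially. \<forall>y\<in>UNIV. dist (S k (y, t)) (w (y, t)) < e"
        by eventually_elim (use tY in auto)
    qed
    have St: "(\<lambda>y. S k (y, t)) \<in> C_torus" for k
      unfolding S_def fst_conv snd_conv by (rule trig_sum_in_C_torus)
    have wC: "(\<lambda>y. w (y, t)) \<in> C_torus"
    proof -
      have "continuous_on UNIV (\<lambda>y. w (y, t))"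
        by (rule uniform_limit_theorem[OF _ u]) (use St in \<open>auto simp: C_torus_def\<close>)
      moreover have "w (y + axis j (2 * pi), t) = w (y, t)" for y j
      proof (rule LIMSEQ_unique)
        show "(\<lambda>k. S k (y, t)) \<longlonglongrightarrow> w (y, t)" by (rule tendsto_uniform_limitI[OF w tY])
        have "S k (y + axis j (2 * pi), t) = S k (y, t)" for k
          using St[of k] by (simp add: C_torus_def periodic_def)
        then show "(\<lambda>k. S k (y, t)) \<longlonglongrightarrow> w (y + axis j (2 * pi), t)"
          using tendsto_uniform_limitI[OF w tY, of "y + axis j (2 * pi)"] by simp
      qed
      ultimately show ?thesis by (simp add: C_torus_def periodic_def)
    qed
    have co: "fourier_coeff (\<lambda>y. w (y, t)) n = fourier_coeff \<phi> n * of_real (relax \<rho> (freq_sq n) t)" for n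
    proof (rule LIMSEQ_unique)
      show "(\<lambda>k. fourier_coeff (\<lambda>y. S k (y, t)) n) \<longlonglongrightarrow> fourier_coeff (\<lambda>y. w (y, t)) n"
        by (rule fourier_coeff_uniform_limit[OF u]) (use St wC in \<open>auto simp: C_torus_def\<close>)
      have p: "fourier_coeff (\<lambda>y. \<Sum>n\<in>F k. c k n * torus_char n y) n = c k n" for k
        using fourier_coeff_trig_sum[OF F] c0 by simp
      have pu: "uniform_limit UNIV (\<lambda>k y. \<Sum>n\<in>F k. c k n * torus_char n y) \<phi> sequentially"
        unfolding uniform_limit_iff
      proof (intro allI impI)
        fix e :: real assume "e > 0"
        then have "\<forall>\<^sub>F k in sequentially. inverse (real (Suc k)) < e"
          using inv0 by (simp add: order_tendstoD)
        then show "\<forall>\<^sub>F k in sequentially. \<forall>y\<in>UNIV. dist (\<Sum>n\<in>F k. c k n * torus_char n y) (\<phi> y) < e"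
          by eventually_elim (use ap in \<open>auto simp: dist_norm norm_minus_commute intro: less_trans\<close>)
      qed
      have "(\<lambda>k. fourier_coeff (\<lambda>y. \<Sum>n\<in>F k. c k n * torus_char n y) n) \<longlonglongrightarrow> fourier_coeff \<phi> n"
        by (rule fourier_coeff_uniform_limit[OF pu])
          (use trig_sum_in_C_torus \<phi> in \<open>auto simp: C_torus_def intro!: always_eventually\<close>)
      then have "(\<lambda>k. c k n * of_real (relax \<rho> (freq_sq n) t)) \<longlonglongrightarrow> fourier_coeff \<phi> n * of_real (relax \<rho> (freq_sq n) t)"
        unfolding p by (intro tendsto_mult tendsto_const)
      moreover have "fourier_coeff (\<lambda>y. S k (y, t)) n = c k n * of_real (relax \<rho> (freq_sq n) t)" for k
        unfolding S_def fst_conv snd_conv using fourier_coeff_trig_sum[OF F] c0 by simp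
      ultimately show "(\<lambda>k. fourier_coeff (\<lambda>y. S k (y, t)) n) \<longlonglongrightarrow> fourier_coeff \<phi> n * of_real (relax \<rho> (freq_sq n) t)"
        by simp
    qed
    show "w (x, t) = (\<Sum>\<^sub>\<infinity>n. (fourier_coeff \<phi> n * of_real (relax \<rho> (freq_sq n) t)) * torus_char n x)"
      using fourier_series_eq[OF wC, of x] s[OF t] by (simp only: co)
  qed
qed

section \<open>Lattice sums and smoothness of trigonometric series\<close>

abbreviation weight :: "int ^ 'n \<Rightarrow> real" where
  "weight n \<equiv> 1 + freq_sq n"

lemma weight_ge_1: "weight n \<ge> 1" by simp

lemma weight_pos: "weight n > 0" by (simp add: add_pos_nonneg)

lemma component_sq_le: "(real_of_int (n $ j))\<^sup>2 \<le> freq_sq n"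
  unfolding freq_sq_eq by (rule member_le_sum) auto

lemma component_le_weight: "\<bar>real_of_int (n $ j)\<bar> \<le> weight n"
proof -
  have "2 * \<bar>real_of_int (n $ j)\<bar> \<le> 1 + (real_of_int (n $ j))\<^sup>2"
    using zero_le_power2[of "\<bar>real_of_int (n $ j)\<bar> - 1"] by (simp add: power2_diff)
  then show ?thesis using component_sq_le[of n j] abs_ge_zero[of "real_of_int (n $ j)"] by linarith
qed

lemma component_mult_le_weight: "\<bar>real_of_int (n $ j)\<bar> * \<bar>real_of_int (n $ k)\<bar> \<le> weight n"
proof -
  have "2 * (\<bar>real_of_int (n $ j)\<bar> * \<bar>real_of_int (n $ k)\<bar>) \<le> (real_of_int (n $ j))\<^sup>2 + (real_of_int (n $ k))\<^sup>2"
    using zero_le_power2[of "\<bar>real_of_int (n $ j)\<bar> - \<bar>real_of_int (n $ k)\<bar>"] by (simp add: power2_diff)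
  then show ?thesis using component_sq_le[of n j] component_sq_le[of n k] by linarith
qed

lemma int_weight_summable:
  assumes "\<beta> > 1 / 2"
  shows "(\<lambda>k :: int. (1 + (real_of_int k)\<^sup>2) powr (- \<beta>)) summable_on UNIV"
proof -
  define g where "g = (\<lambda>k :: int. (1 + (real_of_int k)\<^sup>2) powr (- \<beta>))"
  have "summable (\<lambda>k. real (Suc k) powr (- 2 * \<beta>))"
    using assms by (subst summable_Suc_iff) (simp add: summable_real_powr_iff)
  then have S: "summable (\<lambda>k. 2 powr \<beta> * real (Suc k) powr (- 2 * \<beta>))" by (rule summable_mult)
  have bound: "g (int k) \<le> 2 powr \<beta> * real (Suc k) powr (- 2 * \<beta>)" for k
  proof -
    have "(real (Suc k))\<^sup>2 / 2 \<le> 1 + (real k)\<^sup>2"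
      using zero_le_power2[of "real k - 1"] by (simp add: power2_eq_square algebra_simps)
    then have "(1 + (real k)\<^sup>2) powr (- \<beta>) \<le> ((real (Suc k))\<^sup>2 / 2) powr (- \<beta>)"
      using assms by (intro powr_mono2') auto
    also have "\<dots> = 2 powr \<beta> * real (Suc k) powr (- 2 * \<beta>)"
    proof -
      have "(real (Suc k))\<^sup>2 = real (Suc k) powr 2" by (simp add: powr_numeral)
      then show ?thesis by (simp only: powr_divide powr_powr) (simp add: powr_minus field_simps)
    qed
    finally show ?thesis by (simp add: g_def)
  qed
  have g0: "g k \<ge> 0" for k by (simp add: g_def)
  have "summable (\<lambda>k. norm (g (int k)))"
    by (rule summable_comparison_test'[OF S]) (use bound g0 in auto)
  then have N: "(\<lambda>k. g (int k)) summable_on UNIV" by (rule norm_summable_imp_summable_on)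
  have neg: "g (- k) = g k" for k by (simp add: g_def)
  have "g summable_on range int"
    by (subst summable_on_reindex) (use N in \<open>auto simp: comp_def\<close>)
  moreover have "g summable_on (\<lambda>k. - int k) ` {1..}"
  proof (subst summable_on_reindex)
    show "inj_on (\<lambda>k. - int k) {1..}" by (auto simp: inj_on_def)
    show "(g \<circ> (\<lambda>k. - int k)) summable_on {1..}"
      unfolding comp_def neg by (rule summable_on_subset_banach[OF N]) auto
  qed
  ultimately have "g summable_on range int \<union> (\<lambda>k. - int k) ` {1..}"
    by (rule summable_on_Un_disjoint) auto
  moreover have "range int \<union> (\<lambda>k. - int k) ` {1..} = UNIV"
  proof -
    have "k \<in> range int \<union> (\<lambda>k. - int k) ` {1..}" for k
      by (cases k rule: int_cases2) (auto simp: image_iff intro: exI[of _ "0::nat"] bexI[of _ "nat (- k)"])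
    then show ?thesis by auto
  qed
  ultimately show ?thesis by (simp add: g_def)
qed

text \<open>The weight dominates the product of the \<open>N\<close>-th roots of the one-dimensional weights, which reduces
  the lattice sum to a power of a convergent sum over the integers.\<close>

lemma weight_summable:
  assumes b: "b > real CARD('n) / 2"
  shows "(\<lambda>n :: int ^ 'n. weight n powr (- b)) summable_on UNIV"
proof (rule nonneg_bdd_above_summable_on)
  define N where "N = real CARD('n)"
  have N: "N > 0" by (simp add: N_def)
  define \<beta> where "\<beta> = b / N"
  have \<beta>: "\<beta> > 1 / 2" using b N by (simp add: \<beta>_def N_def field_simps)
  define h where "h = (\<lambda>k :: int. (1 + (real_of_int k)\<^sup>2) powr (- \<beta>))"
  have hs: "h summable_on UNIV" unfolding h_def by (rule int_weight_summable[OF \<beta>])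
  have h0: "h k \<ge> 0" for k by (simp add: h_def)
  have bound: "weight n powr (- b) \<le> (\<Prod>j\<in>UNIV. h (n $ j))" for n :: "int ^ 'n"
  proof -
    have "weight n powr (- b) = (weight n powr (- \<beta>)) powr N"
      using N by (simp add: powr_powr \<beta>_def)
    also have "\<dots> = (\<Prod>j\<in>(UNIV :: 'n set). weight n powr (- \<beta>))"
      using weight_pos[of n] by (simp add: N_def powr_realpow)
    also have "\<dots> \<le> (\<Prod>j\<in>UNIV. h (n $ j))"
    proof (rule prod_mono)
      fix j :: 'n
      have "weight n powr (- \<beta>) \<le> (1 + (real_of_int (n $ j))\<^sup>2) powr (- \<beta>)"
        using component_sq_le[of n j] \<beta> by (intro powr_mono2') (auto simp: add_pos_nonneg)
      then show "0 \<le> weight n powr (- \<beta>) \<and> weight n powr (- \<beta>) \<le> h (n $ j)" by (simp add: h_def)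
    qed
    finally show ?thesis .
  qed
  show "bdd_above (sum (\<lambda>n :: int ^ 'n. weight n powr (- b)) ` {F. F \<subseteq> UNIV \<and> finite F})"
  proof (rule bdd_aboveI2)
    fix F :: "(int ^ 'n) set" assume "F \<in> {F. F \<subseteq> UNIV \<and> finite F}"
    then have F: "finite F" by simp
    define K where "K = (\<Union>j. (\<lambda>n. n $ j) ` F)"
    have K: "finite K" using F by (auto simp: K_def)
    have "(\<Sum>n\<in>F. weight n powr (- b)) \<le> (\<Sum>n\<in>F. \<Prod>j\<in>UNIV. h (n $ j))"
      by (rule sum_mono) (rule bound)
    also have "\<dots> = (\<Sum>f\<in>vec_nth ` F. \<Prod>j\<in>UNIV. h (f j))"
      by (subst sum.reindex) (auto simp: inj_on_def vec_nth_inject)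
    also have "\<dots> \<le> (\<Sum>f\<in>PiE (UNIV :: 'n set) (\<lambda>_. K). \<Prod>j\<in>UNIV. h (f j))"
    proof (rule sum_mono2)
      show "finite (PiE UNIV (\<lambda>_ :: 'n. K))" using K by (intro finite_PiE) auto
      show "vec_nth ` F \<subseteq> PiE UNIV (\<lambda>_. K)" by (auto simp: K_def)
    qed (auto intro!: prod_nonneg h0)
    also have "\<dots> = (\<Prod>j\<in>(UNIV :: 'n set). \<Sum>k\<in>K. h k)"
      using K by (subst prod_sum_PiE) auto
    also have "\<dots> \<le> (\<Prod>j\<in>(UNIV :: 'n set). infsum h UNIV)"
      by (intro prod_mono conjI sum_nonneg h0 finite_sum_le_infsum[OF hs K]) auto
    finally show "(\<Sum>n\<in>F. weight n powr (- b)) \<le> (\<Prod>j\<in>(UNIV :: 'n set). infsum h UNIV)" .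
  qed
qed simp

lemma cis_minus_one_le: "norm (cis y - 1) \<le> \<bar>y\<bar>"
proof -
  have "(norm (cis y - 1))\<^sup>2 = (cos y - 1)\<^sup>2 + (sin y)\<^sup>2"
    by (simp add: cmod_power2)
  also have "\<dots> = 2 - 2 * cos (2 * (y / 2))"
    using sin_cos_squared_add[of y] by (simp add: power2_diff)
  also have "\<dots> = (2 * sin (y / 2))\<^sup>2"
    unfolding cos_double_sin by (simp add: power_mult_distrib)
  also have "\<dots> = (2 * \<bar>sin (y / 2)\<bar>)\<^sup>2" by simp
  also have "\<dots> \<le> \<bar>y\<bar>\<^sup>2"
    using abs_sin_x_le_abs_x[of "y / 2"] by (intro power_mono) auto
  finally show ?thesis by (rule power2_le_imp_le) simp
qed

lemma has_sum_difference:
  fixes f g :: "'i \<Rightarrow> complex"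
  assumes "(f has_sum a) A" "(g has_sum b) A"
  shows "((\<lambda>i. f i - g i) has_sum (a - b)) A"
  using tendsto_diff[OF assms[unfolded has_sum_def]] unfolding has_sum_def sum_subtractf .

lemma has_sum_finite_sum:
  fixes f :: "'j \<Rightarrow> 'i \<Rightarrow> complex"
  assumes "\<And>j. j \<in> J \<Longrightarrow> (f j has_sum a j) A"
  shows "((\<lambda>i. \<Sum>j\<in>J. f j i) has_sum (\<Sum>j\<in>J. a j)) A"
  unfolding has_sum_def sum.swap[of _ J] by (rule tendsto_sum) (rule assms[unfolded has_sum_def])

lemma trig_series_summable:
  fixes c :: "int ^ 'n \<Rightarrow> complex"
  assumes "(\<lambda>n. norm (c n)) summable_on UNIV"
  shows "(\<lambda>n. c n * torus_char n x) summable_on UNIV"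
  by (rule abs_summable_summable) (use assms in \<open>simp add: norm_mult\<close>)

lemma has_vector_derivative_at_0_iff:
  fixes h :: "real \<Rightarrow> complex"
  shows "(h has_vector_derivative D) (at 0) \<longleftrightarrow> ((\<lambda>s. (h s - h 0) / of_real s) \<longlongrightarrow> D) (at 0)"
  unfolding has_vector_derivative_def has_derivative_iff_norm
proof -
  have e: "norm (h s - h 0 - (s - 0) *\<^sub>R D) / norm (s - 0) = norm ((h s - h 0) / of_real s - D)" if "s \<noteq> 0" for s
  proof -
    have "(h s - h 0) / of_real s - D = (h s - h 0 - (s - 0) *\<^sub>R D) / of_real s"
      using that by (simp add: scaleR_conv_of_real field_simps)
    then show ?thesis by (simp add: norm_divide)
  qed
  have "((\<lambda>s. norm (h s - h 0 - (s - 0) *\<^sub>R D) / norm (s - 0)) \<longlongrightarrow> 0) (at 0) \<longleftrightarrow>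
      ((\<lambda>s. norm ((h s - h 0) / of_real s - D)) \<longlongrightarrow> 0) (at 0)"
  proof (rule filterlim_cong[OF refl refl])
    show "\<forall>\<^sub>F s in at 0. norm (h s - h 0 - (s - 0) *\<^sub>R D) / norm (s - 0) = norm ((h s - h 0) / of_real s - D)"
      unfolding eventually_at_filter by (intro always_eventually allI impI e)
  qed
  also have "\<dots> \<longleftrightarrow> ((\<lambda>s. (h s - h 0) / of_real s) \<longlongrightarrow> D) (at 0)"
    by (simp add: tendsto_norm_zero_iff LIM_zero_iff)
  finally show "bounded_linear (\<lambda>x. x *\<^sub>R D) \<and>
      ((\<lambda>s. norm (h s - h 0 - (s - 0) *\<^sub>R D) / norm (s - 0)) \<longlongrightarrow> 0) (at 0) \<longleftrightarrow>
      ((\<lambda>s. (h s - h 0) / of_real s) \<longlongrightarrow> D) (at 0)"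
    by (simp add: bounded_linear_scaleR_left)
qed

text \<open>The difference quotients of the terms are dominated by their limits, since
  \<open>\<bar>cis y - 1\<bar> \<le> \<bar>y\<bar>\<close>; so limit and sum may be interchanged.\<close>

lemma trig_series_has_partial:
  fixes c :: "int ^ 'n \<Rightarrow> complex"
  assumes s0: "(\<lambda>n. norm (c n)) summable_on UNIV"
    and s1: "(\<lambda>n. norm ((\<i> * of_int (n $ j)) * c n)) summable_on UNIV"
  shows "((\<lambda>s :: real. \<Sum>\<^sub>\<infinity>n. c n * torus_char n (x + axis j s)) has_vector_derivative
     (\<Sum>\<^sub>\<infinity>n. ((\<i> * of_int (n $ j)) * c n) * torus_char n x)) (at 0)"
proof -
  define q where "q = (\<lambda>n (s :: real). (c n * torus_char n x) * ((cis (real_of_int (n $ j) * s) - 1) / of_real s))"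
  have qlim: "((\<lambda>s. q n s) \<longlongrightarrow> ((\<i> * of_int (n $ j)) * c n) * torus_char n x) (at 0)" for n
  proof -
    have "((\<lambda>w. exp (\<i> * of_int (n $ j) * w)) has_field_derivative exp (\<i> * of_int (n $ j) * of_real 0) * (\<i> * of_int (n $ j))) (at (of_real 0))"
      by (rule derivative_eq_intros refl)+ simp
    from has_vector_derivative_real_field[OF this]
    have "((\<lambda>s. cis (real_of_int (n $ j) * s)) has_vector_derivative (\<i> * of_int (n $ j))) (at 0)"
      by (simp add: cis_conv_exp mult.assoc)
    then have "((\<lambda>s. (cis (real_of_int (n $ j) * s) - 1) / of_real s) \<longlongrightarrow> \<i> * of_int (n $ j)) (at 0)"
      by (simp add: has_vector_derivative_at_0_iff)
    then have "((\<lambda>s. q n s) \<longlongrightarrow> (c n * torus_char n x) * (\<i> * of_int (n $ j))) (at 0)"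
      unfolding q_def by (intro tendsto_mult tendsto_const)
    then show ?thesis by (simp only: mult_ac)
  qed
  have qb: "norm (q n s) \<le> norm ((\<i> * of_int (n $ j)) * c n)" if "s \<noteq> 0" for n s
  proof -
    have "norm ((cis (real_of_int (n $ j) * s) - 1) / of_real s) \<le> \<bar>real_of_int (n $ j) * s\<bar> / \<bar>s\<bar>"
      unfolding norm_divide norm_of_real using cis_minus_one_le by (intro divide_right_mono) auto
    also have "\<dots> = \<bar>real_of_int (n $ j)\<bar>" using that by (simp add: abs_mult)
    finally have "norm (c n) * norm ((cis (real_of_int (n $ j) * s) - 1) / of_real s) \<le> norm (c n) * \<bar>real_of_int (n $ j)\<bar>"
      by (rule mult_left_mono) simp
    moreover have "norm (q n s) = norm (c n) * norm ((cis (real_of_int (n $ j) * s) - 1) / of_real s)"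
      unfolding q_def by (simp only: norm_mult norm_cis mult_1_right)
    moreover have "norm ((\<i> * of_int (n $ j)) * c n) = norm (c n) * \<bar>real_of_int (n $ j)\<bar>"
      by (simp add: norm_mult)
    ultimately show ?thesis by (simp only:)
  qed
  have "((\<lambda>s. \<Sum>\<^sub>\<infinity>n. q n s) \<longlongrightarrow> (\<Sum>\<^sub>\<infinity>n. ((\<i> * of_int (n $ j)) * c n) * torus_char n x)) (at 0)"
  proof (rule swap_uniform_limit')
    show "\<forall>\<^sub>F F in finite_subsets_at_top UNIV. ((\<lambda>s. \<Sum>n\<in>F. q n s) \<longlongrightarrow> (\<Sum>n\<in>F. ((\<i> * of_int (n $ j)) * c n) * torus_char n x)) (at 0)"
      by (intro always_eventually allI tendsto_sum qlim)
    show "((\<lambda>F. \<Sum>n\<in>F. ((\<i> * of_int (n $ j)) * c n) * torus_char n x) \<longlongrightarrow>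
        (\<Sum>\<^sub>\<infinity>n. ((\<i> * of_int (n $ j)) * c n) * torus_char n x)) (finite_subsets_at_top UNIV)"
      using has_sum_infsum[OF trig_series_summable[OF s1, of x]] by (simp add: has_sum_def)
    show "uniform_limit (- {0}) (\<lambda>F s. \<Sum>n\<in>F. q n s) (\<lambda>s. \<Sum>\<^sub>\<infinity>n. q n s) (finite_subsets_at_top UNIV)"
      by (rule Weierstrass_m_test_general[OF _ s1]) (use qb in auto)
    show "\<forall>\<^sub>F s in at 0. s \<in> - {0 :: real}" by (simp add: eventually_at_filter)
  qed simp
  moreover have "(\<Sum>\<^sub>\<infinity>n. q n s) = ((\<Sum>\<^sub>\<infinity>n. c n * torus_char n (x + axis j s)) - (\<Sum>\<^sub>\<infinity>n. c n * torus_char n x)) / of_real s" for s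
  proof -
    have "q n s = inverse (of_real s) * (c n * torus_char n (x + axis j s) - c n * torus_char n x)" for n
      unfolding q_def torus_char_shift by (simp add: field_simps)
    then have "(\<Sum>\<^sub>\<infinity>n. q n s) = inverse (of_real s) * (\<Sum>\<^sub>\<infinity>n. c n * torus_char n (x + axis j s) - c n * torus_char n x)"
      by (simp only: infsum_cmult_right')
    also have "(\<Sum>\<^sub>\<infinity>n. c n * torus_char n (x + axis j s) - c n * torus_char n x) =
        (\<Sum>\<^sub>\<infinity>n. c n * torus_char n (x + axis j s)) - (\<Sum>\<^sub>\<infinity>n. c n * torus_char n x)"
      by (intro infsumI has_sum_difference has_sum_infsum trig_series_summable s0)
    finally show ?thesis by (simp add: field_simps)
  qed
  moreover have x0: "x + axis j 0 = x" by simp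
  ultimately show ?thesis unfolding has_vector_derivative_at_0_iff x0 by simp
qed

lemma trig_series_C2:
  fixes c :: "int ^ 'n \<Rightarrow> complex"
  assumes s: "(\<lambda>n. weight n * norm (c n)) summable_on UNIV"
  defines "W \<equiv> \<lambda>x. \<Sum>\<^sub>\<infinity>n. c n * torus_char n x"
  shows "W \<in> C2_torus"
    and "laplacian W x = (\<Sum>\<^sub>\<infinity>n. (- of_real (freq_sq n) * c n) * torus_char n x)"
proof -
  have cmp: "(\<lambda>n. norm (d n)) summable_on UNIV" if "\<And>n. norm (d n) \<le> weight n * norm (c n)" for d :: "int ^ 'n \<Rightarrow> complex"
    by (rule summable_on_comparison_test[OF s]) (use that in auto)
  have s0: "(\<lambda>n. norm (c n)) summable_on UNIV"
    by (rule cmp) (use mult_right_mono[OF weight_ge_1 norm_ge_zero] in auto)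
  have s1: "(\<lambda>n. norm ((\<i> * of_int (n $ j)) * c n)) summable_on UNIV" for j
    by (rule cmp) (use mult_right_mono[OF component_le_weight norm_ge_zero] in \<open>auto simp: norm_mult\<close>)
  have s2: "(\<lambda>n. norm ((\<i> * of_int (n $ k)) * ((\<i> * of_int (n $ j)) * c n))) summable_on UNIV" for j k
  proof (rule cmp)
    fix n :: "int ^ 'n"
    have "norm ((\<i> * of_int (n $ k)) * ((\<i> * of_int (n $ j)) * c n)) = (\<bar>real_of_int (n $ k)\<bar> * \<bar>real_of_int (n $ j)\<bar>) * norm (c n)"
      by (simp add: norm_mult)
    also have "\<dots> \<le> weight n * norm (c n)" by (intro mult_right_mono component_mult_le_weight) simp
    finally show "norm ((\<i> * of_int (n $ k)) * ((\<i> * of_int (n $ j)) * c n)) \<le> weight n * norm (c n)" .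
  qed
  have d1: "((\<lambda>s. W (x + axis j s)) has_vector_derivative (\<Sum>\<^sub>\<infinity>n. ((\<i> * of_int (n $ j)) * c n) * torus_char n x)) (at 0)" for j x
    unfolding W_def by (rule trig_series_has_partial[OF s0 s1])
  have p1: "partial j W = (\<lambda>x. \<Sum>\<^sub>\<infinity>n. ((\<i> * of_int (n $ j)) * c n) * torus_char n x)" for j
    unfolding partial_def by (rule ext) (rule vector_derivative_at[OF d1])
  have d2: "((\<lambda>s. partial j W (x + axis k s)) has_vector_derivative
      (\<Sum>\<^sub>\<infinity>n. ((\<i> * of_int (n $ k)) * ((\<i> * of_int (n $ j)) * c n)) * torus_char n x)) (at 0)" for j k x
    unfolding p1 by (rule trig_series_has_partial[OF s1 s2])
  have p2: "partial k (partial j W) = (\<lambda>x. \<Sum>\<^sub>\<infinity>n. ((\<i> * of_int (n $ k)) * ((\<i> * of_int (n $ j)) * c n)) * torus_char n x)" for j k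
    unfolding partial_def[of k] by (rule ext) (rule vector_derivative_at[OF d2])
  have pd1: "partial_differentiable j W x" for j x
    unfolding partial_differentiable_def by (rule differentiableI_vector[OF d1])
  have pd2: "partial_differentiable k (partial j W) x" for j k x
    unfolding partial_differentiable_def by (rule differentiableI_vector[OF d2])
  have c0: "W \<in> C_torus" unfolding W_def by (rule trig_series_in_C_torus[OF s0])
  have c1: "partial j W \<in> C_torus" for j unfolding p1 by (rule trig_series_in_C_torus[OF s1])
  have c2: "partial k (partial j W) \<in> C_torus" for j k unfolding p2 by (rule trig_series_in_C_torus[OF s2])
  show "W \<in> C2_torus"
    using c0 c1 c2 pd1 pd2 unfolding C2_torus_def C1_torus_def by blast
  have "laplacian W x = (\<Sum>j\<in>UNIV. \<Sum>\<^sub>\<infinity>n. ((\<i> * of_int (n $ j)) * ((\<i> * of_int (n $ j)) * c n)) * torus_char n x)"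
    unfolding laplacian_def p2 ..
  also have "\<dots> = (\<Sum>\<^sub>\<infinity>n. \<Sum>j\<in>UNIV. ((\<i> * of_int (n $ j)) * ((\<i> * of_int (n $ j)) * c n)) * torus_char n x)"
  proof -
    have "((\<lambda>n. \<Sum>j\<in>UNIV. ((\<i> * of_int (n $ j)) * ((\<i> * of_int (n $ j)) * c n)) * torus_char n x) has_sum
       (\<Sum>j\<in>UNIV. \<Sum>\<^sub>\<infinity>n. ((\<i> * of_int (n $ j)) * ((\<i> * of_int (n $ j)) * c n)) * torus_char n x)) UNIV"
      by (intro has_sum_finite_sum has_sum_infsum trig_series_summable s2) 
    then show ?thesis by (rule infsumI[symmetric])
  qed
  also have "\<dots> = (\<Sum>\<^sub>\<infinity>n. (- of_real (freq_sq n) * c n) * torus_char n x)"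
  proof (rule infsum_cong)
    fix n :: "int ^ 'n"
    have "(\<Sum>j\<in>UNIV. ((\<i> * of_int (n $ j)) * ((\<i> * of_int (n $ j)) * c n)) * torus_char n x) =
        (\<Sum>j\<in>UNIV. - of_real ((real_of_int (n $ j))\<^sup>2) * (c n * torus_char n x))"
      by (rule sum.cong) (auto simp: power2_eq_square algebra_simps)
    also have "\<dots> = (\<Sum>j\<in>UNIV. - of_real ((real_of_int (n $ j))\<^sup>2)) * (c n * torus_char n x)"
      by (rule sum_distrib_right[symmetric])
    also have "(\<Sum>j\<in>UNIV. - complex_of_real ((real_of_int (n $ j))\<^sup>2)) = - of_real (freq_sq n)"
      unfolding freq_sq_eq of_real_sum by (rule sum_negf)
    finally show "(\<Sum>j\<in>UNIV. ((\<i> * of_int (n $ j)) * ((\<i> * of_int (n $ j)) * c n)) * torus_char n x) =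
        (- of_real (freq_sq n) * c n) * torus_char n x" by (simp only: mult.assoc)
  qed
  finally show "laplacian W x = (\<Sum>\<^sub>\<infinity>n. (- of_real (freq_sq n) * c n) * torus_char n x)" .
qed

section \<open>Uniform convergence and integration of series\<close>

text \<open>A substitute for the Weierstrass test when the terms have no summable majorant uniform in \<open>y\<close>:
  only the \<open>\<ell>\<^sup>2\<close>-norm of the weighted coefficients is bounded uniformly in time, and the
  Cauchy-Schwarz inequality then bounds every finite sum by the square root of a fixed summable
  family. The bound for sets outside a large finite set gives uniform convergence.\<close>

lemma uniform_limit_sqrt_tail:
  fixes g :: "'i \<Rightarrow> 'y \<Rightarrow> complex" and p :: "'i \<Rightarrow> real"
  assumes p: "p summable_on UNIV" and p0: "\<And>n. p n \<ge> 0" and K: "K \<ge> 0"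
    and b: "\<And>F y. finite F \<Longrightarrow> y \<in> Y \<Longrightarrow> (\<Sum>n\<in>F. norm (g n y)) \<le> K * sqrt (\<Sum>n\<in>F. p n)"
  shows "\<And>y. y \<in> Y \<Longrightarrow> (\<lambda>n. norm (g n y)) summable_on UNIV"
    and "uniform_limit Y (\<lambda>F y. \<Sum>n\<in>F. g n y) (\<lambda>y. \<Sum>\<^sub>\<infinity>n. g n y) (finite_subsets_at_top UNIV)"
proof -
  show S: "(\<lambda>n. norm (g n y)) summable_on UNIV" if "y \<in> Y" for y
  proof (rule nonneg_bdd_above_summable_on)
    show "bdd_above (sum (\<lambda>n. norm (g n y)) ` {F. F \<subseteq> UNIV \<and> finite F})"
    proof (rule bdd_aboveI2)
      fix F :: "'i set" assume "F \<in> {F. F \<subseteq> UNIV \<and> finite F}"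
      then have F: "finite F" by simp
      have "(\<Sum>n\<in>F. norm (g n y)) \<le> K * sqrt (\<Sum>n\<in>F. p n)" by (rule b[OF F that])
      also have "\<dots> \<le> K * sqrt (infsum p UNIV)"
        by (intro mult_left_mono real_sqrt_le_mono finite_sum_le_infsum[OF p F] p0 K) auto
      finally show "(\<Sum>n\<in>F. norm (g n y)) \<le> K * sqrt (infsum p UNIV)" .
    qed
  qed simp
  show "uniform_limit Y (\<lambda>F y. \<Sum>n\<in>F. g n y) (\<lambda>y. \<Sum>\<^sub>\<infinity>n. g n y) (finite_subsets_at_top UNIV)"
  proof (rule uniform_limitI)
    fix e :: real assume e: "e > 0"
    \<comment> \<open>Chosen so that \<open>K * sqrt d < e\<close>, also when \<open>K = 0\<close>.\<close>
    define d where "d = (e / (K + 1))\<^sup>2 / 4"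
    have d: "d > 0" using e K by (simp add: d_def)
    have "((\<lambda>F. sum p F) \<longlongrightarrow> infsum p UNIV) (finite_subsets_at_top UNIV)"
      using has_sum_infsum[OF p] by (simp add: has_sum_def)
    then have "\<forall>\<^sub>F F in finite_subsets_at_top UNIV. dist (sum p F) (infsum p UNIV) < d"
      using d by (rule tendstoD)
    moreover have "\<forall>\<^sub>F F in finite_subsets_at_top UNIV. finite (F :: 'i set)"
      by (rule eventually_finite_subsets_at_top_weakI) simp
    ultimately show "\<forall>\<^sub>F F in finite_subsets_at_top UNIV. \<forall>y\<in>Y. dist (\<Sum>n\<in>F. g n y) (\<Sum>\<^sub>\<infinity>n. g n y) < e"
    proof eventually_elim
      case (elim F)
      show ?case
      proof
        fix y assume y: "y \<in> Y"
        have gs: "(\<lambda>n. norm (g n y)) summable_on A" for A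
          using S[OF y] by (rule summable_on_subset_banach) (rule subset_UNIV)
        have "(\<Sum>\<^sub>\<infinity>n. g n y) = (\<Sum>\<^sub>\<infinity>n\<in>F. g n y) + (\<Sum>\<^sub>\<infinity>n\<in>-F. g n y)"
          using infsum_Un_disjoint[OF abs_summable_summable[OF gs] abs_summable_summable[OF gs] Compl_disjoint, of F]
          by (simp only: Compl_partition)
        then have "(\<Sum>n\<in>F. g n y) - (\<Sum>\<^sub>\<infinity>n. g n y) = - (\<Sum>\<^sub>\<infinity>n\<in>-F. g n y)"
          unfolding infsum_finite[OF elim(2)] by (simp only: diff_add_eq_diff_diff_swap) simp
        then have "dist (\<Sum>n\<in>F. g n y) (\<Sum>\<^sub>\<infinity>n. g n y) = norm (\<Sum>\<^sub>\<infinity>n\<in>-F. g n y)"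
          by (simp only: dist_norm norm_minus_cancel)
        also have "\<dots> \<le> (\<Sum>\<^sub>\<infinity>n\<in>-F. norm (g n y))" by (rule norm_infsum_bound[OF gs])
        also have "\<dots> \<le> K * sqrt d"
        proof (rule infsum_le_finite_sums[OF gs])
          fix H assume H: "finite H" "H \<subseteq> - F"
          have "(\<Sum>n\<in>H. norm (g n y)) \<le> K * sqrt (\<Sum>n\<in>H. p n)" by (rule b[OF H(1) y])
          also have "(\<Sum>n\<in>H. p n) \<le> d"
          proof -
            have "sum p F + sum p H = sum p (F \<union> H)"
              using H elim(2) by (subst sum.union_disjoint) auto
            also have "\<dots> \<le> infsum p UNIV"
              using H elim(2) p0 by (intro finite_sum_le_infsum[OF p]) auto
            finally show ?thesis using elim(1) by (simp add: dist_real_def)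
          qed
          finally show "(\<Sum>n\<in>H. norm (g n y)) \<le> K * sqrt d"
            using K by (simp add: mult_left_mono)
        qed
        also have "sqrt d = (e / (K + 1)) / 2"
        proof (rule real_sqrt_unique)
          show "(e / (K + 1) / 2)\<^sup>2 = d" unfolding d_def power_divide[of _ 2] by simp
        qed (use e K in simp)
        also have "K * ((e / (K + 1)) / 2) < e"
        proof -
          have half: "z / 2 < e" if "z \<le> e * 1" for z using e that by linarith
          have "e * (K / (K + 1)) / 2 < e"
            by (rule half, rule mult_left_mono) (use e K in auto)
          moreover have "K * ((e / (K + 1)) / 2) = e * (K / (K + 1)) / 2" by (simp add: mult.commute)
          ultimately show ?thesis by (simp only:)
        qed
        finally show "dist (\<Sum>n\<in>F. g n y) (\<Sum>\<^sub>\<infinity>n. g n y) < e" .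
      qed
    qed
  qed
qed

text \<open>The Cauchy-Schwarz inequality after splitting \<open>w\<^sup>e = w\<^sup>a\<^sup>/\<^sup>2 w\<^sup>e\<^sup>-\<^sup>a\<^sup>/\<^sup>2\<close>.\<close>

lemma weighted_sum_le:
  fixes x :: "int ^ 'n \<Rightarrow> real"
  assumes b: "(\<Sum>n\<in>F. weight n powr a * (x n)\<^sup>2) \<le> B\<^sup>2" and B: "B \<ge> 0"
  shows "(\<Sum>n\<in>F. weight n powr e * \<bar>x n\<bar>) \<le> B * sqrt (\<Sum>n\<in>F. weight n powr (2 * e - a))"
proof -
  have "(\<Sum>n\<in>F. weight n powr e * \<bar>x n\<bar>) = (\<Sum>n\<in>F. \<bar>weight n powr (a / 2) * x n\<bar> * \<bar>weight n powr (e - a / 2)\<bar>)"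
  proof (rule sum.cong)
    fix n :: "int ^ 'n"
    have "weight n powr e = weight n powr (a / 2) * weight n powr (e - a / 2)"
      unfolding powr_add[symmetric] by simp
    then show "weight n powr e * \<bar>x n\<bar> = \<bar>weight n powr (a / 2) * x n\<bar> * \<bar>weight n powr (e - a / 2)\<bar>"
      by (simp only: abs_mult abs_of_nonneg[OF powr_ge_zero] mult_ac)
  qed simp
  also have "\<dots> \<le> L2_set (\<lambda>n. weight n powr (a / 2) * x n) F * L2_set (\<lambda>n. weight n powr (e - a / 2)) F"
    by (rule L2_set_mult_ineq)
  also have "L2_set (\<lambda>n. weight n powr (a / 2) * x n) F = sqrt (\<Sum>n\<in>F. weight n powr a * (x n)\<^sup>2)"
  proof -
    have "(weight n powr (a / 2))\<^sup>2 = weight n powr a" for n :: "int ^ 'n"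
      unfolding power2_eq_square powr_add[symmetric] by simp
    then have "(weight n powr (a / 2) * x n)\<^sup>2 = weight n powr a * (x n)\<^sup>2" for n
      by (simp only: power_mult_distrib)
    then show ?thesis by (simp add: L2_set_def)
  qed
  also have "L2_set (\<lambda>n. weight n powr (e - a / 2)) F = sqrt (\<Sum>n\<in>F. weight n powr (2 * e - a))"
  proof -
    have "(weight n powr (e - a / 2))\<^sup>2 = weight n powr (2 * e - a)" for n :: "int ^ 'n"
      unfolding power2_eq_square powr_add[symmetric] by simp
    then show ?thesis by (simp add: L2_set_def)
  qed
  also have "sqrt (\<Sum>n\<in>F. weight n powr a * (x n)\<^sup>2) * sqrt (\<Sum>n\<in>F. weight n powr (2 * e - a)) \<le>
      B * sqrt (\<Sum>n\<in>F. weight n powr (2 * e - a))"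
    using b B by (intro mult_right_mono real_le_lsqrt) (auto intro: sum_nonneg)
  finally show ?thesis .
qed

lemma infinite_UNIV_int_vec: "infinite (UNIV :: (int ^ 'n) set)"
proof -
  have "inj (\<lambda>k :: nat. (\<chi> j. int k) :: int ^ 'n)" by (simp add: inj_def vec_eq_iff)
  then have "infinite (range (\<lambda>k :: nat. (\<chi> j. int k) :: int ^ 'n))" by (rule range_inj_infinite)
  then show ?thesis by (rule infinite_super[OF subset_UNIV])
qed

lemma set_integral_infsum:
  fixes g :: "int ^ 'n \<Rightarrow> 'b \<Rightarrow> complex"
  assumes i: "\<And>n. set_integrable M A (g n)"
    and s: "\<And>x. x \<in> A \<Longrightarrow> (\<lambda>n. norm (g n x)) summable_on UNIV"
    and ns: "(\<lambda>n. set_lebesgue_integral M A (\<lambda>x. norm (g n x))) summable_on UNIV"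
  shows "set_integrable M A (\<lambda>x. \<Sum>\<^sub>\<infinity>n. g n x)"
    and "set_lebesgue_integral M A (\<lambda>x. \<Sum>\<^sub>\<infinity>n. g n x) = (\<Sum>\<^sub>\<infinity>n. set_lebesgue_integral M A (g n))"
proof -
  define e where "e = from_nat_into (UNIV :: (int ^ 'n) set)"
  have e: "bij_betw e UNIV UNIV"
    unfolding e_def by (rule bij_betw_from_nat_into) (auto simp: infinite_UNIV_int_vec)
  have to_nat: "(\<lambda>k. h (e k)) sums (\<Sum>\<^sub>\<infinity>n. h n)" "summable (\<lambda>k. norm (h (e k)))"
    if "(\<lambda>n. norm (h n)) summable_on UNIV" for h :: "int ^ 'n \<Rightarrow> complex"
  proof -
    have n: "(\<lambda>k. norm (h (e k))) summable_on UNIV"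
      using that summable_on_reindex_bij_betw[OF e, of "\<lambda>n. norm (h n)"] by simp
    then show "summable (\<lambda>k. norm (h (e k)))" by (rule summable_on_imp_summable)
    have "(\<lambda>k. h (e k)) summable_on UNIV" by (rule abs_summable_summable[OF n])
    from has_sum_imp_sums[OF has_sum_infsum[OF this]]
    show "(\<lambda>k. h (e k)) sums (\<Sum>\<^sub>\<infinity>n. h n)"
      by (simp only: infsum_reindex_bij_betw[OF e, of h])
  qed
  have ns': "summable (\<lambda>k. set_lebesgue_integral M A (\<lambda>x. norm (g (e k) x)))"
    using ns summable_on_reindex_bij_betw[OF e, of "\<lambda>n. set_lebesgue_integral M A (\<lambda>x. norm (g n x))"]
    by (intro summable_on_imp_summable) simp
  note S = set_integral_sums[OF i to_nat(1)[OF s] to_nat(2)[OF s] ns']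
  show "set_integrable M A (\<lambda>x. \<Sum>\<^sub>\<infinity>n. g n x)" by (rule S(1))
  have nb: "(\<lambda>n. norm (set_lebesgue_integral M A (g n))) summable_on UNIV"
    by (rule summable_on_comparison_test[OF ns]) (auto intro: set_integral_norm_bound[OF i])
  show "set_lebesgue_integral M A (\<lambda>x. \<Sum>\<^sub>\<infinity>n. g n x) = (\<Sum>\<^sub>\<infinity>n. set_lebesgue_integral M A (g n))"
    by (rule sums_unique2[OF S(2) to_nat(1)[OF nb]])
qed

section \<open>The Fourier modes of the solution\<close>

lemma frac_integral_eq_half_conv: "frac_integral (\<rho> - 1) h t = half_conv (power_kernel (1 - \<rho>)) h t"
proof -
  have "power_kernel (1 - \<rho>) (t - s) *\<^sub>R h s = inverse (Gamma (1 - \<rho>)) *\<^sub>R (h s /\<^sub>R (t - s) powr (\<rho> - 1 + 1))" for s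
    by (simp add: power_kernel_def powr_minus divide_inverse)
  then show ?thesis
    unfolding frac_integral_def half_conv_def by (simp only: set_integral_scaleR_right minus_diff_eq)
qed

lemma integrable_scaleR_iff:
  fixes g :: "'b \<Rightarrow> 'a::{banach, second_countable_topology}"
  assumes "c \<noteq> 0"
  shows "integrable M g \<longleftrightarrow> integrable M (\<lambda>x. c *\<^sub>R g x)"
proof
  assume "integrable M (\<lambda>x. c *\<^sub>R g x)"
  then have "integrable M (\<lambda>x. inverse c *\<^sub>R (c *\<^sub>R g x))" by (rule integrable_scaleR_right)
  then show "integrable M g" using assms by simp
qed (rule integrable_scaleR_right)

lemma frac_integral_exists_iff:
  assumes "\<rho> < 1"
  shows "frac_integral_exists (\<rho> - 1) h t \<longleftrightarrow> set_integrable lborel {0<..<t} (\<lambda>s. power_kernel (1 - \<rho>) (t - s) *\<^sub>R h s)"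
proof -
  have G: "Gamma (1 - \<rho>) > 0" using assms by (intro Gamma_real_pos) simp
  have E: "indicator {0<..<t} s *\<^sub>R (power_kernel (1 - \<rho>) (t - s) *\<^sub>R h s) =
      inverse (Gamma (1 - \<rho>)) *\<^sub>R (indicator {0<..<t} s *\<^sub>R (h s /\<^sub>R (t - s) powr (\<rho> - 1 + 1)))" for s
    by (simp add: power_kernel_def powr_minus divide_inverse mult_ac)
  show ?thesis
    unfolding frac_integral_exists_def set_integrable_def E using G
    by (intro integrable_scaleR_iff) auto
qed

lemma half_conv_mult_right:
  fixes h :: "real \<Rightarrow> complex"
  shows "half_conv k (\<lambda>s. h s * z) t = half_conv k h t * z"
  unfolding half_conv_def by (simp only: mult_scaleR_left[symmetric] set_integral_mult_left)

lemma continuous_on_UNIV_times_Ioc: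
  fixes g :: "'a::topological_space \<times> real \<Rightarrow> 'b::topological_space"
  assumes "\<And>t0. 0 < t0 \<Longrightarrow> t0 \<le> T \<Longrightarrow> continuous_on (UNIV \<times> {t0..T}) g"
  shows "continuous_on (UNIV \<times> {0<..T}) g"
  unfolding continuous_on_def
proof
  fix p :: "'a \<times> real" assume p: "p \<in> UNIV \<times> {0<..T}"
  obtain x t where pt: "p = (x, t)" by (cases p)
  have t: "0 < t" "t \<le> T" using p by (auto simp: pt)
  have "at p within (UNIV \<times> {0<..T}) = at p within (UNIV \<times> {t / 2..T})"
  proof (rule at_within_nhd)
    show "p \<in> UNIV \<times> {t / 2<..}" using t by (auto simp: pt)
    show "open ((UNIV :: 'a set) \<times> {t / 2<..})" by (intro open_Times) auto
    show "UNIV \<times> {0<..T} \<inter> UNIV \<times> {t / 2<..} - {p} = UNIV \<times> {t / 2..T} \<inter> UNIV \<times> {t / 2<..} - {p}"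
      using t by auto
  qed
  moreover have "(g \<longlongrightarrow> g p) (at p within (UNIV \<times> {t / 2..T}))"
    using assms[of "t / 2"] t unfolding continuous_on_def pt by simp
  ultimately show "(g \<longlongrightarrow> g p) (at p within (UNIV \<times> {0<..T}))" by simp
qed

lemma fourier_coeff_scaleR: "fourier_coeff (\<lambda>x. r *\<^sub>R g x) n = r *\<^sub>R fourier_coeff g n"
proof -
  have "set_lebesgue_integral lborel torus (\<lambda>x. (r *\<^sub>R g x) * cis (- (real_vec n \<bullet> x))) =
      set_lebesgue_integral lborel torus (\<lambda>x. r *\<^sub>R (g x * cis (- (real_vec n \<bullet> x))))"
    by simp
  then show ?thesis unfolding fourier_coeff_def by (simp only: set_integral_scaleR_right scaleR_conv_of_real) simp
qed

lemma liouville_finite_sum_le: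
  fixes g :: "real ^ 'n \<Rightarrow> complex"
  assumes "g \<in> L2b_torus b" "finite F"
  shows "(\<Sum>n\<in>F. weight n powr b * (norm (fourier_coeff g n))\<^sup>2) \<le> L2b_norm_sq b g"
proof -
  have s: "liouville_summand b g summable_on UNIV" using assms by (simp add: L2b_torus_def)
  have "(\<Sum>n\<in>F. liouville_summand b g n) \<le> L2b_norm_sq b g"
    unfolding L2b_norm_sq_def
    by (rule finite_sum_le_infsum[OF s assms(2)]) (auto simp: liouville_summand_def)
  then show ?thesis by (simp add: liouville_summand_def)
qed

text \<open>The data of the initial value problem. The mode \<open>n\<close> of the solution is \<open>mode n\<close>, and
  \<open>mode_int n\<close> is its fractional integral of order \<open>1 - \<rho>\<close>.\<close>

locale rl_problem =
  fixes T \<rho> a :: real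
    and \<phi> :: "real ^ 'n \<Rightarrow> complex"
    and f :: "real ^ 'n \<Rightarrow> real \<Rightarrow> complex"
  assumes T: "T > 0" and \<rho>: "0 < \<rho>" "\<rho> < 1" and a: "a > real CARD('n) / 2"
    and \<phi>C: "\<phi> \<in> C_torus" and \<phi>L: "\<phi> \<in> L2b_torus (a - 2)"
    and fC: "f \<in> C_torus_time {0<..T}"
    and fL: "\<And>t. 0 < t \<Longrightarrow> t \<le> T \<Longrightarrow> (\<lambda>x. f x t) \<in> L2b_torus a"
    and fG: "\<exists>G. continuous_on {0..T} G \<and>
           (\<forall>t\<in>{0<..T}. G t = L2b_norm_sq a (\<lambda>x. t powr (1 - \<rho>) *\<^sub>R f x t))"
begin

definition fc :: "int ^ 'n \<Rightarrow> real \<Rightarrow> complex" where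
  "fc n t = fourier_coeff (\<lambda>x. f x t) n"

definition duhamel :: "int ^ 'n \<Rightarrow> real \<Rightarrow> complex" where
  "duhamel n = half_conv (ml_kernel \<rho> \<rho> (freq_sq n)) (fc n)"

definition duhamel_int :: "int ^ 'n \<Rightarrow> real \<Rightarrow> complex" where
  "duhamel_int n = half_conv (ml_kernel \<rho> 1 (freq_sq n)) (fc n)"

definition mode :: "int ^ 'n \<Rightarrow> real \<Rightarrow> complex" where
  "mode n t = fourier_coeff \<phi> n * of_real (ml_kernel \<rho> \<rho> (freq_sq n) t) + duhamel n t"

definition mode_int :: "int ^ 'n \<Rightarrow> real \<Rightarrow> complex" where
  "mode_int n t = fourier_coeff \<phi> n * of_real (ml_kernel \<rho> 1 (freq_sq n) t) + duhamel_int n t"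

text \<open>A loss of derivatives that still leaves \<open>a - 2 \<epsilon>\<close> above half the dimension.\<close>

definition \<epsilon> :: real where
  "\<epsilon> = min 1 ((a - real CARD('n) / 2) / 4)"

definition tail :: "int ^ 'n \<Rightarrow> real" where
  "tail n = weight n powr (2 * \<epsilon> - a)"

lemma \<epsilon>: "0 < \<epsilon>" "\<epsilon> \<le> 1" "a - 2 * \<epsilon> > real CARD('n) / 2"
  using a by (auto simp: \<epsilon>_def min_def field_simps)

lemma a_pos: "a > 0"
proof -
  have "real CARD('n) / 2 \<ge> 0" by simp
  then show ?thesis using a by linarith
qed

lemma tail_summable: "tail summable_on UNIV"
  using weight_summable[OF \<epsilon>(3)] by (simp add: tail_def[abs_def])

lemma tail_nonneg: "tail n \<ge> 0"
  by (simp add: tail_def)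

lemma weight_powr_le_tail: "2 * e \<le> 2 * \<epsilon> \<Longrightarrow> weight n powr (2 * e - a) \<le> tail n"
  unfolding tail_def by (intro powr_mono) auto

lemma sqrt_weight_le_tail: "e \<le> \<epsilon> \<Longrightarrow> sqrt (\<Sum>n\<in>F. weight n powr (2 * e - a)) \<le> sqrt (\<Sum>n\<in>F. tail n)"
  by (intro real_sqrt_le_mono sum_mono weight_powr_le_tail) simp

lemma f_cont: "0 < t \<Longrightarrow> t \<le> T \<Longrightarrow> continuous_on UNIV (\<lambda>x. f x t)"
proof -
  assume t: "0 < t" "t \<le> T"
  have "continuous_on (UNIV \<times> {0<..T}) (\<lambda>(x, t). f x t)" using fC by (simp add: C_torus_time_def)
  then have "continuous_on UNIV (\<lambda>x. (\<lambda>(x, t). f x t) (x, t))"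
    by (rule continuous_on_compose2) (use t in \<open>auto intro!: continuous_on_Pair continuous_on_id continuous_on_const\<close>)
  then show ?thesis by simp
qed

lemma f_C_torus: "0 < t \<Longrightarrow> t \<le> T \<Longrightarrow> (\<lambda>x. f x t) \<in> C_torus"
  using f_cont fC by (auto simp: C_torus_def C_torus_time_def)

lemma fc_continuous: "continuous_on {0<..T} (fc n)"
proof -
  have c: "continuous_on (UNIV \<times> {0<..T}) (\<lambda>p. f (fst p) (snd p))" using fC by (simp add: C_torus_time_def case_prod_unfold)
  have "continuous_on ({0<..T} \<times> torus_cbox) (\<lambda>p. f (snd p) (fst p))"
    by (rule continuous_on_compose2[OF c, of _ "\<lambda>p. (snd p, fst p)", simplified])
      (auto intro!: continuous_on_Pair continuous_on_fst continuous_on_snd continuous_on_id)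
  moreover have "continuous_on ({0<..T} \<times> torus_cbox) (\<lambda>p. cis (- (real_vec n \<bullet> snd p)))"
    by (intro continuous_intros)
  ultimately have "continuous_on ({0<..T} \<times> torus_cbox) (\<lambda>p. f (snd p) (fst p) * cis (- (real_vec n \<bullet> snd p)))"
    by (rule continuous_on_mult)
  then have "continuous_on {0<..T} (\<lambda>t. integral torus_cbox (\<lambda>x. f x t * cis (- (real_vec n \<bullet> x))))"
    by (intro integral_continuous_on_param) (simp add: case_prod_unfold)
  then have "continuous_on {0<..T} (\<lambda>t. integral torus_cbox (\<lambda>x. f x t * cis (- (real_vec n \<bullet> x))) / (2 * pi) ^ CARD('n))"
    by (intro continuous_on_divide continuous_on_const) auto
  then show ?thesis
    by (rule continuous_on_eq) (simp add: fc_def fourier_coeff_eq_integral[OF f_cont])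
qed

text \<open>The squared norm of \<open>t\<^sup>1\<^sup>-\<^sup>\<rho> f(\<cdot>, t)\<close> extends continuously to \<open>[0, T]\<close> and is therefore bounded.\<close>

lemma fc_sum_bound:
  obtains B where "B \<ge> 0"
    "\<And>t F. 0 < t \<Longrightarrow> t \<le> T \<Longrightarrow> finite F \<Longrightarrow> (\<Sum>n\<in>F. weight n powr a * (norm (fc n t))\<^sup>2) \<le> (B * power_kernel \<rho> t)\<^sup>2"
proof -
  obtain G where G: "continuous_on {0..T} G" "\<And>t. t \<in> {0<..T} \<Longrightarrow> G t = L2b_norm_sq a (\<lambda>x. t powr (1 - \<rho>) *\<^sub>R f x t)"
    using fG by blast
  have "compact (G ` {0..T})" by (rule compact_continuous_image[OF G(1) compact_Icc])
  then have "bounded (G ` {0..T})" by (rule compact_imp_bounded)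
  then have "\<exists>M. \<forall>y\<in>G ` {0..T}. norm y \<le> M" by (simp only: bounded_iff)
  then obtain M where "\<forall>y\<in>G ` {0..T}. norm y \<le> M" ..
  then have M: "norm (G t) \<le> M" if "t \<in> {0..T}" for t using that by simp
  have M0: "M \<ge> 0" using order_trans[OF norm_ge_zero M[of 0]] T by simp
  have g: "Gamma \<rho> > 0" using \<rho> by simp
  show thesis
  proof (rule that[of "sqrt M * Gamma \<rho>"])
    show "sqrt M * Gamma \<rho> \<ge> 0" using M0 g by simp
    fix t F assume t: "0 < t" "t \<le> T" and F: "finite (F :: (int ^ 'n) set)"
    define r where "r = t powr (1 - \<rho>)"
    have r: "r > 0" using t by (simp add: r_def)
    have ls: "liouville_summand a (\<lambda>x. r *\<^sub>R f x t) n = r\<^sup>2 * liouville_summand a (\<lambda>x. f x t) n" for n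
      by (simp add: liouville_summand_def fourier_coeff_scaleR power_mult_distrib)
    have "L2b_norm_sq a (\<lambda>x. r *\<^sub>R f x t) = (\<Sum>\<^sub>\<infinity>n. r\<^sup>2 * liouville_summand a (\<lambda>x. f x t) n)"
      unfolding L2b_norm_sq_def by (rule infsum_cong) (rule ls)
    also have "\<dots> = r\<^sup>2 * L2b_norm_sq a (\<lambda>x. f x t)"
      unfolding L2b_norm_sq_def by (rule infsum_cmult_right')
    finally have "L2b_norm_sq a (\<lambda>x. r *\<^sub>R f x t) = r\<^sup>2 * L2b_norm_sq a (\<lambda>x. f x t)" .
    then have "r\<^sup>2 * L2b_norm_sq a (\<lambda>x. f x t) = G t" using G(2)[of t] t by (simp add: r_def)
    also have "\<dots> \<le> M" using order_trans[OF abs_ge_self, of "G t" M] M[of t] t by simp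
    finally have "r\<^sup>2 * L2b_norm_sq a (\<lambda>x. f x t) \<le> M" .
    then have "L2b_norm_sq a (\<lambda>x. f x t) \<le> M / r\<^sup>2" using r by (simp add: pos_le_divide_eq mult.commute)
    also have "M / r\<^sup>2 = (sqrt M * Gamma \<rho> * power_kernel \<rho> t)\<^sup>2"
    proof -
      have *: "sqrt M * Gamma \<rho> * power_kernel \<rho> t = sqrt M / r"
      proof -
        have "t powr (\<rho> - 1) = inverse r" unfolding r_def by (simp flip: powr_minus)
        then show ?thesis using g by (simp add: power_kernel_def divide_inverse)
      qed
      show ?thesis unfolding * power_divide using M0 by simp
    qed
    finally show "(\<Sum>n\<in>F. weight n powr a * (norm (fc n t))\<^sup>2) \<le> (sqrt M * Gamma \<rho> * power_kernel \<rho> t)\<^sup>2"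
      using liouville_finite_sum_le[OF fL[OF t] F] by (simp add: fc_def)
  qed
qed

text \<open>The bound is fixed once and for all, so that the constants below depend on the data only.\<close>

definition fB :: real where
  "fB = (SOME B. B \<ge> 0 \<and> (\<forall>t F. 0 < t \<longrightarrow> t \<le> T \<longrightarrow> finite F \<longrightarrow>
     (\<Sum>n\<in>F. weight n powr a * (norm (fc n t))\<^sup>2) \<le> (B * power_kernel \<rho> t)\<^sup>2))"

lemma fB: "fB \<ge> 0"
    "0 < t \<Longrightarrow> t \<le> T \<Longrightarrow> finite F \<Longrightarrow> (\<Sum>n\<in>F. weight n powr a * (norm (fc n t))\<^sup>2) \<le> (fB * power_kernel \<rho> t)\<^sup>2"
proof -
  obtain B where B: "B \<ge> 0" "\<And>t F. 0 < t \<Longrightarrow> t \<le> T \<Longrightarrow> finite F \<Longrightarrow>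
      (\<Sum>n\<in>F. weight n powr a * (norm (fc n t))\<^sup>2) \<le> (B * power_kernel \<rho> t)\<^sup>2"
    by (rule fc_sum_bound) (rule that, assumption, blast)
  have "B \<ge> 0 \<and> (\<forall>t F. 0 < t \<longrightarrow> t \<le> T \<longrightarrow> finite F \<longrightarrow>
     (\<Sum>n\<in>F. weight n powr a * (norm (fc n t))\<^sup>2) \<le> (B * power_kernel \<rho> t)\<^sup>2)"
    by (intro conjI allI impI B)
  then have P: "fB \<ge> 0 \<and> (\<forall>t F. 0 < t \<longrightarrow> t \<le> T \<longrightarrow> finite F \<longrightarrow>
     (\<Sum>n\<in>F. weight n powr a * (norm (fc n t))\<^sup>2) \<le> (fB * power_kernel \<rho> t)\<^sup>2)"
    unfolding fB_def by (rule someI)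
  show "fB \<ge> 0" using P by (rule conjunct1)
  show "(\<Sum>n\<in>F. weight n powr a * (norm (fc n t))\<^sup>2) \<le> (fB * power_kernel \<rho> t)\<^sup>2"
    if "0 < t" "t \<le> T" "finite F"
    using P[THEN conjunct2, rule_format, OF that] .
qed

lemma fc_weighted_sum:
  assumes t: "0 < t" "t \<le> T" and F: "finite F" and e: "e \<le> \<epsilon>"
  shows "(\<Sum>n\<in>F. weight n powr e * norm (fc n t)) \<le> fB * sqrt (\<Sum>n\<in>F. tail n) * power_kernel \<rho> t"
proof -
  have p: "power_kernel \<rho> t \<ge> 0" using \<rho> by (intro power_kernel_nonneg)
  have "(\<Sum>n\<in>F. weight n powr e * \<bar>norm (fc n t)\<bar>) \<le> (fB * power_kernel \<rho> t) * sqrt (\<Sum>n\<in>F. weight n powr (2 * e - a))"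
    by (rule weighted_sum_le[OF fB(2)[OF t F]]) (use fB(1) p in simp)
  also have "\<dots> \<le> (fB * power_kernel \<rho> t) * sqrt (\<Sum>n\<in>F. tail n)"
    using fB(1) p e by (intro mult_left_mono sqrt_weight_le_tail) auto
  finally show ?thesis by (simp add: mult_ac)
qed

lemma fc_bound: "0 < t \<Longrightarrow> t \<le> T \<Longrightarrow> norm (fc n t) \<le> fB * power_kernel \<rho> t"
proof -
  assume t: "0 < t" "t \<le> T"
  have "(norm (fc n t))\<^sup>2 = 1 * (norm (fc n t))\<^sup>2" by simp
  also have "\<dots> \<le> weight n powr a * (norm (fc n t))\<^sup>2"
    using a_pos weight_ge_1[of n] by (intro mult_right_mono ge_one_powr_ge_zero) auto
  also have "\<dots> \<le> (fB * power_kernel \<rho> t)\<^sup>2" using fB(2)[OF t, of "{n}"] by simp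
  finally show ?thesis
    by (rule power2_le_imp_le) (use fB(1) \<rho> in \<open>auto intro!: mult_nonneg_nonneg power_kernel_nonneg\<close>)
qed

lemma fc_measurable: "t \<le> T \<Longrightarrow> set_borel_measurable lborel {0<..<t} (fc n)"
  by (rule continuous_on_set_borel_measurable[OF fc_continuous])

lemma f_fourier_series:
  assumes t: "0 < t" "t \<le> T"
  shows "(\<lambda>n. norm (fc n t)) summable_on UNIV" "f x t = (\<Sum>\<^sub>\<infinity>n. fc n t * torus_char n x)"
proof -
  show s: "(\<lambda>n. norm (fc n t)) summable_on UNIV"
  proof (rule uniform_limit_sqrt_tail(1)[OF tail_summable tail_nonneg, of "fB * power_kernel \<rho> t" "{()}" "\<lambda>n _. fc n t"])
    show "fB * power_kernel \<rho> t \<ge> 0" using fB(1) \<rho> by (intro mult_nonneg_nonneg power_kernel_nonneg)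
    show "(\<Sum>n\<in>F. norm (fc n t)) \<le> fB * power_kernel \<rho> t * sqrt (\<Sum>n\<in>F. tail n)" if "finite F" for F
      using fc_weighted_sum[OF t that, of 0] \<epsilon>(1) by (simp add: weight_pos[THEN less_imp_neq, symmetric] mult_ac)
  qed simp
  show "f x t = (\<Sum>\<^sub>\<infinity>n. fc n t * torus_char n x)"
    using fourier_series_eq[OF f_C_torus[OF t], of x] s by (simp add: fc_def)
qed

text \<open>The sum is taken inside the convolution before the coefficients are estimated: a bound for the
  individual \<open>fc n\<close> that is uniform in time would not be summable in \<open>n\<close>.\<close>

lemma half_conv_fc_sum_bound:
  fixes k :: "int ^ 'n \<Rightarrow> real \<Rightarrow> real"
  assumes t: "0 < t" "t \<le> T" and F: "finite F" and e: "e \<le> \<epsilon>" and \<alpha>: "\<alpha> > 0" and A: "A \<ge> 0"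
    and km: "\<And>n. k n \<in> borel_measurable borel" and m0: "\<And>n. m n > 0"
    and kb: "\<And>n s. 0 < s \<Longrightarrow> s \<le> T \<Longrightarrow> m n * \<bar>k n s\<bar> \<le> A * weight n powr e * power_kernel \<alpha> s"
  shows "(\<Sum>n\<in>F. m n * norm (half_conv (k n) (fc n) t)) \<le> A * fB * power_kernel (\<alpha> + \<rho>) t * sqrt (\<Sum>n\<in>F. tail n)"
proof -
  have cm: "set_borel_measurable lborel {0<..<t} (\<lambda>s. weight n powr e * norm (fc n s))" for n
  proof -
    have "(\<lambda>s. indicator {0<..<t} s *\<^sub>R fc n s) \<in> borel_measurable lborel"
      using fc_measurable[OF t(2)] unfolding set_borel_measurable_def .
    from measurable_compose[OF this borel_measurable_norm]
    have "(\<lambda>s. weight n powr e * norm (indicator {0<..<t} s *\<^sub>R fc n s)) \<in> borel_measurable lborel"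
      by (rule borel_measurable_times[OF borel_measurable_const])
    also have "(\<lambda>s. weight n powr e * norm (indicator {0<..<t} s *\<^sub>R fc n s)) =
        (\<lambda>s. indicator {0<..<t} s *\<^sub>R (weight n powr e * norm (fc n s)))"
      by (rule ext) (simp add: indicator_def)
    finally show ?thesis unfolding set_borel_measurable_def .
  qed
  have cb: "norm (weight n powr e * norm (fc n s)) \<le> (weight n powr e * fB) * power_kernel \<rho> s" if "0 < s" "s < t" for n s
    using fc_bound[of s n] that t by (simp add: mult.assoc mult_left_mono)
  have I: "set_integrable lborel {0<..<t} (\<lambda>s. power_kernel \<alpha> (t - s) *\<^sub>R (weight n powr e * norm (fc n s)))" for n
  proof (rule half_conv_dominated(1)[where \<alpha> = \<alpha> and \<beta> = \<rho> and A = 1 and K = "weight n powr e * fB"])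
    show "\<bar>power_kernel \<alpha> s\<bar> \<le> 1 * power_kernel \<alpha> s" for s using power_kernel_nonneg[OF \<alpha>] by simp
    show "norm (weight n powr e * norm (fc n s)) \<le> (weight n powr e * fB) * power_kernel \<rho> s" if "0 < s" "s < t" for s
      by (rule cb[OF that])
  qed (rule \<alpha> \<rho>(1) t(1) borel_measurable_power_kernel cm)+
  have single: "m n * norm (half_conv (k n) (fc n) t) \<le> A * half_conv (power_kernel \<alpha>) (\<lambda>s. weight n powr e * norm (fc n s)) t" for n
  proof -
    have kI: "set_integrable lborel {0<..<t} (\<lambda>s. k n (t - s) *\<^sub>R fc n s)"
    proof (rule half_conv_dominated(1)[OF \<alpha> \<rho>(1) t(1) km fc_measurable[OF t(2)], where A = "A * weight n powr e / m n" and K = fB])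
      fix s assume s: "0 < s" "s < t"
      show "\<bar>k n s\<bar> \<le> A * weight n powr e / m n * power_kernel \<alpha> s"
        using kb[of s n] s t m0[of n] by (simp add: pos_le_divide_eq mult.commute)
      show "norm (fc n s) \<le> fB * power_kernel \<rho> s" using fc_bound s t by simp
    qed
    have "m n * norm (half_conv (k n) (fc n) t) \<le> m n * set_lebesgue_integral lborel {0<..<t} (\<lambda>s. norm (k n (t - s) *\<^sub>R fc n s))"
      unfolding half_conv_def using m0[of n] by (intro mult_left_mono set_integral_norm_bound[OF kI]) auto
    also have "\<dots> = set_lebesgue_integral lborel {0<..<t} (\<lambda>s. m n * norm (k n (t - s) *\<^sub>R fc n s))"
      by (rule set_integral_mult_right[symmetric])
    also have "\<dots> \<le> set_lebesgue_integral lborel {0<..<t} (\<lambda>s. A * (power_kernel \<alpha> (t - s) *\<^sub>R (weight n powr e * norm (fc n s))))"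
    proof (rule set_integral_mono)
      show "set_integrable lborel {0<..<t} (\<lambda>s. m n * norm (k n (t - s) *\<^sub>R fc n s))"
        using set_integrable_norm[OF kI] by (rule set_integrable_mult_right)
      show "set_integrable lborel {0<..<t} (\<lambda>s. A * (power_kernel \<alpha> (t - s) *\<^sub>R (weight n powr e * norm (fc n s))))"
        using I by (rule set_integrable_mult_right)
      fix s assume s: "s \<in> {0<..<t}"
      have "m n * norm (k n (t - s) *\<^sub>R fc n s) = (m n * \<bar>k n (t - s)\<bar>) * norm (fc n s)" by simp
      also have "\<dots> \<le> (A * weight n powr e * power_kernel \<alpha> (t - s)) * norm (fc n s)"
        using kb[of "t - s" n] s t by (intro mult_right_mono) auto
      finally show "m n * norm (k n (t - s) *\<^sub>R fc n s) \<le> A * (power_kernel \<alpha> (t - s) *\<^sub>R (weight n powr e * norm (fc n s)))"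
        by (simp add: mult_ac)
    qed
    also have "\<dots> = A * half_conv (power_kernel \<alpha>) (\<lambda>s. weight n powr e * norm (fc n s)) t"
      unfolding half_conv_def by (rule set_integral_mult_right)
    finally show ?thesis .
  qed
  have "(\<Sum>n\<in>F. m n * norm (half_conv (k n) (fc n) t)) \<le>
      (\<Sum>n\<in>F. A * half_conv (power_kernel \<alpha>) (\<lambda>s. weight n powr e * norm (fc n s)) t)"
    by (rule sum_mono) (rule single)
  also have "\<dots> = A * (\<Sum>n\<in>F. 1 * half_conv (power_kernel \<alpha>) (\<lambda>s. weight n powr e * norm (fc n s)) t)"
    by (simp only: sum_distrib_left mult_1)
  also have "(\<Sum>n\<in>F. 1 * half_conv (power_kernel \<alpha>) (\<lambda>s. weight n powr e * norm (fc n s)) t) =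
      half_conv (power_kernel \<alpha>) (\<lambda>s. \<Sum>n\<in>F. 1 * (weight n powr e * norm (fc n s))) t"
    by (rule half_conv_sum(2)[symmetric]) (rule I)
  finally have S: "(\<Sum>n\<in>F. m n * norm (half_conv (k n) (fc n) t)) \<le>
      A * half_conv (power_kernel \<alpha>) (\<lambda>s. \<Sum>n\<in>F. 1 * (weight n powr e * norm (fc n s))) t" .
  have "norm (half_conv (power_kernel \<alpha>) (\<lambda>s. \<Sum>n\<in>F. 1 * (weight n powr e * norm (fc n s))) t) \<le>
      1 * (fB * sqrt (\<Sum>n\<in>F. tail n)) * power_kernel (\<alpha> + \<rho>) t"
  proof (rule half_conv_dominated(3)[OF \<alpha> \<rho>(1) t(1) borel_measurable_power_kernel])
    show "set_borel_measurable lborel {0<..<t} (\<lambda>s. \<Sum>n\<in>F. 1 * (weight n powr e * norm (fc n s)))"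
      using cm unfolding set_borel_measurable_def scaleR_sum_right mult_1 by (intro borel_measurable_sum)
    show "\<bar>power_kernel \<alpha> s\<bar> \<le> 1 * power_kernel \<alpha> s" for s using power_kernel_nonneg[OF \<alpha>] by simp
    fix s assume s: "0 < s" "s < t"
    have "norm (\<Sum>n\<in>F. 1 * (weight n powr e * norm (fc n s))) = (\<Sum>n\<in>F. weight n powr e * norm (fc n s))"
      by (simp add: sum_nonneg)
    also have "\<dots> \<le> fB * sqrt (\<Sum>n\<in>F. tail n) * power_kernel \<rho> s"
      by (rule fc_weighted_sum) (use s t F e in auto)
    finally show "norm (\<Sum>n\<in>F. 1 * (weight n powr e * norm (fc n s))) \<le> fB * sqrt (\<Sum>n\<in>F. tail n) * power_kernel \<rho> s" .
  qed
  then have "half_conv (power_kernel \<alpha>) (\<lambda>s. \<Sum>n\<in>F. 1 * (weight n powr e * norm (fc n s))) t \<le>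
      1 * (fB * sqrt (\<Sum>n\<in>F. tail n)) * power_kernel (\<alpha> + \<rho>) t"
    unfolding real_norm_def by (rule order_trans[OF abs_ge_self])
  from order_trans[OF S mult_left_mono[OF this A]] show ?thesis by (simp only: mult_ac mult_1)
qed

end

lemma powr_le_endpoints:
  fixes t0 t T r :: real
  assumes "0 < t0" "t0 \<le> t" "t \<le> T"
  shows "t powr r \<le> t0 powr r + T powr r"
proof (cases "r \<ge> 0")
  case True
  then have "t powr r \<le> T powr r" using assms by (intro powr_mono2) auto
  then show ?thesis using powr_ge_zero[of t0 r] by linarith
next
  case False
  then have "t powr r \<le> t0 powr r" using assms by (intro powr_mono2') auto
  then show ?thesis using powr_ge_zero[of T r] by linarith
qed

context rl_problem
begin

lemma phi_weighted_sum:
  obtains P where "P \<ge> 0"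
    "\<And>F. finite F \<Longrightarrow> (\<Sum>n\<in>F. weight n powr (- 1) * norm (fourier_coeff \<phi> n)) \<le> P * sqrt (\<Sum>n\<in>F. tail n)"
proof -
  define P where "P = sqrt (L2b_norm_sq (a - 2) \<phi>)"
  have L0: "L2b_norm_sq (a - 2) \<phi> \<ge> 0" using liouville_finite_sum_le[OF \<phi>L, of "{}"] by simp
  have P0: "P \<ge> 0" using L0 by (simp add: P_def)
  have "(\<Sum>n\<in>F. weight n powr (- 1) * norm (fourier_coeff \<phi> n)) \<le> P * sqrt (\<Sum>n\<in>F. tail n)" if F: "finite F" for F
  proof -
    have "(\<Sum>n\<in>F. weight n powr (a - 2) * (norm (fourier_coeff \<phi> n))\<^sup>2) \<le> P\<^sup>2"
      using liouville_finite_sum_le[OF \<phi>L F] L0 by (simp add: P_def)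
    from weighted_sum_le[OF this P0, of "- 1"]
    have "(\<Sum>n\<in>F. weight n powr (- 1) * norm (fourier_coeff \<phi> n)) \<le> P * sqrt (\<Sum>n\<in>F. weight n powr (2 * 0 - a))"
      by simp
    also have "\<dots> \<le> P * sqrt (\<Sum>n\<in>F. tail n)"
      using sqrt_weight_le_tail[of 0 F] \<epsilon>(1) P0 by (intro mult_left_mono) auto
    finally show ?thesis .
  qed
  from that[OF P0 this] show thesis .
qed

text \<open>The exponent \<open>\<theta> = 1 - \<epsilon>\<close> in the kernel bound leaves \<open>w\<^sup>\<epsilon> s\<^sup>\<epsilon>\<^sup>\<rho>\<^sup>-\<^sup>1\<close>, integrable at \<open>s = 0\<close>; the lost factor
  \<open>w\<^sup>\<epsilon>\<close> is paid for by the room between \<open>a\<close> and half the dimension.\<close>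

lemma duhamel_weighted_sum:
  obtains A where "A \<ge> 0"
    "\<And>t F. 0 < t \<Longrightarrow> t \<le> T \<Longrightarrow> finite F \<Longrightarrow>
      (\<Sum>n\<in>F. weight n * norm (duhamel n t)) \<le> A * power_kernel (\<epsilon> * \<rho> + \<rho>) t * sqrt (\<Sum>n\<in>F. tail n)"
proof -
  obtain C where C: "C > 0"
    "\<And>l t \<theta>. l \<ge> 0 \<Longrightarrow> 0 < t \<Longrightarrow> t \<le> T \<Longrightarrow> 0 \<le> \<theta> \<Longrightarrow> \<theta> \<le> 2 \<Longrightarrow>
       ml_kernel \<rho> \<rho> l t \<le> C * t powr (\<rho> - 1) * ((1 + l) * t powr \<rho>) powr (- \<theta>)"
    using ml_kernel_uniform_bounds[OF \<rho> T] by metis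
  have er: "\<epsilon> * \<rho> > 0" using \<epsilon>(1) \<rho>(1) by simp
  have G: "Gamma (\<epsilon> * \<rho>) > 0" using er by simp
  have kb: "weight n * \<bar>ml_kernel \<rho> \<rho> (freq_sq n) s\<bar> \<le> (C * Gamma (\<epsilon> * \<rho>)) * weight n powr \<epsilon> * power_kernel (\<epsilon> * \<rho>) s"
    if s: "0 < s" "s \<le> T" for n :: "int ^ 'n" and s
  proof -
    have w: "weight n > 0" by (rule weight_pos)
    have "\<bar>ml_kernel \<rho> \<rho> (freq_sq n) s\<bar> = ml_kernel \<rho> \<rho> (freq_sq n) s"
      using ml_kernel_nonneg[OF \<rho>, of "freq_sq n" s] s by simp
    also have "\<dots> \<le> C * s powr (\<rho> - 1) * (weight n * s powr \<rho>) powr (- (1 - \<epsilon>))"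
      using \<epsilon>(1,2) s by (intro C(2)) auto
    also have "(weight n * s powr \<rho>) powr (- (1 - \<epsilon>)) = weight n powr (\<epsilon> - 1) * s powr (\<rho> * (\<epsilon> - 1))"
      using w s by (simp add: powr_mult powr_powr)
    also have "C * s powr (\<rho> - 1) * (weight n powr (\<epsilon> - 1) * s powr (\<rho> * (\<epsilon> - 1))) =
        C * weight n powr (\<epsilon> - 1) * s powr (\<epsilon> * \<rho> - 1)"
    proof -
      have "s powr (\<rho> - 1) * s powr (\<rho> * (\<epsilon> - 1)) = s powr (\<epsilon> * \<rho> - 1)"
        unfolding powr_add[symmetric] by (simp add: algebra_simps)
      then show ?thesis by (simp add: mult_ac)
    qed
    finally have "weight n * \<bar>ml_kernel \<rho> \<rho> (freq_sq n) s\<bar> \<le> weight n * (C * weight n powr (\<epsilon> - 1) * s powr (\<epsilon> * \<rho> - 1))"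
      using w by (intro mult_left_mono) auto
    also have "\<dots> = C * weight n powr \<epsilon> * s powr (\<epsilon> * \<rho> - 1)"
    proof -
      have "weight n * weight n powr (\<epsilon> - 1) = weight n powr 1 * weight n powr (\<epsilon> - 1)" using w by simp
      also have "\<dots> = weight n powr \<epsilon>" unfolding powr_add[symmetric] by simp
      finally show ?thesis by (simp add: mult_ac)
    qed
    finally show ?thesis using G by (simp add: power_kernel_def mult_ac)
  qed
  have A0: "C * Gamma (\<epsilon> * \<rho>) \<ge> 0" using C(1) G by simp
  show thesis
  proof (rule that[of "C * Gamma (\<epsilon> * \<rho>) * fB"])
    show "C * Gamma (\<epsilon> * \<rho>) * fB \<ge> 0" using A0 fB(1) by simp
    fix t F assume t: "0 < t" "t \<le> T" and F: "finite (F :: (int ^ 'n) set)"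
    show "(\<Sum>n\<in>F. weight n * norm (duhamel n t)) \<le> C * Gamma (\<epsilon> * \<rho>) * fB * power_kernel (\<epsilon> * \<rho> + \<rho>) t * sqrt (\<Sum>n\<in>F. tail n)"
      unfolding duhamel_def
      by (rule half_conv_fc_sum_bound[OF t F order_refl er A0 borel_measurable_ml_kernel[OF \<rho>(1) \<rho>(1)] weight_pos kb])
  qed
qed

lemma duhamel_sum:
  assumes t: "0 < t" "t \<le> T" and F: "finite F"
  shows "(\<Sum>n\<in>F. norm (duhamel n t)) \<le> fB * power_kernel (\<rho> + \<rho>) t * sqrt (\<Sum>n\<in>F. tail n)"
proof -
  have "(\<Sum>n\<in>F. 1 * norm (half_conv (ml_kernel \<rho> \<rho> (freq_sq n)) (fc n) t)) \<le> 1 * fB * power_kernel (\<rho> + \<rho>) t * sqrt (\<Sum>n\<in>F. tail n)"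
  proof (rule half_conv_fc_sum_bound[OF t F, of 0])
    show "ml_kernel \<rho> \<rho> (freq_sq n) \<in> borel_measurable borel" for n :: "int ^ 'n"
      by (rule borel_measurable_ml_kernel[OF \<rho>(1) \<rho>(1)])
    show "1 * \<bar>ml_kernel \<rho> \<rho> (freq_sq n) s\<bar> \<le> 1 * weight n powr 0 * power_kernel \<rho> s" if "0 < s" for n :: "int ^ 'n" and s
      using ml_kernel_shift_le[OF \<rho>, of "freq_sq n" s 0] that weight_pos[of n] by simp
  qed (use \<epsilon> \<rho> in auto)
  then show ?thesis by (simp add: duhamel_def)
qed

lemma duhamel_int_sum:
  assumes t: "0 < t" "t \<le> T" and F: "finite F"
  shows "(\<Sum>n\<in>F. norm (duhamel_int n t)) \<le> fB * power_kernel (1 + \<rho>) t * sqrt (\<Sum>n\<in>F. tail n)"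
proof -
  have "(\<Sum>n\<in>F. 1 * norm (half_conv (ml_kernel \<rho> 1 (freq_sq n)) (fc n) t)) \<le> 1 * fB * power_kernel (1 + \<rho>) t * sqrt (\<Sum>n\<in>F. tail n)"
  proof (rule half_conv_fc_sum_bound[OF t F, of 0])
    show "ml_kernel \<rho> 1 (freq_sq n) \<in> borel_measurable borel" for n :: "int ^ 'n"
      by (rule borel_measurable_ml_kernel[OF \<rho>(1)]) simp
    show "1 * \<bar>ml_kernel \<rho> 1 (freq_sq n) s\<bar> \<le> 1 * weight n powr 0 * power_kernel 1 s" if "0 < s" for n :: "int ^ 'n" and s
      using ml_kernel_1_le_1[OF \<rho>, of "freq_sq n" s] ml_kernel_1_nonneg[OF \<rho>, of "freq_sq n" s] that weight_pos[of n]
      by (simp add: power_kernel_1)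
  qed (use \<epsilon> \<rho> in auto)
  then show ?thesis by (simp add: duhamel_int_def)
qed

text \<open>The part from \<open>\<phi>\<close> uses the exponent \<open>\<theta> = 2\<close> in the kernel bound; its constant blows up as \<open>t\<close> tends
  to \<open>0\<close>, hence the restriction to \<open>t \<ge> t\<^sub>0\<close>.\<close>

lemma mode_weighted_sum:
  assumes t0: "0 < t0" "t0 \<le> T"
  obtains K where "K \<ge> 0"
    "\<And>t F. t0 \<le> t \<Longrightarrow> t \<le> T \<Longrightarrow> finite F \<Longrightarrow> (\<Sum>n\<in>F. weight n * norm (mode n t)) \<le> K * sqrt (\<Sum>n\<in>F. tail n)"
proof -
  obtain C where C: "C > 0"
    "\<And>l t \<theta>. l \<ge> 0 \<Longrightarrow> 0 < t \<Longrightarrow> t \<le> T \<Longrightarrow> 0 \<le> \<theta> \<Longrightarrow> \<theta> \<le> 2 \<Longrightarrow>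
       ml_kernel \<rho> \<rho> l t \<le> C * t powr (\<rho> - 1) * ((1 + l) * t powr \<rho>) powr (- \<theta>)"
    using ml_kernel_uniform_bounds[OF \<rho> T] by metis
  obtain P where P: "P \<ge> 0"
    "\<And>F. finite F \<Longrightarrow> (\<Sum>n\<in>F. weight n powr (- 1) * norm (fourier_coeff \<phi> n)) \<le> P * sqrt (\<Sum>n\<in>F. tail n)"
    by (rule phi_weighted_sum) (rule that, assumption, blast)
  obtain A where A: "A \<ge> 0"
    "\<And>t F. 0 < t \<Longrightarrow> t \<le> T \<Longrightarrow> finite F \<Longrightarrow>
      (\<Sum>n\<in>F. weight n * norm (duhamel n t)) \<le> A * power_kernel (\<epsilon> * \<rho> + \<rho>) t * sqrt (\<Sum>n\<in>F. tail n)"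
    by (rule duhamel_weighted_sum) (rule that, assumption, blast)
  define K1 where "K1 = C * t0 powr (- 1 - \<rho>)"
  define \<beta> where "\<beta> = \<epsilon> * \<rho> + \<rho>"
  have \<beta>: "\<beta> > 0" using \<epsilon>(1) \<rho>(1) by (simp add: \<beta>_def add_pos_pos)
  define K2 where "K2 = (t0 powr (\<beta> - 1) + T powr (\<beta> - 1)) / Gamma \<beta>"
  have K: "K1 \<ge> 0" "K2 \<ge> 0" using C(1) \<beta> by (simp_all add: K1_def K2_def)
  show thesis
  proof (rule that[of "K1 * P + A * K2"])
    show "K1 * P + A * K2 \<ge> 0" using K P(1) A(1) by simp
    fix t F assume t: "t0 \<le> t" "t \<le> T" and F: "finite (F :: (int ^ 'n) set)"
    have tp: "0 < t" using t t0 by simp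
    have e: "weight n * ml_kernel \<rho> \<rho> (freq_sq n) t \<le> K1 * weight n powr (- 1)" for n :: "int ^ 'n"
    proof -
      have w: "weight n > 0" by (rule weight_pos)
      have "ml_kernel \<rho> \<rho> (freq_sq n) t \<le> C * t powr (\<rho> - 1) * (weight n * t powr \<rho>) powr (- 2)"
        using tp t by (intro C(2)) auto
      also have "(weight n * t powr \<rho>) powr (- 2) = weight n powr (- 2) * t powr (\<rho> * (- 2))"
        using w by (simp add: powr_mult powr_powr)
      also have "C * t powr (\<rho> - 1) * (weight n powr (- 2) * t powr (\<rho> * (- 2))) = C * t powr (- 1 - \<rho>) * weight n powr (- 2)"
      proof -
        have "t powr (\<rho> - 1) * t powr (\<rho> * (- 2)) = t powr (- 1 - \<rho>)"
          unfolding powr_add[symmetric] by (simp add: algebra_simps)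
        then show ?thesis by (simp add: mult_ac)
      qed
      also have "\<dots> \<le> K1 * weight n powr (- 2)"
        unfolding K1_def using t t0 C(1) \<rho>(1) by (intro mult_right_mono mult_left_mono powr_mono2') auto
      finally have "weight n * ml_kernel \<rho> \<rho> (freq_sq n) t \<le> weight n * (K1 * weight n powr (- 2))"
        using w by (intro mult_left_mono) auto
      also have "\<dots> = K1 * (weight n powr 1 * weight n powr (- 2))" using w by (simp add: mult_ac)
      also have "weight n powr 1 * weight n powr (- 2) = weight n powr (- 1)" unfolding powr_add[symmetric] by simp
      finally show ?thesis .
    qed
    have "(\<Sum>n\<in>F. weight n * norm (mode n t)) \<le>
        (\<Sum>n\<in>F. K1 * (weight n powr (- 1) * norm (fourier_coeff \<phi> n)) + weight n * norm (duhamel n t))"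
    proof (rule sum_mono)
      fix n :: "int ^ 'n"
      have e0: "ml_kernel \<rho> \<rho> (freq_sq n) t \<ge> 0" using tp by (intro ml_kernel_nonneg[OF \<rho>]) auto
      have "weight n * norm (mode n t) \<le> weight n * (norm (fourier_coeff \<phi> n * of_real (ml_kernel \<rho> \<rho> (freq_sq n) t)) + norm (duhamel n t))"
        unfolding mode_def using weight_pos[of n] by (intro mult_left_mono norm_triangle_ineq) auto
      also have "\<dots> = (weight n * ml_kernel \<rho> \<rho> (freq_sq n) t) * norm (fourier_coeff \<phi> n) + weight n * norm (duhamel n t)"
        using e0 by (simp add: norm_mult algebra_simps)
      also have "\<dots> \<le> (K1 * weight n powr (- 1)) * norm (fourier_coeff \<phi> n) + weight n * norm (duhamel n t)"
        by (intro add_right_mono mult_right_mono e) simp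
      finally show "weight n * norm (mode n t) \<le> K1 * (weight n powr (- 1) * norm (fourier_coeff \<phi> n)) + weight n * norm (duhamel n t)"
        by (simp only: mult.assoc)
    qed
    also have "\<dots> = K1 * (\<Sum>n\<in>F. weight n powr (- 1) * norm (fourier_coeff \<phi> n)) + (\<Sum>n\<in>F. weight n * norm (duhamel n t))"
      by (simp only: sum.distrib sum_distrib_left)
    also have "\<dots> \<le> K1 * (P * sqrt (\<Sum>n\<in>F. tail n)) + A * K2 * sqrt (\<Sum>n\<in>F. tail n)"
    proof (rule add_mono)
      show "K1 * (\<Sum>n\<in>F. weight n powr (- 1) * norm (fourier_coeff \<phi> n)) \<le> K1 * (P * sqrt (\<Sum>n\<in>F. tail n))"
        by (rule mult_left_mono[OF P(2)[OF F] K(1)])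
      have "power_kernel \<beta> t \<le> K2"
        unfolding power_kernel_def K2_def using powr_le_endpoints[OF t0(1) t] \<beta> by (intro divide_right_mono) auto
      then have "A * power_kernel \<beta> t * sqrt (\<Sum>n\<in>F. tail n) \<le> A * K2 * sqrt (\<Sum>n\<in>F. tail n)"
        using A(1) by (intro mult_right_mono mult_left_mono) (auto simp: sum_nonneg tail_nonneg)
      then show "(\<Sum>n\<in>F. weight n * norm (duhamel n t)) \<le> A * K2 * sqrt (\<Sum>n\<in>F. tail n)"
        using A(2)[OF tp t(2) F] unfolding \<beta>_def by linarith
    qed
    also have "\<dots> = (K1 * P + A * K2) * sqrt (\<Sum>n\<in>F. tail n)" by (simp add: algebra_simps)
    finally show "(\<Sum>n\<in>F. weight n * norm (mode n t)) \<le> (K1 * P + A * K2) * sqrt (\<Sum>n\<in>F. tail n)" .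
  qed
qed

lemma freq_sq_nonneg: "freq_sq n \<ge> 0" by simp

lemma duhamel_facts:
  shows "continuous_on {0<..T} (duhamel n)"
    and "0 < t \<Longrightarrow> t \<le> T \<Longrightarrow> set_integrable lborel {0<..<t} (\<lambda>s. power_kernel (1 - \<rho>) (t - s) *\<^sub>R duhamel n s)"
    and "0 < t \<Longrightarrow> t \<le> T \<Longrightarrow> half_conv (power_kernel (1 - \<rho>)) (duhamel n) t = duhamel_int n t"
    and "0 < t \<Longrightarrow> t \<le> T \<Longrightarrow> (duhamel_int n has_vector_derivative (fc n t - freq_sq n *\<^sub>R duhamel n t)) (at t within {0<..T})"
proof -
  have b: "norm (fc n s) \<le> fB * power_kernel \<rho> s" if "0 < s" "s \<le> T" for s by (rule fc_bound[OF that])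
  note D = duhamel_half_conv[OF \<rho> freq_sq_nonneg[of n] T fc_continuous[of n] b, folded duhamel_def duhamel_int_def]
  show "continuous_on {0<..T} (duhamel n)" by (rule D(1))
  show "set_integrable lborel {0<..<t} (\<lambda>s. power_kernel (1 - \<rho>) (t - s) *\<^sub>R duhamel n s)" if "0 < t" "t \<le> T"
    by (rule D(2)[OF _ _ that])
  show "half_conv (power_kernel (1 - \<rho>)) (duhamel n) t = duhamel_int n t" if "0 < t" "t \<le> T"
    by (rule D(3)[OF _ _ that])
  show "(duhamel_int n has_vector_derivative (fc n t - freq_sq n *\<^sub>R duhamel n t)) (at t within {0<..T})" if "0 < t" "t \<le> T"
    by (rule D(4)[OF _ _ that])
qed

lemma mode_continuous: "continuous_on {0<..T} (mode n)"
  unfolding mode_def[abs_def]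
proof (intro continuous_on_add continuous_on_mult continuous_on_const continuous_on_of_real)
  show "continuous_on {0<..T} (ml_kernel \<rho> \<rho> (freq_sq n))"
    by (rule continuous_on_subset[OF continuous_on_ml_kernel[OF \<rho>(1) \<rho>(1)]]) auto
  show "continuous_on {0<..T} (duhamel n)"
    by (rule duhamel_facts(1))
qed

lemma mode_split: "k *\<^sub>R mode n s = (k *\<^sub>R ml_kernel \<rho> \<rho> (freq_sq n) s) *\<^sub>R fourier_coeff \<phi> n + k *\<^sub>R duhamel n s"
  by (simp add: mode_def scaleR_conv_of_real algebra_simps)

lemma mode_half_conv:
  assumes t: "0 < t" "t \<le> T"
  shows "set_integrable lborel {0<..<t} (\<lambda>s. power_kernel (1 - \<rho>) (t - s) *\<^sub>R mode n s)"
    and "half_conv (power_kernel (1 - \<rho>)) (mode n) t = mode_int n t"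
proof -
  have r: "0 < 1 - \<rho>" using \<rho> by simp
  have i1: "set_integrable lborel {0<..<t} (\<lambda>s. (power_kernel (1 - \<rho>) (t - s) *\<^sub>R ml_kernel \<rho> \<rho> (freq_sq n) s) *\<^sub>R fourier_coeff \<phi> n)"
    by (rule set_integrable_scaleR_left) (rule half_conv_power_ml_kernel(1)[OF \<rho>(1) \<rho>(1) r t(1)])
  have i2: "set_integrable lborel {0<..<t} (\<lambda>s. power_kernel (1 - \<rho>) (t - s) *\<^sub>R duhamel n s)"
    by (rule duhamel_facts(2)[OF t])
  show "set_integrable lborel {0<..<t} (\<lambda>s. power_kernel (1 - \<rho>) (t - s) *\<^sub>R mode n s)"
    unfolding mode_split by (rule set_integral_add(1)[OF i1 i2])
  have "half_conv (power_kernel (1 - \<rho>)) (mode n) t =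
      set_lebesgue_integral lborel {0<..<t} (\<lambda>s. (power_kernel (1 - \<rho>) (t - s) *\<^sub>R ml_kernel \<rho> \<rho> (freq_sq n) s) *\<^sub>R fourier_coeff \<phi> n)
      + half_conv (power_kernel (1 - \<rho>)) (duhamel n) t"
    unfolding half_conv_def mode_split by (rule set_integral_add(2)[OF i1 i2])
  also have "half_conv (power_kernel (1 - \<rho>)) (duhamel n) t = duhamel_int n t"
    by (rule duhamel_facts(3)[OF t])
  also have "set_lebesgue_integral lborel {0<..<t} (\<lambda>s. (power_kernel (1 - \<rho>) (t - s) *\<^sub>R ml_kernel \<rho> \<rho> (freq_sq n) s) *\<^sub>R fourier_coeff \<phi> n)
      = half_conv (power_kernel (1 - \<rho>)) (ml_kernel \<rho> \<rho> (freq_sq n)) t *\<^sub>R fourier_coeff \<phi> n"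
  proof -
    have i0: "integrable lborel (\<lambda>s. indicator {0<..<t} s *\<^sub>R (power_kernel (1 - \<rho>) (t - s) *\<^sub>R ml_kernel \<rho> \<rho> (freq_sq n) s))"
      using half_conv_power_ml_kernel(1)[OF \<rho>(1) \<rho>(1) r t(1), of "freq_sq n"] unfolding set_integrable_def .
    have e: "indicator {0<..<t} s *\<^sub>R (c *\<^sub>R fourier_coeff \<phi> n) = (indicator {0<..<t} s *\<^sub>R c) *\<^sub>R fourier_coeff \<phi> n" for s :: real and c :: real
      by simp
    show ?thesis
      unfolding half_conv_def set_lebesgue_integral_def e by (rule integral_scaleR_left) (rule i0)
  qed
  also have "half_conv (power_kernel (1 - \<rho>)) (ml_kernel \<rho> \<rho> (freq_sq n)) t = ml_kernel \<rho> 1 (freq_sq n) t"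
    using half_conv_power_ml_kernel(2)[OF \<rho>(1) \<rho>(1) r t(1), of "freq_sq n"] by simp
  finally show "half_conv (power_kernel (1 - \<rho>)) (mode n) t = mode_int n t"
    by (simp add: mode_int_def scaleR_conv_of_real mult.commute)
qed

lemma mode_int_derivative:
  assumes t: "0 < t" "t \<le> T"
  shows "(mode_int n has_vector_derivative (fc n t - freq_sq n *\<^sub>R mode n t)) (at t within {0<..T})"
proof -
  have "(ml_kernel \<rho> 1 (freq_sq n) has_vector_derivative - (freq_sq n * ml_kernel \<rho> \<rho> (freq_sq n) t)) (at t within {0<..T})"
    using has_field_derivative_at_within[OF ml_kernel_1_has_derivative[OF \<rho>(1) t(1)]]
    by (simp only: has_real_derivative_iff_has_vector_derivative)
  from bounded_linear.has_vector_derivative[OF bounded_linear_scaleR_left[of "fourier_coeff \<phi> n"] this]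
  have "((\<lambda>t. ml_kernel \<rho> 1 (freq_sq n) t *\<^sub>R fourier_coeff \<phi> n) has_vector_derivative
     - (freq_sq n * ml_kernel \<rho> \<rho> (freq_sq n) t) *\<^sub>R fourier_coeff \<phi> n) (at t within {0<..T})" .
  from has_vector_derivative_add[OF this duhamel_facts(4)[OF t]]
  have "((\<lambda>t. ml_kernel \<rho> 1 (freq_sq n) t *\<^sub>R fourier_coeff \<phi> n + duhamel_int n t) has_vector_derivative
     - (freq_sq n * ml_kernel \<rho> \<rho> (freq_sq n) t) *\<^sub>R fourier_coeff \<phi> n + (fc n t - freq_sq n *\<^sub>R duhamel n t)) (at t within {0<..T})" .
  moreover have "(\<lambda>t. ml_kernel \<rho> 1 (freq_sq n) t *\<^sub>R fourier_coeff \<phi> n + duhamel_int n t) = mode_int n"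
    by (rule ext) (simp add: mode_int_def scaleR_conv_of_real mult.commute)
  moreover have "- (freq_sq n * ml_kernel \<rho> \<rho> (freq_sq n) t) *\<^sub>R fourier_coeff \<phi> n + (fc n t - freq_sq n *\<^sub>R duhamel n t) =
      fc n t - freq_sq n *\<^sub>R mode n t"
    by (simp add: mode_def scaleR_conv_of_real algebra_simps)
  ultimately show ?thesis by (simp only:)
qed

lemma duhamel_integrand_eq:
  "duhamel_integrand \<rho> f n t \<xi> = ml_kernel \<rho> \<rho> (freq_sq n) (t - (t - \<xi>)) *\<^sub>R fc n (t - \<xi>)"
  by (simp add: duhamel_integrand_def ml_kernel_def fc_def scaleR_conv_of_real mult.commute)

lemma series_term_eq: "series_term \<rho> \<phi> f n x t = mode n t * torus_char n x"
proof -
  have "set_lebesgue_integral lborel {0<..<t} (duhamel_integrand \<rho> f n t) = duhamel n t"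
    unfolding duhamel_def half_conv_def
    using set_integral_reflect(2)[of t "\<lambda>s. ml_kernel \<rho> \<rho> (freq_sq n) (t - s) *\<^sub>R fc n s"]
    unfolding duhamel_integrand_eq[abs_def] .
  then show ?thesis by (simp add: series_term_def mode_def ml_kernel_def)
qed

lemma duhamel_integrand_integrable:
  assumes t: "0 < t" "t \<le> T"
  shows "set_integrable lborel {0<..<t} (duhamel_integrand \<rho> f n t)"
proof -
  have "set_integrable lborel {0<..<t} (\<lambda>s. ml_kernel \<rho> \<rho> (freq_sq n) (t - s) *\<^sub>R fc n s)"
  proof (rule half_conv_dominated(1)[OF \<rho>(1) \<rho>(1) t(1) borel_measurable_ml_kernel[OF \<rho>(1) \<rho>(1)] fc_measurable[OF t(2)], where A = 1 and K = fB])
    show "\<bar>ml_kernel \<rho> \<rho> (freq_sq n) s\<bar> \<le> 1 * power_kernel \<rho> s" if "0 < s" for s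
      using ml_kernel_shift_le[OF \<rho>, of "freq_sq n" s 0] that by simp
    show "norm (fc n s) \<le> fB * power_kernel \<rho> s" if "0 < s" "s < t" for s
      using fc_bound[of s n] that t by simp
  qed
  then show ?thesis
    using set_integral_reflect(1)[of t "\<lambda>s. ml_kernel \<rho> \<rho> (freq_sq n) (t - s) *\<^sub>R fc n s"]
    unfolding duhamel_integrand_eq[abs_def] by (simp only:)
qed

lemma mode_weighted_summable:
  assumes t: "0 < t" "t \<le> T"
  shows "(\<lambda>n. weight n * norm (mode n t)) summable_on UNIV"
proof -
  obtain K where K: "K \<ge> 0"
    "\<And>s F. t \<le> s \<Longrightarrow> s \<le> T \<Longrightarrow> finite F \<Longrightarrow> (\<Sum>n\<in>F. weight n * norm (mode n s)) \<le> K * sqrt (\<Sum>n\<in>F. tail n)"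
    by (rule mode_weighted_sum[OF t]) (rule that, assumption, blast)
  have w: "norm (complex_of_real (weight n) * mode n t) = weight n * norm (mode n t)" for n
    using weight_pos[of n] by (simp add: norm_mult del: of_real_add)
  have "(\<lambda>n. norm (complex_of_real (weight n) * mode n t)) summable_on UNIV"
  proof (rule uniform_limit_sqrt_tail(1)[OF tail_summable tail_nonneg K(1), where Y = "{()}" and g = "\<lambda>n _. complex_of_real (weight n) * mode n t"])
    show "(\<Sum>n\<in>F. norm (complex_of_real (weight n) * mode n t)) \<le> K * sqrt (\<Sum>n\<in>F. tail n)" if "finite F" for F
      unfolding w by (rule K(2)[OF order_refl t(2) that])
  qed (rule singletonI)
  then show ?thesis by (simp only: w)
qed

lemma mode_summable:
  assumes t: "0 < t" "t \<le> T"
  shows "(\<lambda>n. norm (mode n t)) summable_on UNIV"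
proof (rule summable_on_comparison_test[OF mode_weighted_summable[OF t]])
  show "norm (mode n t) \<le> weight n * norm (mode n t)" for n
    using mult_right_mono[OF weight_ge_1[of n] norm_ge_zero[of "mode n t"]] by simp
qed simp

definition u :: "real ^ 'n \<Rightarrow> real \<Rightarrow> complex" where
  "u x t = (\<Sum>\<^sub>\<infinity>n. mode n t * torus_char n x)"

definition time_deriv :: "real ^ 'n \<Rightarrow> real \<Rightarrow> complex" where
  "time_deriv x t = (\<Sum>\<^sub>\<infinity>n. (fc n t - freq_sq n *\<^sub>R mode n t) * torus_char n x)"

lemma time_deriv_sum_bound:
  assumes t0: "0 < t0" "t0 \<le> T"
  obtains K where "K \<ge> 0"
    "\<And>t F. t0 \<le> t \<Longrightarrow> t \<le> T \<Longrightarrow> finite F \<Longrightarrow> (\<Sum>n\<in>F. norm (fc n t - freq_sq n *\<^sub>R mode n t)) \<le> K * sqrt (\<Sum>n\<in>F. tail n)"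
proof -
  obtain K where K: "K \<ge> 0"
    "\<And>s F. t0 \<le> s \<Longrightarrow> s \<le> T \<Longrightarrow> finite F \<Longrightarrow> (\<Sum>n\<in>F. weight n * norm (mode n s)) \<le> K * sqrt (\<Sum>n\<in>F. tail n)"
    by (rule mode_weighted_sum[OF t0]) (rule that, assumption, blast)
  define K2 where "K2 = (t0 powr (\<rho> - 1) + T powr (\<rho> - 1)) / Gamma \<rho>"
  have K2: "K2 \<ge> 0" using \<rho> by (simp add: K2_def)
  show thesis
  proof (rule that[of "fB * K2 + K"])
    show "fB * K2 + K \<ge> 0" using K(1) K2 fB(1) by simp
    fix t F assume t: "t0 \<le> t" "t \<le> T" and F: "finite (F :: (int ^ 'n) set)"
    have tp: "0 < t" using t t0 by simp
    have "(\<Sum>n\<in>F. norm (fc n t - freq_sq n *\<^sub>R mode n t)) \<le> (\<Sum>n\<in>F. weight n powr 0 * norm (fc n t) + weight n * norm (mode n t))"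
    proof (rule sum_mono)
      fix n :: "int ^ 'n"
      have "norm (fc n t - freq_sq n *\<^sub>R mode n t) \<le> norm (fc n t) + norm (freq_sq n *\<^sub>R mode n t)"
        by (rule norm_triangle_ineq4)
      also have "norm (freq_sq n *\<^sub>R mode n t) = freq_sq n * norm (mode n t)" by simp
      also have "\<dots> \<le> weight n * norm (mode n t)" by (intro mult_right_mono) auto
      finally show "norm (fc n t - freq_sq n *\<^sub>R mode n t) \<le> weight n powr 0 * norm (fc n t) + weight n * norm (mode n t)"
        using weight_pos[of n] by simp
    qed
    also have "\<dots> = (\<Sum>n\<in>F. weight n powr 0 * norm (fc n t)) + (\<Sum>n\<in>F. weight n * norm (mode n t))"
      by (rule sum.distrib)
    also have "\<dots> \<le> fB * sqrt (\<Sum>n\<in>F. tail n) * K2 + K * sqrt (\<Sum>n\<in>F. tail n)"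
    proof (rule add_mono[OF _ K(2)[OF t F]])
      have "power_kernel \<rho> t \<le> K2"
        unfolding power_kernel_def K2_def using powr_le_endpoints[OF t0(1) t] \<rho> by (intro divide_right_mono) auto
      then have "fB * sqrt (\<Sum>n\<in>F. tail n) * power_kernel \<rho> t \<le> fB * sqrt (\<Sum>n\<in>F. tail n) * K2"
        using fB(1) by (intro mult_left_mono) (auto simp: sum_nonneg tail_nonneg)
      then show "(\<Sum>n\<in>F. weight n powr 0 * norm (fc n t)) \<le> fB * sqrt (\<Sum>n\<in>F. tail n) * K2"
        using fc_weighted_sum[OF tp t(2) F, of 0] \<epsilon>(1) by linarith
    qed
    also have "\<dots> = (fB * K2 + K) * sqrt (\<Sum>n\<in>F. tail n)" by (simp add: algebra_simps)
    finally show "(\<Sum>n\<in>F. norm (fc n t - freq_sq n *\<^sub>R mode n t)) \<le> (fB * K2 + K) * sqrt (\<Sum>n\<in>F. tail n)" .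
  qed
qed

lemma time_deriv_uniform:
  assumes t0: "0 < t0" "t0 \<le> T"
  shows "uniform_limit (UNIV \<times> {t0..T}) (\<lambda>F p. \<Sum>n\<in>F. (fc n (snd p) - freq_sq n *\<^sub>R mode n (snd p)) * torus_char n (fst p))
     (\<lambda>p. time_deriv (fst p) (snd p)) (finite_subsets_at_top UNIV)"
proof -
  obtain K where K: "K \<ge> 0"
    "\<And>t F. t0 \<le> t \<Longrightarrow> t \<le> T \<Longrightarrow> finite F \<Longrightarrow> (\<Sum>n\<in>F. norm (fc n t - freq_sq n *\<^sub>R mode n t)) \<le> K * sqrt (\<Sum>n\<in>F. tail n)"
    by (rule time_deriv_sum_bound[OF t0]) (rule that, assumption, blast)
  show ?thesis unfolding time_deriv_def
  proof (rule uniform_limit_sqrt_tail(2)[OF tail_summable tail_nonneg K(1)])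
    fix F :: "(int ^ 'n) set" and p :: "(real ^ 'n) \<times> real"
    assume F: "finite F" and p: "p \<in> UNIV \<times> {t0..T}"
    have "norm ((fc n (snd p) - freq_sq n *\<^sub>R mode n (snd p)) * torus_char n (fst p)) = norm (fc n (snd p) - freq_sq n *\<^sub>R mode n (snd p))" for n
      by (simp only: norm_mult norm_cis mult_1_right)
    then show "(\<Sum>n\<in>F. norm ((fc n (snd p) - freq_sq n *\<^sub>R mode n (snd p)) * torus_char n (fst p))) \<le> K * sqrt (\<Sum>n\<in>F. tail n)"
      using K(2)[of "snd p" F] p F by (simp add: mem_Times_iff)
  qed
qed

lemma time_deriv_continuous: "continuous_on (UNIV \<times> {0<..T}) (\<lambda>p. time_deriv (fst p) (snd p))"
proof (rule continuous_on_UNIV_times_Ioc)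
  fix t0 assume t0: "0 < t0" "t0 \<le> T"
  show "continuous_on (UNIV \<times> {t0..T}) (\<lambda>p. time_deriv (fst p) (snd p))"
  proof (rule uniform_limit_theorem[OF _ time_deriv_uniform[OF t0]])
    have s: "continuous_on (UNIV \<times> {t0..T}) (\<lambda>p :: (real ^ 'n) \<times> real. h (snd p))" if "continuous_on {0<..T} h" for h :: "real \<Rightarrow> complex"
      by (rule continuous_on_compose2[OF that continuous_on_snd[OF continuous_on_id]]) (use t0 in auto)
    have c: "continuous_on (UNIV \<times> {t0..T}) (\<lambda>p :: (real ^ 'n) \<times> real. torus_char n (fst p))" for n
      by (rule continuous_on_compose2[OF continuous_on_torus_char continuous_on_fst[OF continuous_on_id]]) auto
    show "\<forall>\<^sub>F F in finite_subsets_at_top UNIV. continuous_on (UNIV \<times> {t0..T})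
        (\<lambda>p. \<Sum>n\<in>F. (fc n (snd p) - freq_sq n *\<^sub>R mode n (snd p)) * torus_char n (fst p))"
      by (intro always_eventually allI continuous_on_sum continuous_on_mult continuous_on_diff continuous_on_scaleR
          continuous_on_const s c fc_continuous mode_continuous)
  qed simp
qed

lemma duhamel_int_0: "duhamel_int n 0 = 0"
  by (simp add: duhamel_int_def half_conv_def set_lebesgue_integral_def)

lemma duhamel_int_continuous: "continuous_on {0..T} (duhamel_int n)"
  unfolding continuous_on_def
proof
  fix t assume t: "t \<in> {0..T}"
  show "(duhamel_int n \<longlongrightarrow> duhamel_int n t) (at t within {0..T})"
  proof (cases "t = 0")
    case True
    define M where "M = fB * sqrt (\<Sum>m\<in>{n}. tail m) / Gamma (1 + \<rho>)"
    have b: "norm (duhamel_int n s) \<le> M * s powr \<rho>" if "0 < s" "s \<le> T" for s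
      using duhamel_int_sum[OF that, of "{n}"] by (simp add: M_def power_kernel_def mult_ac)
    have "continuous_on {0..T} (\<lambda>s. M * s powr \<rho>)"
      using \<rho> by (intro continuous_on_mult continuous_on_const continuous_on_powr' continuous_on_id) auto
    then have "\<forall>s0\<in>{0..T}. ((\<lambda>s. M * s powr \<rho>) \<longlongrightarrow> M * s0 powr \<rho>) (at s0 within {0..T})"
      by (simp only: continuous_on_def)
    from bspec[OF this, of 0] have L: "((\<lambda>s. M * s powr \<rho>) \<longlongrightarrow> 0) (at 0 within {0..T})" using T by simp
    have "(duhamel_int n \<longlongrightarrow> 0) (at 0 within {0..T})"
    proof (rule Lim_null_comparison[OF _ L])
      show "\<forall>\<^sub>F s in at 0 within {0..T}. norm (duhamel_int n s) \<le> M * s powr \<rho>"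
        unfolding eventually_at_filter by (intro always_eventually allI impI b) auto
    qed
    then show ?thesis using True by (simp add: duhamel_int_0)
  next
    case False
    then have tp: "0 < t" "t \<le> T" using t by auto
    have "continuous (at t within {0<..T}) (duhamel_int n)"
      using duhamel_facts(4)[OF tp] by (rule has_vector_derivative_continuous)
    then have "(duhamel_int n \<longlongrightarrow> duhamel_int n t) (at t within {0<..T})" by (simp add: continuous_within)
    moreover have "at t within {0..T} = at t within {0<..T}"
      by (rule at_within_nhd[of _ "{0<..}"]) (use tp in auto)
    ultimately show ?thesis by simp
  qed
qed

lemma phi_weighted_summable: "(\<lambda>n. weight n powr (- 1) * norm (fourier_coeff \<phi> n)) summable_on UNIV"
proof -
  obtain P where P: "P \<ge> 0"
    "\<And>F. finite F \<Longrightarrow> (\<Sum>n\<in>F. weight n powr (- 1) * norm (fourier_coeff \<phi> n)) \<le> P * sqrt (\<Sum>n\<in>F. tail n)"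
    by (rule phi_weighted_sum) (rule that, assumption, blast)
  have w: "norm (complex_of_real (weight n powr (- 1)) * fourier_coeff \<phi> n) = weight n powr (- 1) * norm (fourier_coeff \<phi> n)" for n
    by (simp only: norm_mult norm_of_real abs_of_nonneg[OF powr_ge_zero])
  have "(\<lambda>n. norm (complex_of_real (weight n powr (- 1)) * fourier_coeff \<phi> n)) summable_on UNIV"
  proof (rule uniform_limit_sqrt_tail(1)[OF tail_summable tail_nonneg P(1), where Y = "{()}" and g = "\<lambda>n _. complex_of_real (weight n powr (- 1)) * fourier_coeff \<phi> n"])
    show "(\<Sum>n\<in>F. norm (complex_of_real (weight n powr (- 1)) * fourier_coeff \<phi> n)) \<le> P * sqrt (\<Sum>n\<in>F. tail n)" if "finite F" for F
      unfolding w by (rule P(2)[OF that])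
  qed (rule singletonI)
  then show ?thesis by (simp only: w)
qed

lemma phi_relax_summable:
  assumes t: "0 < t" "t \<le> T"
  shows "(\<lambda>n. norm (fourier_coeff \<phi> n * of_real (ml_kernel \<rho> 1 (freq_sq n) t))) summable_on UNIV"
proof -
  obtain C where C: "C > 0"
    "\<And>l t. l \<ge> 0 \<Longrightarrow> 0 < t \<Longrightarrow> t \<le> T \<Longrightarrow> ml_kernel \<rho> 1 l t \<le> C / ((1 + l) * t powr \<rho>)"
    using ml_kernel_uniform_bounds[OF \<rho> T] by metis
  show ?thesis
  proof (rule summable_on_comparison_test[OF summable_on_cmult_right[OF phi_weighted_summable, of "C / t powr \<rho>"]])
    fix n :: "int ^ 'n"
    have "ml_kernel \<rho> 1 (freq_sq n) t \<ge> 0" using t by (intro ml_kernel_1_nonneg[OF \<rho>]) auto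
    then have "norm (fourier_coeff \<phi> n * of_real (ml_kernel \<rho> 1 (freq_sq n) t)) = norm (fourier_coeff \<phi> n) * ml_kernel \<rho> 1 (freq_sq n) t"
      by (simp only: norm_mult norm_of_real abs_of_nonneg)
    also have "\<dots> \<le> norm (fourier_coeff \<phi> n) * (C / (weight n * t powr \<rho>))"
      using C(2)[OF freq_sq_nonneg t, of n] by (intro mult_left_mono) auto
    also have "\<dots> = C / t powr \<rho> * (weight n powr (- 1) * norm (fourier_coeff \<phi> n))"
      using weight_pos[of n] by (simp add: powr_minus divide_inverse mult_ac)
    finally show "norm (fourier_coeff \<phi> n * of_real (ml_kernel \<rho> 1 (freq_sq n) t)) \<le> C / t powr \<rho> * (weight n powr (- 1) * norm (fourier_coeff \<phi> n))" .
  qed simp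
qed

lemma duhamel_int_bound:
  assumes t: "0 \<le> t" "t \<le> T" and F: "finite F"
  shows "(\<Sum>n\<in>F. norm (duhamel_int n t)) \<le> fB * power_kernel (1 + \<rho>) T * sqrt (\<Sum>n\<in>F. tail n)"
proof (cases "t = 0")
  case True
  have "fB * power_kernel (1 + \<rho>) T * sqrt (\<Sum>n\<in>F. tail n) \<ge> 0"
    using fB(1) \<rho> by (intro mult_nonneg_nonneg power_kernel_nonneg) (auto simp: sum_nonneg tail_nonneg)
  then show ?thesis using True by (simp add: duhamel_int_0)
next
  case False
  then have tp: "0 < t" using t by simp
  have "power_kernel (1 + \<rho>) t \<le> power_kernel (1 + \<rho>) T"
    unfolding power_kernel_def using t \<rho> by (intro divide_right_mono powr_mono2) auto
  then have "fB * power_kernel (1 + \<rho>) t * sqrt (\<Sum>n\<in>F. tail n) \<le> fB * power_kernel (1 + \<rho>) T * sqrt (\<Sum>n\<in>F. tail n)"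
    using fB(1) by (intro mult_right_mono mult_left_mono) (auto simp: sum_nonneg tail_nonneg)
  then show ?thesis using duhamel_int_sum[OF tp t(2) F] by linarith
qed

lemma duhamel_int_const_nonneg: "fB * power_kernel (1 + \<rho>) T \<ge> 0"
  using fB(1) \<rho> by (intro mult_nonneg_nonneg power_kernel_nonneg) auto

lemma duhamel_int_summable:
  assumes t: "0 \<le> t" "t \<le> T"
  shows "(\<lambda>n. norm (duhamel_int n t)) summable_on UNIV"
  by (rule uniform_limit_sqrt_tail(1)[OF tail_summable tail_nonneg duhamel_int_const_nonneg, where Y = "{t}" and g = duhamel_int])
    (use duhamel_int_bound t in auto)

lemma mode_int_summable:
  assumes t: "0 < t" "t \<le> T"
  shows "(\<lambda>n. norm (mode_int n t)) summable_on UNIV"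
  by (rule summable_on_comparison_test[OF summable_on_add[OF phi_relax_summable[OF t] duhamel_int_summable[OF less_imp_le[OF t(1)] t(2)]]])
    (auto simp: mode_int_def norm_triangle_ineq)

text \<open>This is what allows the fractional integral and the sum over the modes to be interchanged. Because
  \<open>e \<ge> 0\<close>, the part from \<open>\<phi>\<close> integrates exactly to \<open>\<bar>\<phi>\<^sub>n\<bar> E(t)\<close>.\<close>

lemma mode_abs_integral_summable:
  assumes t: "0 < t" "t \<le> T"
  shows "(\<lambda>n. set_lebesgue_integral lborel {0<..<t} (\<lambda>s. norm (power_kernel (1 - \<rho>) (t - s) *\<^sub>R mode n s))) summable_on UNIV"
proof -
  let ?k = "power_kernel (1 - \<rho>)"
  have r: "0 < 1 - \<rho>" using \<rho> by simp
  have k0: "?k s \<ge> 0" for s using r by (rule power_kernel_nonneg)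
  define S where "S = (\<lambda>n. half_conv ?k (\<lambda>s. norm (duhamel n s)) t)"
  have di: "set_integrable lborel {0<..<t} (\<lambda>s. ?k (t - s) *\<^sub>R norm (duhamel n s))" for n
    using set_integrable_norm[OF duhamel_facts(2)[OF t]] k0 by simp
  have ei: "set_integrable lborel {0<..<t} (\<lambda>s. (?k (t - s) *\<^sub>R ml_kernel \<rho> \<rho> (freq_sq n) s) * norm (fourier_coeff \<phi> n))" for n
    by (rule set_integrable_mult_left) (rule half_conv_power_ml_kernel(1)[OF \<rho>(1) \<rho>(1) r t(1)])
  have Ssum: "S summable_on UNIV"
  proof (rule nonneg_bdd_above_summable_on)
    show "S n \<ge> 0" for n
      unfolding S_def half_conv_def set_lebesgue_integral_def
      by (rule Bochner_Integration.integral_nonneg) (simp add: k0)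
    show "bdd_above (sum S ` {F. F \<subseteq> UNIV \<and> finite F})"
    proof (rule bdd_aboveI2)
      fix F :: "(int ^ 'n) set" assume "F \<in> {F. F \<subseteq> UNIV \<and> finite F}"
      then have F: "finite F" by simp
      have "sum S F = (\<Sum>n\<in>F. 1 * S n)" by simp
      also have "\<dots> = half_conv ?k (\<lambda>s. \<Sum>n\<in>F. 1 * norm (duhamel n s)) t"
        unfolding S_def by (rule half_conv_sum(2)[symmetric]) (rule di)
      also have "half_conv ?k (\<lambda>s. \<Sum>n\<in>F. 1 * norm (duhamel n s)) t \<le> norm (half_conv ?k (\<lambda>s. \<Sum>n\<in>F. 1 * norm (duhamel n s)) t)"
        unfolding real_norm_def by (rule abs_ge_self)
      also have "\<dots> \<le> 1 * (fB * sqrt (\<Sum>n\<in>F. tail n)) * power_kernel ((1 - \<rho>) + (\<rho> + \<rho>)) t"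
      proof (rule half_conv_dominated(3)[OF r _ t(1) borel_measurable_power_kernel])
        show "\<rho> + \<rho> > 0" using \<rho> by simp
        show "set_borel_measurable lborel {0<..<t} (\<lambda>s. \<Sum>n\<in>F. 1 * norm (duhamel n s))"
          by (rule continuous_on_set_borel_measurable[OF _ t(2)])
            (intro continuous_on_sum continuous_on_mult continuous_on_const continuous_on_norm duhamel_facts(1))
        show "\<bar>?k s\<bar> \<le> 1 * ?k s" for s using k0 by simp
        fix s assume s: "0 < s" "s < t"
        have "norm (\<Sum>n\<in>F. 1 * norm (duhamel n s)) = (\<Sum>n\<in>F. norm (duhamel n s))" by (simp add: sum_nonneg)
        also have "\<dots> \<le> fB * power_kernel (\<rho> + \<rho>) s * sqrt (\<Sum>n\<in>F. tail n)"
          by (rule duhamel_sum) (use s t F in auto)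
        finally show "norm (\<Sum>n\<in>F. 1 * norm (duhamel n s)) \<le> (fB * sqrt (\<Sum>n\<in>F. tail n)) * power_kernel (\<rho> + \<rho>) s"
          by (simp only: mult_ac)
      qed
      also have "\<dots> \<le> 1 * (fB * sqrt (infsum tail UNIV)) * power_kernel ((1 - \<rho>) + (\<rho> + \<rho>)) t"
        using fB(1) \<rho> by (intro mult_right_mono mult_left_mono real_sqrt_le_mono finite_sum_le_infsum[OF tail_summable F] power_kernel_nonneg)
          (auto simp: tail_nonneg)
      finally show "sum S F \<le> 1 * (fB * sqrt (infsum tail UNIV)) * power_kernel ((1 - \<rho>) + (\<rho> + \<rho>)) t" .
    qed
  qed
  show ?thesis
  proof (rule summable_on_comparison_test[OF summable_on_add[OF phi_relax_summable[OF t] Ssum]])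
    fix n :: "int ^ 'n"
    have E0: "ml_kernel \<rho> 1 (freq_sq n) t \<ge> 0" using t by (intro ml_kernel_1_nonneg[OF \<rho>]) auto
    have "set_lebesgue_integral lborel {0<..<t} (\<lambda>s. norm (?k (t - s) *\<^sub>R mode n s)) \<le>
       set_lebesgue_integral lborel {0<..<t} (\<lambda>s. (?k (t - s) *\<^sub>R ml_kernel \<rho> \<rho> (freq_sq n) s) * norm (fourier_coeff \<phi> n) + ?k (t - s) *\<^sub>R norm (duhamel n s))"
    proof (rule set_integral_mono[OF set_integrable_norm[OF mode_half_conv(1)[OF t]] set_integral_add(1)[OF ei di]])
      fix s assume s: "s \<in> {0<..<t}"
      have e0: "ml_kernel \<rho> \<rho> (freq_sq n) s \<ge> 0" using s by (intro ml_kernel_nonneg[OF \<rho>]) auto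
      have "norm (?k (t - s) *\<^sub>R mode n s) = norm ((?k (t - s) *\<^sub>R ml_kernel \<rho> \<rho> (freq_sq n) s) *\<^sub>R fourier_coeff \<phi> n + ?k (t - s) *\<^sub>R duhamel n s)"
        by (simp only: mode_split)
      also have "\<dots> \<le> norm ((?k (t - s) *\<^sub>R ml_kernel \<rho> \<rho> (freq_sq n) s) *\<^sub>R fourier_coeff \<phi> n) + norm (?k (t - s) *\<^sub>R duhamel n s)"
        by (rule norm_triangle_ineq)
      also have "\<dots> = (?k (t - s) *\<^sub>R ml_kernel \<rho> \<rho> (freq_sq n) s) * norm (fourier_coeff \<phi> n) + ?k (t - s) *\<^sub>R norm (duhamel n s)"
        using e0 k0 by (simp add: abs_mult)
      finally show "norm (?k (t - s) *\<^sub>R mode n s) \<le> (?k (t - s) *\<^sub>R ml_kernel \<rho> \<rho> (freq_sq n) s) * norm (fourier_coeff \<phi> n) + ?k (t - s) *\<^sub>R norm (duhamel n s)" .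
    qed
    also have "\<dots> = set_lebesgue_integral lborel {0<..<t} (\<lambda>s. (?k (t - s) *\<^sub>R ml_kernel \<rho> \<rho> (freq_sq n) s) * norm (fourier_coeff \<phi> n)) + S n"
      unfolding S_def half_conv_def by (rule set_integral_add(2)[OF ei di])
    also have "set_lebesgue_integral lborel {0<..<t} (\<lambda>s. (?k (t - s) *\<^sub>R ml_kernel \<rho> \<rho> (freq_sq n) s) * norm (fourier_coeff \<phi> n)) =
        half_conv ?k (ml_kernel \<rho> \<rho> (freq_sq n)) t * norm (fourier_coeff \<phi> n)"
      unfolding half_conv_def by (rule set_integral_mult_left)
    also have "half_conv ?k (ml_kernel \<rho> \<rho> (freq_sq n)) t = ml_kernel \<rho> 1 (freq_sq n) t"
      using half_conv_power_ml_kernel(2)[OF \<rho>(1) \<rho>(1) r t(1), of "freq_sq n"] by simp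
    also have "ml_kernel \<rho> 1 (freq_sq n) t * norm (fourier_coeff \<phi> n) = norm (fourier_coeff \<phi> n * of_real (ml_kernel \<rho> 1 (freq_sq n) t))"
      using E0 by (simp add: norm_mult)
    finally show "set_lebesgue_integral lborel {0<..<t} (\<lambda>s. norm (?k (t - s) *\<^sub>R mode n s)) \<le>
        norm (fourier_coeff \<phi> n * of_real (ml_kernel \<rho> 1 (freq_sq n) t)) + S n" .
    show "0 \<le> set_lebesgue_integral lborel {0<..<t} (\<lambda>s. norm (?k (t - s) *\<^sub>R mode n s))"
      unfolding set_lebesgue_integral_def by (rule Bochner_Integration.integral_nonneg) simp
  qed
qed

lemma u_half_conv:
  assumes t: "0 < t" "t \<le> T"
  shows "set_integrable lborel {0<..<t} (\<lambda>s. power_kernel (1 - \<rho>) (t - s) *\<^sub>R u x s)"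
    and "half_conv (power_kernel (1 - \<rho>)) (u x) t = (\<Sum>\<^sub>\<infinity>n. mode_int n t * torus_char n x)"
proof -
  let ?g = "\<lambda>n s. power_kernel (1 - \<rho>) (t - s) *\<^sub>R (mode n s * torus_char n x)"
  have gE: "?g n s = (power_kernel (1 - \<rho>) (t - s) *\<^sub>R mode n s) * torus_char n x" for n s by simp
  have gn: "norm (?g n s) = norm (power_kernel (1 - \<rho>) (t - s) *\<^sub>R mode n s)" for n s
    by (simp only: gE norm_mult norm_cis mult_1_right)
  have i: "set_integrable lborel {0<..<t} (?g n)" for n
    unfolding gE by (rule set_integrable_mult_left) (rule mode_half_conv(1)[OF t])
  have s: "(\<lambda>n. norm (?g n s)) summable_on UNIV" if "s \<in> {0<..<t}" for s
    unfolding gn unfolding norm_scaleR by (rule summable_on_cmult_right, rule mode_summable) (use that t in auto)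
  have ns: "(\<lambda>n. set_lebesgue_integral lborel {0<..<t} (\<lambda>s. norm (?g n s))) summable_on UNIV"
    unfolding gn by (rule mode_abs_integral_summable[OF t])
  have inner: "(\<Sum>\<^sub>\<infinity>n. ?g n s) = power_kernel (1 - \<rho>) (t - s) *\<^sub>R u x s" for s
    unfolding u_def scaleR_conv_of_real by (rule infsum_cmult_right')
  note S = set_integral_infsum[OF i s ns, unfolded inner]
  show "set_integrable lborel {0<..<t} (\<lambda>s. power_kernel (1 - \<rho>) (t - s) *\<^sub>R u x s)" by (rule S(1))
  have v: "set_lebesgue_integral lborel {0<..<t} (?g n) = mode_int n t * torus_char n x" for n
    unfolding gE set_integral_mult_left mode_half_conv(2)[OF t, unfolded half_conv_def] ..
  have "half_conv (power_kernel (1 - \<rho>)) (u x) t = (\<Sum>\<^sub>\<infinity>n. set_lebesgue_integral lborel {0<..<t} (?g n))"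
    unfolding half_conv_def by (rule S(2))
  also have "\<dots> = (\<Sum>\<^sub>\<infinity>n. mode_int n t * torus_char n x)" by (rule infsum_cong) (rule v)
  finally show "half_conv (power_kernel (1 - \<rho>)) (u x) t = (\<Sum>\<^sub>\<infinity>n. mode_int n t * torus_char n x)" .
qed

text \<open>The series of derivatives converges uniformly on \<open>[t\<^sub>0, T]\<close>, so it may be integrated term by term from
  \<open>t\<^sub>0\<close>; near \<open>0\<close> it need not be integrable, which is why the integration starts at \<open>t\<^sub>0 = t / 2\<close>.\<close>

lemma u_half_conv_derivative:
  assumes t: "0 < t" "t \<le> T"
  shows "(half_conv (power_kernel (1 - \<rho>)) (u x) has_vector_derivative time_deriv x t) (at t within {0<..T})"
proof -
  define V where "V = half_conv (power_kernel (1 - \<rho>)) (u x)"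
  define t0 where "t0 = t / 2"
  have t0: "0 < t0" "t0 \<le> T" "t0 \<le> t" using t by (auto simp: t0_def)
  define g where "g = (\<lambda>n s. (fc n s - freq_sq n *\<^sub>R mode n s) * torus_char n x)"
  have gc: "continuous_on {t0..r} (\<lambda>s. \<Sum>n\<in>F. g n s)" if "r \<le> T" for F r
  proof -
    have "continuous_on {0<..T} (\<lambda>s. \<Sum>n\<in>F. g n s)"
      unfolding g_def
      by (intro continuous_on_sum continuous_on_mult continuous_on_diff continuous_on_scaleR continuous_on_const fc_continuous mode_continuous)
    then show ?thesis by (rule continuous_on_subset) (use t0 that in auto)
  qed
  have u0: "uniform_limit {t0..T} (\<lambda>F s. \<Sum>n\<in>F. g n s) (time_deriv x) (finite_subsets_at_top UNIV)"
    unfolding uniform_limit_iff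
  proof (intro allI impI)
    fix e :: real assume e: "e > 0"
    have "\<forall>\<^sub>F F in finite_subsets_at_top UNIV. \<forall>p\<in>UNIV \<times> {t0..T}.
        dist (\<Sum>n\<in>F. (fc n (snd p) - freq_sq n *\<^sub>R mode n (snd p)) * torus_char n (fst p)) (time_deriv (fst p) (snd p)) < e"
      using time_deriv_uniform[OF t0(1,2)] e by (rule uniform_limitD)
    then show "\<forall>\<^sub>F F in finite_subsets_at_top UNIV. \<forall>s\<in>{t0..T}. dist (\<Sum>n\<in>F. g n s) (time_deriv x s) < e"
    proof eventually_elim
      case (elim F)
      show ?case
      proof
        fix s assume "s \<in> {t0..T}"
        then have "(x, s) \<in> UNIV \<times> {t0..T}" by simp
        from bspec[OF elim this] show "dist (\<Sum>n\<in>F. g n s) (time_deriv x s) < e" by (simp only: g_def fst_conv snd_conv)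
      qed
    qed
  qed
  have Vs: "((\<lambda>n. mode_int n s * torus_char n x) has_sum V s) UNIV" if "0 < s" "s \<le> T" for s
    unfolding V_def u_half_conv(2)[OF that] by (rule has_sum_infsum[OF trig_series_summable[OF mode_int_summable[OF that]]])
  have eq: "V r = V t0 + integral {t0..r} (time_deriv x)" if r: "r \<in> {t0..T}" for r
  proof -
    have rp: "0 < r" "r \<le> T" "t0 \<le> r" using r t0 by auto
    have ur: "uniform_limit {t0..r} (\<lambda>F s. \<Sum>n\<in>F. g n s) (time_deriv x) (finite_subsets_at_top UNIV)"
      by (rule uniform_limit_on_subset[OF u0]) (use rp in auto)
    obtain I J where IJ: "\<And>F. ((\<lambda>s. \<Sum>n\<in>F. g n s) has_integral I F) {t0..r}" "(time_deriv x has_integral J) {t0..r}"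
      "(I \<longlongrightarrow> J) (finite_subsets_at_top UNIV)"
      by (rule uniform_limit_integral[OF ur gc[OF rp(2)] finite_subsets_at_top_neq_bot]) (rule that, blast, assumption, assumption)
    have "((\<lambda>s. g n s) has_integral (mode_int n r * torus_char n x - mode_int n t0 * torus_char n x)) {t0..r}" for n
    proof (rule fundamental_theorem_of_calculus[OF rp(3)])
      fix s assume s: "s \<in> {t0..r}"
      have "(mode_int n has_vector_derivative (fc n s - freq_sq n *\<^sub>R mode n s)) (at s within {t0..r})"
        by (rule has_vector_derivative_within_subset[OF mode_int_derivative]) (use s t0 rp in auto)
      from bounded_linear.has_vector_derivative[OF bounded_linear_mult_left[of "torus_char n x"] this]
      show "((\<lambda>s. mode_int n s * torus_char n x) has_vector_derivative g n s) (at s within {t0..r})"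
        by (simp only: g_def)
    qed
    then have X: "((\<lambda>s. \<Sum>n\<in>F. g n s) has_integral (\<Sum>n\<in>F. mode_int n r * torus_char n x - mode_int n t0 * torus_char n x)) {t0..r}"
      if "finite F" for F using that by (intro has_integral_sum)
    have IF: "I F = (\<Sum>n\<in>F. mode_int n r * torus_char n x - mode_int n t0 * torus_char n x)" if "finite F" for F
      by (rule has_integral_unique[OF IJ(1) X[OF that]])
    have "((\<lambda>F. \<Sum>n\<in>F. mode_int n r * torus_char n x - mode_int n t0 * torus_char n x) \<longlongrightarrow> V r - V t0) (finite_subsets_at_top UNIV)"
      using has_sum_difference[OF Vs[OF rp(1,2)] Vs[OF t0(1,2)]] unfolding has_sum_def .
    moreover have "\<forall>\<^sub>F F in finite_subsets_at_top UNIV. (\<Sum>n\<in>F. mode_int n r * torus_char n x - mode_int n t0 * torus_char n x) = I F"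
      by (rule eventually_finite_subsets_at_top_weakI) (rule IF[symmetric])
    ultimately have "(I \<longlongrightarrow> V r - V t0) (finite_subsets_at_top UNIV)"
      by (rule Lim_transform_eventually)
    from tendsto_unique[OF _ IJ(3) this] have "J = V r - V t0" by simp
    then show ?thesis using integral_unique[OF IJ(2)] by simp
  qed
  have "continuous_on {t0..T} (time_deriv x)"
    by (rule uniform_limit_theorem[OF always_eventually[OF allI[OF gc[OF order_refl]]] u0 finite_subsets_at_top_neq_bot])
  then have "((\<lambda>r. integral {t0..r} (time_deriv x)) has_vector_derivative time_deriv x t) (at t within {t0..T})"
    by (rule integral_has_vector_derivative) (use t0 t in auto)
  from has_vector_derivative_add[OF has_vector_derivative_const[of "V t0"] this]
  have "((\<lambda>r. V t0 + integral {t0..r} (time_deriv x)) has_vector_derivative time_deriv x t) (at t within {t0..T})"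
    by simp
  then have "(V has_vector_derivative time_deriv x t) (at t within {t0..T})"
  proof (rule has_vector_derivative_transform[rotated 2])
    show "t \<in> {t0..T}" using t0 t by simp
    show "V r = V t0 + integral {t0..r} (time_deriv x)" if "r \<in> {t0..T}" for r by (rule eq[OF that])
  qed
  then show ?thesis unfolding at_within_half[OF t] V_def t0_def .
qed

text \<open>The part of the series that comes from \<open>\<phi>\<close> is continuous up to \<open>t = 0\<close> by the contraction property;
  the part from the source is a uniformly convergent series of functions vanishing at \<open>t = 0\<close>.\<close>

lemma initial_value_continuous:
  obtains v where "continuous_on (UNIV \<times> {0..T}) (\<lambda>(x, t). v x t)"
    "\<And>x. v x 0 = \<phi> x"
    "\<And>x t. 0 < t \<Longrightarrow> t \<le> T \<Longrightarrow> v x t = half_conv (power_kernel (1 - \<rho>)) (u x) t"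
proof -
  have s: "(\<lambda>n. norm (fourier_coeff \<phi> n * of_real (relax \<rho> (freq_sq n) t))) summable_on UNIV" if "0 < t" "t \<le> T" for t
    using phi_relax_summable[OF that] unfolding relax_eq_ml_kernel[OF that(1)] .
  obtain w where w: "continuous_on (UNIV \<times> {0..T}) (\<lambda>(x, t). w x t)"
    "\<And>x. 0 \<le> T \<Longrightarrow> w x 0 = \<phi> x"
    "\<And>x t. 0 < t \<Longrightarrow> t \<le> T \<Longrightarrow> w x t = (\<Sum>\<^sub>\<infinity>n. (fourier_coeff \<phi> n * of_real (relax \<rho> (freq_sq n) t)) * torus_char n x)"
    by (rule relax_series_continuous[OF \<rho> \<phi>C s]) (assumption, assumption, rule that, assumption, blast, blast)
  define q where "q = (\<lambda>p. \<Sum>\<^sub>\<infinity>n. duhamel_int n (snd p) * torus_char n (fst p :: real ^ 'n))"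
  have "uniform_limit (UNIV \<times> {0..T}) (\<lambda>F p. \<Sum>n\<in>F. duhamel_int n (snd p) * torus_char n (fst p)) q (finite_subsets_at_top UNIV)"
    unfolding q_def
  proof (rule uniform_limit_sqrt_tail(2)[OF tail_summable tail_nonneg duhamel_int_const_nonneg])
    fix F :: "(int ^ 'n) set" and p :: "(real ^ 'n) \<times> real"
    assume F: "finite F" and p: "p \<in> UNIV \<times> {0..T}"
    have "norm (duhamel_int n (snd p) * torus_char n (fst p)) = norm (duhamel_int n (snd p))" for n
      by (simp only: norm_mult norm_cis mult_1_right)
    then show "(\<Sum>n\<in>F. norm (duhamel_int n (snd p) * torus_char n (fst p))) \<le> fB * power_kernel (1 + \<rho>) T * sqrt (\<Sum>n\<in>F. tail n)"
      using duhamel_int_bound[of "snd p" F] p F by (simp add: mem_Times_iff)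
  qed
  then have qc: "continuous_on (UNIV \<times> {0..T}) q"
  proof (rule uniform_limit_theorem[rotated])
    have a: "continuous_on (UNIV \<times> {0..T}) (\<lambda>p :: (real ^ 'n) \<times> real. duhamel_int n (snd p))" for n
      by (rule continuous_on_compose2[OF duhamel_int_continuous continuous_on_snd[OF continuous_on_id]]) auto
    have c: "continuous_on (UNIV \<times> {0..T}) (\<lambda>p :: (real ^ 'n) \<times> real. torus_char n (fst p))" for n
      by (rule continuous_on_compose2[OF continuous_on_torus_char continuous_on_fst[OF continuous_on_id]]) auto
    show "\<forall>\<^sub>F F in finite_subsets_at_top UNIV. continuous_on (UNIV \<times> {0..T}) (\<lambda>p. \<Sum>n\<in>F. duhamel_int n (snd p) * torus_char n (fst p))"
      by (intro always_eventually allI continuous_on_sum continuous_on_mult a c)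
  qed simp
  show thesis
  proof (rule that[of "\<lambda>x t. w x t + q (x, t)"])
    have "continuous_on (UNIV \<times> {0..T}) (\<lambda>p. (\<lambda>(x, t). w x t) p + q p)" by (rule continuous_on_add[OF w(1) qc])
    then show "continuous_on (UNIV \<times> {0..T}) (\<lambda>(x, t). w x t + q (x, t))" by (simp add: case_prod_unfold)
    show "w x 0 + q (x, 0) = \<phi> x" for x using w(2)[of x] T by (simp add: q_def duhamel_int_0)
    fix x t assume t: "0 < t" "t \<le> T"
    have "((\<lambda>n. (fourier_coeff \<phi> n * of_real (relax \<rho> (freq_sq n) t)) * torus_char n x) has_sum w x t) UNIV"
      unfolding w(3)[OF t] by (rule has_sum_infsum[OF trig_series_summable[OF s[OF t]]])
    moreover have "((\<lambda>n. duhamel_int n t * torus_char n x) has_sum q (x, t)) UNIV"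
      unfolding q_def fst_conv snd_conv
      by (rule has_sum_infsum[OF trig_series_summable[OF duhamel_int_summable[OF less_imp_le[OF t(1)] t(2)]]])
    ultimately have "((\<lambda>n. (fourier_coeff \<phi> n * of_real (relax \<rho> (freq_sq n) t)) * torus_char n x + duhamel_int n t * torus_char n x) has_sum (w x t + q (x, t))) UNIV"
      by (rule has_sum_add)
    also have "(\<lambda>n. (fourier_coeff \<phi> n * of_real (relax \<rho> (freq_sq n) t)) * torus_char n x + duhamel_int n t * torus_char n x) =
        (\<lambda>n. mode_int n t * torus_char n x)"
      by (simp only: mode_int_def relax_eq_ml_kernel[OF t(1)] distrib_right)
    finally show "w x t + q (x, t) = half_conv (power_kernel (1 - \<rho>)) (u x) t"
      unfolding u_half_conv(2)[OF t] by (rule infsumI[symmetric])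
  qed
qed

end

lemma trig_series_converges:
  fixes d :: "int ^ 'n \<Rightarrow> complex"
  assumes "(\<lambda>n. norm (d n)) summable_on UNIV"
  shows "converges_abs_unif (\<lambda>n x. d n * torus_char n x)"
proof -
  have "norm (d n * torus_char n x) = norm (d n)" for n x by (simp only: norm_mult norm_cis mult_1_right)
  then show ?thesis unfolding converges_abs_unif_def using assms trig_series_uniform[OF assms] by simp
qed

text \<open>The series lemma applied to coefficients supported at one frequency.\<close>

lemma single_mode_C2:
  fixes n :: "int ^ 'n"
  shows "(\<lambda>x. c * torus_char n x) \<in> C2_torus"
    and "laplacian (\<lambda>x. c * torus_char n x) x = (- of_real (freq_sq n) * c) * torus_char n x"
proof -
  define d where "d = (\<lambda>m. if m = n then c else 0)"
  have single: "(\<Sum>\<^sub>\<infinity>m. h m) = h n" if "\<And>m. m \<noteq> n \<Longrightarrow> h m = 0" for h :: "int ^ 'n \<Rightarrow> complex"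
  proof -
    have "(\<Sum>\<^sub>\<infinity>m. h m) = (\<Sum>\<^sub>\<infinity>m\<in>{n}. h m)" by (rule infsum_cong_neutral) (use that in auto)
    then show ?thesis by simp
  qed
  have "(\<lambda>m. weight m * norm (d m)) summable_on {n}" by (rule summable_on_finite) simp
  also have "?this \<longleftrightarrow> (\<lambda>m. weight m * norm (d m)) summable_on UNIV"
    by (rule summable_on_cong_neutral) (auto simp: d_def)
  finally have s: "(\<lambda>m. weight m * norm (d m)) summable_on UNIV" .
  have e1: "(\<Sum>\<^sub>\<infinity>m. d m * torus_char m x) = c * torus_char n x" for x
    by (subst single) (simp_all add: d_def)
  have e2: "(\<Sum>\<^sub>\<infinity>m. (- of_real (freq_sq m) * d m) * torus_char m x) = (- of_real (freq_sq n) * c) * torus_char n x" for x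
    by (subst single) (simp_all add: d_def)
  show "(\<lambda>x. c * torus_char n x) \<in> C2_torus" using trig_series_C2(1)[OF s] unfolding e1 .
  show "laplacian (\<lambda>x. c * torus_char n x) x = (- of_real (freq_sq n) * c) * torus_char n x"
    using trig_series_C2(2)[OF s, of x] unfolding e1 e2 .
qed

lemma rl_deriv_eqI:
  assumes "0 < t" "t \<le> T"
    and "(half_conv (power_kernel (1 - \<rho>)) h has_vector_derivative d) (at t within {0<..T})"
  shows "rl_deriv T \<rho> h t = d"
proof -
  have "at t within {0<..T} \<noteq> bot"
  proof -
    have "t \<in> {t / 2..T}" "t / 2 < T" using assms by auto
    then have "at t within {t / 2..T} \<noteq> bot" by (simp add: trivial_limit_within islimpt_Icc)
    then show ?thesis by (simp add: at_within_half[OF assms(1,2)])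
  qed
  moreover have "frac_integral (\<rho> - 1) h = half_conv (power_kernel (1 - \<rho>)) h"
    by (rule ext) (rule frac_integral_eq_half_conv)
  ultimately show ?thesis
    unfolding rl_deriv_def using assms(3) by (simp add: vector_derivative_within)
qed

lemma rl_differentiableI:
  assumes "\<rho> < 1"
    and "\<And>t. 0 < t \<Longrightarrow> t \<le> T \<Longrightarrow> set_integrable lborel {0<..<t} (\<lambda>s. power_kernel (1 - \<rho>) (t - s) *\<^sub>R h s)"
    and "\<And>t. 0 < t \<Longrightarrow> t \<le> T \<Longrightarrow> (half_conv (power_kernel (1 - \<rho>)) h has_vector_derivative d t) (at t within {0<..T})"
  shows "rl_differentiable T \<rho> h"
proof -
  have e: "frac_integral (\<rho> - 1) h = half_conv (power_kernel (1 - \<rho>)) h"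
    by (rule ext) (rule frac_integral_eq_half_conv)
  show ?thesis
    unfolding rl_differentiable_def frac_integral_exists_iff[OF assms(1)] e
  proof (intro ballI conjI)
    fix t assume "t \<in> {0<..T}"
    then have t: "0 < t" "t \<le> T" by auto
    show "set_integrable lborel {0<..<t} (\<lambda>s. power_kernel (1 - \<rho>) (t - s) *\<^sub>R h s)" by (rule assms(2)[OF t])
    show "half_conv (power_kernel (1 - \<rho>)) h differentiable (at t within {0<..T})"
      by (rule differentiableI_vector[OF assms(3)[OF t]])
  qed
qed

context rl_problem
begin

lemma term_half_conv:
  assumes t: "0 < t" "t \<le> T"
  shows "set_integrable lborel {0<..<t} (\<lambda>s. power_kernel (1 - \<rho>) (t - s) *\<^sub>R (mode n s * z))"
    and "(half_conv (power_kernel (1 - \<rho>)) (\<lambda>s. mode n s * z) has_vector_derivative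
      (fc n t - freq_sq n *\<^sub>R mode n t) * z) (at t within {0<..T})"
proof -
  have "set_integrable lborel {0<..<t} (\<lambda>s. (power_kernel (1 - \<rho>) (t - s) *\<^sub>R mode n s) * z)"
    by (rule set_integrable_mult_left) (rule mode_half_conv(1)[OF t])
  then show "set_integrable lborel {0<..<t} (\<lambda>s. power_kernel (1 - \<rho>) (t - s) *\<^sub>R (mode n s * z))"
    by (simp only: mult_scaleR_left)
  have "((\<lambda>t. mode_int n t * z) has_vector_derivative (fc n t - freq_sq n *\<^sub>R mode n t) * z) (at t within {0<..T})"
    by (rule bounded_linear.has_vector_derivative[OF bounded_linear_mult_left mode_int_derivative[OF t]])
  then show "(half_conv (power_kernel (1 - \<rho>)) (\<lambda>s. mode n s * z) has_vector_derivative
      (fc n t - freq_sq n *\<^sub>R mode n t) * z) (at t within {0<..T})"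
  proof (rule has_vector_derivative_transform[rotated 2])
    show "t \<in> {0<..T}" using t by simp
    show "half_conv (power_kernel (1 - \<rho>)) (\<lambda>s. mode n s * z) r = mode_int n r * z" if "r \<in> {0<..T}" for r
      using that mode_half_conv(2)[of r n] by (simp add: half_conv_mult_right)
  qed
qed

lemma series_term_fun: "series_term \<rho> \<phi> f n x = (\<lambda>t. mode n t * torus_char n x)"
  by (rule ext) (rule series_term_eq)

lemma term_rl_deriv:
  assumes t: "0 < t" "t \<le> T"
  shows "rl_deriv T \<rho> (series_term \<rho> \<phi> f n x) t = (fc n t - freq_sq n *\<^sub>R mode n t) * torus_char n x"
  unfolding series_term_fun by (rule rl_deriv_eqI[OF t term_half_conv(2)[OF t]])

lemma u_rl_deriv:
  assumes t: "0 < t" "t \<le> T"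
  shows "rl_deriv T \<rho> (u x) t = time_deriv x t"
  by (rule rl_deriv_eqI[OF t u_half_conv_derivative[OF t]])

lemma u_C2:
  assumes t: "0 < t" "t \<le> T"
  shows "(\<lambda>x. u x t) \<in> C2_torus"
    and "laplacian (\<lambda>x. u x t) x = (\<Sum>\<^sub>\<infinity>n. (- of_real (freq_sq n) * mode n t) * torus_char n x)"
  unfolding u_def by (rule trig_series_C2[OF mode_weighted_summable[OF t]])+

lemma freq_mode_summable:
  assumes t: "0 < t" "t \<le> T"
  shows "(\<lambda>n. norm (- complex_of_real (freq_sq n) * mode n t)) summable_on UNIV"
proof (rule summable_on_comparison_test[OF mode_weighted_summable[OF t]])
  fix n :: "int ^ 'n"
  have "norm (- complex_of_real (freq_sq n) * mode n t) = freq_sq n * norm (mode n t)"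
    by (simp add: norm_mult norm_power)
  also have "\<dots> \<le> weight n * norm (mode n t)" by (intro mult_right_mono) auto
  finally show "norm (- complex_of_real (freq_sq n) * mode n t) \<le> weight n * norm (mode n t)" .
qed simp

lemma time_deriv_eq:
  assumes t: "0 < t" "t \<le> T"
  shows "time_deriv x t = f x t + laplacian (\<lambda>x. u x t) x"
    and "(\<lambda>n. norm (fc n t - freq_sq n *\<^sub>R mode n t)) summable_on UNIV"
proof -
  have "((\<lambda>n. fc n t * torus_char n x) has_sum f x t) UNIV"
    unfolding f_fourier_series(2)[OF t] by (rule has_sum_infsum[OF trig_series_summable[OF f_fourier_series(1)[OF t]]])
  moreover have "((\<lambda>n. (- of_real (freq_sq n) * mode n t) * torus_char n x) has_sum laplacian (\<lambda>x. u x t) x) UNIV"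
    unfolding u_C2(2)[OF t] by (rule has_sum_infsum[OF trig_series_summable[OF freq_mode_summable[OF t]]])
  ultimately have "((\<lambda>n. fc n t * torus_char n x + (- of_real (freq_sq n) * mode n t) * torus_char n x) has_sum
      (f x t + laplacian (\<lambda>x. u x t) x)) UNIV"
    by (rule has_sum_add)
  also have "(\<lambda>n. fc n t * torus_char n x + (- of_real (freq_sq n) * mode n t) * torus_char n x) =
      (\<lambda>n. (fc n t - freq_sq n *\<^sub>R mode n t) * torus_char n x)"
    by (rule ext) (simp add: scaleR_conv_of_real algebra_simps)
  finally show "time_deriv x t = f x t + laplacian (\<lambda>x. u x t) x"
    unfolding time_deriv_def by (rule infsumI)
  show "(\<lambda>n. norm (fc n t - freq_sq n *\<^sub>R mode n t)) summable_on UNIV"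
  proof (rule summable_on_comparison_test[OF summable_on_add[OF f_fourier_series(1)[OF t] freq_mode_summable[OF t]]])
    show "norm (fc n t - freq_sq n *\<^sub>R mode n t) \<le> norm (fc n t) + norm (- complex_of_real (freq_sq n) * mode n t)" for n
      using norm_triangle_ineq[of "fc n t" "- complex_of_real (freq_sq n) * mode n t"] by (simp add: scaleR_conv_of_real)
  qed simp
qed

lemma torus_char_period: "torus_char n (x + axis j (2 * pi)) = torus_char n x"
  using periodic_torus_char[of n] by (simp only: periodic_def)

lemma u_periodic: "u (x + axis j (2 * pi)) = u x"
  by (rule ext) (simp only: u_def torus_char_period)

lemma time_deriv_C_torus_time: "time_deriv \<in> C_torus_time {0<..T}"
proof -
  have "periodic (\<lambda>x. time_deriv x t)" for t
    unfolding periodic_def time_deriv_def torus_char_period by simp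
  then show ?thesis using time_deriv_continuous by (simp add: C_torus_time_def case_prod_unfold)
qed

lemma u_is_solution: "is_solution T \<rho> \<phi> f u"
  unfolding is_solution_def
proof (intro conjI allI ballI)
  have C_cong: "G \<in> C_torus_time {0<..T}" if "H \<in> C_torus_time {0<..T}" "\<And>x t. 0 < t \<Longrightarrow> t \<le> T \<Longrightarrow> G x t = H x t"
    for G H :: "real ^ 'n \<Rightarrow> real \<Rightarrow> complex"
  proof -
    have p: "periodic (\<lambda>x. G x t)" if t: "t \<in> {0<..T}" for t
      using \<open>H \<in> C_torus_time {0<..T}\<close> t that(1) \<open>\<And>x t. 0 < t \<Longrightarrow> t \<le> T \<Longrightarrow> G x t = H x t\<close>
      by (simp add: C_torus_time_def periodic_def)
    have "continuous_on (UNIV \<times> {0<..T}) (\<lambda>(x, t). H x t)" using that(1) by (simp add: C_torus_time_def)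
    then have "continuous_on (UNIV \<times> {0<..T}) (\<lambda>(x, t). G x t)"
      by (rule continuous_on_eq) (use that(2) in auto)
    then show ?thesis using p by (simp add: C_torus_time_def)
  qed
  show "rl_differentiable T \<rho> (u x)" for x
    by (rule rl_differentiableI[OF \<rho>(2) u_half_conv(1) u_half_conv_derivative])
  show "(\<lambda>x. rl_deriv T \<rho> (u x)) \<in> C_torus_time {0<..T}"
    by (rule C_cong[OF time_deriv_C_torus_time]) (rule u_rl_deriv)
  show "(\<lambda>x. u x t) \<in> C2_torus" if "t \<in> {0<..T}" for t
    using u_C2(1)[of t] that by simp
  show "(\<lambda>x t. A_op (\<lambda>y. u y t) x) \<in> C_torus_time {0<..T}"
  proof (rule C_cong[of "\<lambda>x t. f x t - time_deriv x t"])
    show "(\<lambda>x t. f x t - time_deriv x t) \<in> C_torus_time {0<..T}"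
      using fC time_deriv_C_torus_time
      by (auto simp: C_torus_time_def periodic_def case_prod_unfold intro: continuous_on_diff)
    show "A_op (\<lambda>y. u y t) x = f x t - time_deriv x t" if "0 < t" "t \<le> T" for x t
      using time_deriv_eq(1)[OF that, of x] by (simp add: A_op_def)
  qed
  show "rl_deriv T \<rho> (u x) t - laplacian (\<lambda>y. u y t) x = f x t" if "t \<in> {0<..T}" for x t
    using that u_rl_deriv[of t x] time_deriv_eq(1)[of t x] by simp
  obtain v where v: "continuous_on (UNIV \<times> {0..T}) (\<lambda>(x, t). v x t)"
    "\<And>x. v x 0 = \<phi> x"
    "\<And>x t. 0 < t \<Longrightarrow> t \<le> T \<Longrightarrow> v x t = half_conv (power_kernel (1 - \<rho>)) (u x) t"
    by (rule initial_value_continuous) (rule that, assumption, blast, blast)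
  have "periodic (\<lambda>x. v x t)" if "t \<in> {0..T}" for t
  proof (cases "t = 0")
    case True
    then show ?thesis using \<phi>C v(2) by (simp add: C_torus_def)
  next
    case False
    then show ?thesis using that v(3) by (simp add: periodic_def u_periodic)
  qed
  then have vC: "v \<in> C_torus_time {0..T}" using v(1) by (simp add: C_torus_time_def)
  show "\<exists>v\<in>C_torus_time {0..T}. \<forall>x. \<forall>t\<in>{0<..T}. v x t = frac_integral (\<rho> - 1) (u x) t"
    using vC v(3) by (intro bexI[of _ v]) (auto simp: frac_integral_eq_half_conv)
  show "(frac_integral (\<rho> - 1) (u x) \<longlongrightarrow> \<phi> x) (at_right 0)" for x
  proof -
    have "continuous_on {0..T} (\<lambda>t. (\<lambda>(x, t). v x t) (x, t))"
      by (rule continuous_on_compose2[OF v(1)]) (auto intro!: continuous_on_Pair continuous_on_const continuous_on_id)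
    then have "continuous_on {0..T} (v x)" by simp
    then have "\<forall>s\<in>{0..T}. (v x \<longlongrightarrow> v x s) (at s within {0..T})"
      by (simp only: continuous_on_def)
    from bspec[OF this, of 0] have L: "(v x \<longlongrightarrow> \<phi> x) (at 0 within {0..T})"
      using T v(2)[of x] by simp
    have "at_right 0 = at 0 within {0<..T}"
      by (rule at_within_nhd[of _ "{..<T}"]) (use T in auto)
    moreover have "(v x \<longlongrightarrow> \<phi> x) (at 0 within {0<..T})"
      by (rule tendsto_within_subset[OF L]) auto
    moreover have "\<forall>\<^sub>F t in at 0 within {0<..T}. v x t = frac_integral (\<rho> - 1) (u x) t"
      unfolding eventually_at_filter
      by (intro always_eventually allI impI) (simp add: v(3) frac_integral_eq_half_conv)
    ultimately show ?thesis by (simp only:) (rule Lim_transform_eventually)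
  qed
qed

lemma solution_and_series:
  "is_solution T \<rho> \<phi> f u \<and>
    (\<forall>n. \<forall>t\<in>{0<..T}. set_integrable lborel {0<..<t} (duhamel_integrand \<rho> f n t)) \<and>
    (\<forall>t\<in>{0<..T}. converges_abs_unif (\<lambda>n x. series_term \<rho> \<phi> f n x t) \<and>
       (\<forall>x. u x t = (\<Sum>\<^sub>\<infinity>n. series_term \<rho> \<phi> f n x t))) \<and>
    (\<forall>n x. rl_differentiable T \<rho> (series_term \<rho> \<phi> f n x)) \<and>
    (\<forall>n. \<forall>t\<in>{0<..T}. (\<lambda>x. series_term \<rho> \<phi> f n x t) \<in> C2_torus) \<and>
    (\<forall>t\<in>{0<..T}.
       converges_abs_unif (\<lambda>n x. rl_deriv T \<rho> (series_term \<rho> \<phi> f n x) t) \<and>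
       converges_abs_unif (\<lambda>n x. A_op (\<lambda>y. series_term \<rho> \<phi> f n y t) x))"
proof (intro conjI allI ballI)
  show "is_solution T \<rho> \<phi> f u" by (rule u_is_solution)
  show "rl_differentiable T \<rho> (series_term \<rho> \<phi> f n x)" for n x
    unfolding series_term_fun by (rule rl_differentiableI[OF \<rho>(2) term_half_conv])
  show "u x t = (\<Sum>\<^sub>\<infinity>n. series_term \<rho> \<phi> f n x t)" for x t
    by (simp only: u_def series_term_eq)
  show "(\<lambda>x. series_term \<rho> \<phi> f n x t) \<in> C2_torus" for n t
    unfolding series_term_eq by (rule single_mode_C2(1))
  fix t assume "t \<in> {0<..T}"
  then have t: "0 < t" "t \<le> T" by auto
  show "set_integrable lborel {0<..<t} (duhamel_integrand \<rho> f n t)" for n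
    by (rule duhamel_integrand_integrable[OF t])
  show "converges_abs_unif (\<lambda>n x. series_term \<rho> \<phi> f n x t)"
    unfolding series_term_eq by (rule trig_series_converges[OF mode_summable[OF t]])
  show "converges_abs_unif (\<lambda>n x. rl_deriv T \<rho> (series_term \<rho> \<phi> f n x) t)"
    unfolding term_rl_deriv[OF t] by (rule trig_series_converges[OF time_deriv_eq(2)[OF t]])
  have "A_op (\<lambda>y. series_term \<rho> \<phi> f n y t) x = (- (- of_real (freq_sq n) * mode n t)) * torus_char n x" for n x
    unfolding A_op_def series_term_eq single_mode_C2(2) by (rule mult_minus_left[symmetric])
  then show "converges_abs_unif (\<lambda>n x. A_op (\<lambda>y. series_term \<rho> \<phi> f n y t) x)"
    using trig_series_converges[of "\<lambda>n. - (- of_real (freq_sq n) * mode n t)"] freq_mode_summable[OF t]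
    by (simp only: norm_minus_cancel)
qed

end

theorem theorem1p2:
  fixes T \<rho> a :: real
    and \<phi> :: "real ^ 'n \<Rightarrow> complex"
    and f :: "real ^ 'n \<Rightarrow> real \<Rightarrow> complex"
  assumes "T > 0"
    and "0 < \<rho>" and "\<rho> < 1"
    and "a > real CARD('n) / 2"
    and "\<phi> \<in> C_torus" and "\<phi> \<in> L2b_torus (a - 2)"
    and "f \<in> C_torus_time {0<..T}"
    and "\<And>t. 0 < t \<Longrightarrow> t \<le> T \<Longrightarrow> (\<lambda>x. f x t) \<in> L2b_torus a"
    and "\<exists>G. continuous_on {0..T} G \<and>
           (\<forall>t\<in>{0<..T}. G t = L2b_norm_sq a (\<lambda>x. t powr (1 - \<rho>) *\<^sub>R f x t))"
  shows "\<exists>u. is_solution T \<rho> \<phi> f u \<and>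
    (\<forall>n. \<forall>t\<in>{0<..T}. set_integrable lborel {0<..<t} (duhamel_integrand \<rho> f n t)) \<and>
    (\<forall>t\<in>{0<..T}. converges_abs_unif (\<lambda>n x. series_term \<rho> \<phi> f n x t) \<and>
       (\<forall>x. u x t = (\<Sum>\<^sub>\<infinity>n. series_term \<rho> \<phi> f n x t))) \<and>
    (\<forall>n x. rl_differentiable T \<rho> (series_term \<rho> \<phi> f n x)) \<and>
    (\<forall>n. \<forall>t\<in>{0<..T}. (\<lambda>x. series_term \<rho> \<phi> f n x t) \<in> C2_torus) \<and>
    (\<forall>t\<in>{0<..T}.
       converges_abs_unif (\<lambda>n x. rl_deriv T \<rho> (series_term \<rho> \<phi> f n x) t) \<and>
       converges_abs_unif (\<lambda>n x. A_op (\<lambda>y. series_term \<rho> \<phi> f n y t) x))"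
proof -
  interpret rl_problem T \<rho> a \<phi> f
    by (rule rl_problem.intro) (fact assms)+
  show ?thesis by (rule exI) (rule solution_and_series)
qed

end
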